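(* Let $N\ge2$ and let $z,y\in S(\mathbf C^N)^\infty$, $z=(z^{(n)})_{n\in\mathbf N}$, $y=(y^{(n)})_{n\in\mathbf N}$. Let $a^z$, $a^y$ be the induced product representations of $\mathcal O_N$ by $z$ and $y$. Then the following holds. (i) $a^z\sim a^y$ if and only if there is an integer $k\ge0$ such that $\sum_{n=1}^\infty(1-|\langle z^{(n)}|y^{(n+k)}\rangle|)<\infty$ or $\sum_{n=1}^\infty(1-|\langle z^{(n+k)}|y^{(n)}\rangle|)<\infty$. (ii) $a^z$ is irreducible if and only if $\sum_{n=1}^\infty(1-|\langle z^{(n)}|z^{(n+k)}\rangle|)=\infty$ for any $k\ge1$. (iii) There is a family $\{a^z_n\}_{n\in\mathbf Z}$ of (nonzero) subrepresentations of the restriction $a^z|_{\mathcal O_N^{U(1)}}$ such that $a^z|_{\mathcal O_N^{U(1)}}=\bigoplus_{n\in\mathbf Z}a^z_n$. (iv) $a^z$ is $GP(z)$.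
   Context: $\mathcal O_N$ ($N\ge2$) is the Cuntz algebra: the universal C$^*$-algebra generated by $s_1,\dots,s_N$ with $s_i^*s_j=\delta_{ij}I$ and $\sum_{i=1}^N s_is_i^*=I$. A representation means a unital $*$-representation on a complex Hilbert space; $\sim$ between representations denotes unitary equivalence. $\mathbf N=\{1,2,3,\dots\}$; $\langle\cdot|\cdot\rangle$ is linear in the second variable. $S(\mathbf C^N)=\{z\in\mathbf C^N:\|z\|=1\}$, $S(\mathbf C^N)^\infty=\{(z^{(n)})_{n\in\mathbf N}: z^{(n)}\in S(\mathbf C^N)\}$. For $w=(w_1,\dots,w_N)\in\mathbf C^N$, $s(w)=w_1s_1+\cdots+w_Ns_N$. For $J=(j_1,\dots,j_n)$, $s_J=s_{j_1}\cdots s_{j_n}$. $\mathcal O_N^{U(1)}$ is the fixed-point subalgebra of $\mathcal O_N$ under the gauge action $s_i\mapsto cs_i$, $c\in U(1)=\{a\in\mathbf C:|a|=1\}$. $GP(z)$: for $z=(z^{(n)})_{n\in\mathbf N}\in S(\mathbf C^N)^\infty$, a representation $(\mathcal H,\pi)$ of $\mathcal O_N$ is $GP(z)$ if there is a unit cyclic vector $\Omega\in\mathcal H$ such that $\{\pi(s(z^{(n)})^*\cdots s(z^{(1)})^* )\Omega: n\in\mathbf N\}$ is an orthonormal family. Induced product representation: let $\mathcal K=\mathrm{Lin}\{s_1,\dots,s_N\}\subset\mathcal O_N$ with inner product $\langle s_i|s_j\rangle=\delta_{ij}$, identified with $\mathbf C^N$ via $w\leftrightarrow s(w)$. Let $\mathcal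 H^z_{(0)}$ be the Hilbert space inductive limit of $\mathcal K^{\otimes r}\to\mathcal K^{\otimes(r+1)}$, $\xi\mapsto\xi\otimes z^{(r+1)}$ ($r\ge1$), and $\Omega^z_{(0)}=\lim_r z^{(1)}\otimes\cdots\otimes z^{(r)}\in\mathcal H^z_{(0)}$. Let $\mathcal B_n=C^*\langle\{s_Js_K^*:J,K\in\{1,\dots,N\}^n\}\rangle$; the closure of $\bigcup_n\mathcal B_n$ is $\mathcal O_N^{U(1)}$. Let $\mathcal B_n$ act on $\mathcal K^{\otimes n}$ by $\pi_n(s_Js_K^* )v_L=\delta_{KL}v_J$, where $v_L=s_{l_1}\otimes\cdots\otimes s_{l_n}$ for $L=(l_1,\dots,l_n)$. The inductive limit of the $\pi_n$ is a representation $a^z_{(0)}$ of $\mathcal O_N^{U(1)}$ on $\mathcal H^z_{(0)}$. Put $F^z_{(0)}=\langle\Omega^z_{(0)}|a^z_{(0)}(\cdot)\Omega^z_{(0)}\rangle$, let $P:\mathcal O_N\to\mathcal O_N^{U(1)}$ be the canonical conditional expectation (averaging over the gauge action), and $F^z=F^z_{(0)}\circ P$, a state of $\mathcal O_N$. The induced product representation $(\mathcal H^z,a^z)$ of $\mathcal O_N$ by $z$ is the GNS representation of $F^z$. *)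

theory Defs
  imports "HOL-Analysis.Analysis"
begin

section \<open>Complex vector spaces, Hilbert spaces and C*-algebras\<close>

class complex_vector = real_vector +
  fixes scaleC :: "complex \<Rightarrow> 'a \<Rightarrow> 'a" (infixr "*\<^sub>C" 75)
  assumes scaleC_add_right: "c *\<^sub>C (x + y) = c *\<^sub>C x + c *\<^sub>C y"
    and scaleC_add_left: "(c + d) *\<^sub>C x = c *\<^sub>C x + d *\<^sub>C x"
    and scaleC_scaleC: "c *\<^sub>C d *\<^sub>C x = (c * d) *\<^sub>C x"
    and scaleR_scaleC: "r *\<^sub>R x = complex_of_real r *\<^sub>C x"

class complex_normed_vector = complex_vector + real_normed_vector +
  assumes norm_scaleC: "norm (c *\<^sub>C x) = cmod c * norm x"

text \<open>Inner products are linear in the second variable.\<close>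

class complex_inner = complex_normed_vector +
  fixes cinner :: "'a \<Rightarrow> 'a \<Rightarrow> complex"
  assumes cinner_commute: "cinner x y = cnj (cinner y x)"
    and cinner_add_right: "cinner x (y + z) = cinner x y + cinner x z"
    and cinner_scaleC_right: "cinner x (c *\<^sub>C y) = c * cinner x y"
    and cinner_self: "cinner x x = complex_of_real ((norm x)\<^sup>2)"

class chilbert_space = complex_inner + banach

text \<open>Unital C*-algebras. The zero algebra is admitted, so that the bounded operators on every
  Hilbert space are an instance.\<close>

class cstar_algebra = real_normed_algebra + monoid_mult + complex_normed_vector + banach +
  fixes star :: "'a \<Rightarrow> 'a"
  assumes mult_scaleC_left: "(c *\<^sub>C x) * y = c *\<^sub>C (x * y)"
    and mult_scaleC_right: "x * (c *\<^sub>C y) = c *\<^sub>C (x * y)"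
    and star_star: "star (star x) = x"
    and star_add: "star (x + y) = star x + star y"
    and star_mult: "star (x * y) = star y * star x"
    and star_scaleC: "star (c *\<^sub>C x) = cnj c *\<^sub>C star x"
    and cstar_identity: "norm (star x * x) = (norm x)\<^sup>2"

lemma scaleC_zero_right [simp]: "c *\<^sub>C (0::'a::complex_vector) = 0"
  using scaleC_add_right[of c "0::'a" 0] by simp

lemma scaleC_one [simp]: "1 *\<^sub>C (x::'a::complex_vector) = x"
  using scaleR_scaleC[of 1 x] by simp

lemma scaleC_minus1: "(- 1) *\<^sub>C (x::'a::complex_vector) = - x"
  using scaleR_scaleC[of "- 1" x] by simp

lemma scaleC_diff_right: "c *\<^sub>C (x - y) = c *\<^sub>C x - c *\<^sub>C (y::'a::complex_vector)"
  using scaleC_add_right[of c "x - y" y] by (simp add: algebra_simps)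

lemma bounded_linear_scaleC: "bounded_linear (\<lambda>x::'a::complex_normed_vector. c *\<^sub>C x)"
proof (rule bounded_linear_intro[where K = "cmod c"])
  show "c *\<^sub>C (r *\<^sub>R x) = r *\<^sub>R c *\<^sub>C x" for r and x :: 'a
    by (simp add: scaleR_scaleC scaleC_scaleC mult.commute)
qed (simp_all add: scaleC_add_right norm_scaleC mult.commute)

lemma cinner_add_left: "cinner (x + y) (z::'a::complex_inner) = cinner x z + cinner y z"
  by (metis cinner_commute cinner_add_right complex_cnj_add)

lemma cinner_scaleC_left: "cinner (c *\<^sub>C x) (z::'a::complex_inner) = cnj c * cinner x z"
  by (metis cinner_commute cinner_scaleC_right complex_cnj_mult)

lemma cinner_zero_right [simp]: "cinner (x::'a::complex_inner) 0 = 0"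
  using cinner_add_right[of x 0 0] by simp

lemma cinner_zero_left [simp]: "cinner 0 (x::'a::complex_inner) = 0"
  using cinner_add_left[of 0 0 x] by simp

lemma cinner_diff_right: "cinner (x::'a::complex_inner) (y - z) = cinner x y - cinner x z"
  using cinner_add_right[of x "y - z" z] by simp

lemma cinner_diff_left: "cinner (y - z) (x::'a::complex_inner) = cinner y x - cinner z x"
  using cinner_add_left[of "y - z" z x] by simp

lemma norm_add_square:
  "(norm (x + y))\<^sup>2 = (norm x)\<^sup>2 + (norm y)\<^sup>2 + 2 * Re (cinner x (y::'a::complex_inner))"
proof -
  have "complex_of_real ((norm (x + y))\<^sup>2) =
      cinner x x + cinner y y + (cinner x y + cnj (cinner x y))"
    by (simp add: cinner_self[symmetric] cinner_add_left cinner_add_right cinner_commute[of y x]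
        del: of_real_power)
  from arg_cong[OF this, of Re] show ?thesis
    by (simp add: cinner_self)
qed

lemma cinner_cauchy_schwarz: "cmod (cinner x (y::'a::complex_inner)) \<le> norm x * norm y"
proof -
  have re: "Re (cinner x z) \<le> norm x * norm z" for z :: 'a
  proof -
    have "(norm (x + z))\<^sup>2 \<le> (norm x + norm z)\<^sup>2"
      by (intro power_mono norm_triangle_ineq norm_ge_zero)
    then show ?thesis
      by (simp add: norm_add_square power2_sum)
  qed
  define c where "c = cnj (sgn (cinner x y))"
  have cc: "c * cinner x y = complex_of_real (cmod (cinner x y))"
    unfolding c_def by (cases "cinner x y = 0")
      (simp_all add: sgn_eq complex_norm_square[symmetric] power2_eq_square mult.commute)
  have "cmod (cinner x y) = Re (cinner x (c *\<^sub>C y))"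
    by (simp add: cinner_scaleC_right cc)
  also have "\<dots> \<le> norm x * (cmod c * norm y)"
    using re[of "c *\<^sub>C y"] by (simp add: norm_scaleC)
  also have "\<dots> \<le> norm x * norm y"
    unfolding c_def by (cases "cinner x y = 0") (simp_all add: norm_sgn)
  finally show ?thesis .
qed

lemma cinner_ext:
  assumes "\<And>z. cinner z x = cinner z (y::'a::complex_inner)"
  shows "x = y"
proof -
  have "cinner (x - y) (x - y) = 0"
    by (simp add: cinner_diff_right assms)
  then show ?thesis
    by (simp add: cinner_self)
qed

lemma riesz_representation:
  fixes \<phi> :: "'h::chilbert_space \<Rightarrow> complex"
  assumes bl: "bounded_linear \<phi>" and cl: "\<And>c x. \<phi> (c *\<^sub>C x) = c * \<phi> x"
  shows "\<exists>v. \<forall>x. \<phi> x = cinner v x"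
proof -
  interpret bounded_linear \<phi> by (fact bl)
  obtain B where B: "\<And>x. norm (\<phi> x) \<le> norm x * B"
    using bounded by blast
  define J where "J x = (norm x)\<^sup>2 - 2 * Re (\<phi> x)" for x
  have Jlow: "J x \<ge> - B\<^sup>2" for x
  proof -
    have "Re (\<phi> x) \<le> norm x * B"
      using complex_Re_le_cmod[of "\<phi> x"] B[of x] by linarith
    moreover have "0 \<le> (norm x - B)\<^sup>2" by simp
    ultimately show ?thesis
      unfolding J_def power2_diff by linarith
  qed
  define m where "m = Inf (range J)"
  have bdd: "bdd_below (range J)"
    using Jlow by (auto intro!: bdd_belowI)
  have m_le: "m \<le> J x" for x
    unfolding m_def by (rule cInf_lower[OF _ bdd]) simp
  have "\<exists>x. J x < m + 1 / real (Suc n)" for n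
    using cInf_lessD[of "range J" "m + 1 / real (Suc n)"] by (auto simp: m_def)
  then obtain X where X: "\<And>n. J (X n) < m + 1 / real (Suc n)"
    by metis
  have par: "(norm (x - y))\<^sup>2 = 2 * J x + 2 * J y - 4 * J ((1/2) *\<^sub>R (x + y))" for x y
  proof -
    have "(norm (x - y))\<^sup>2 = (norm x)\<^sup>2 + (norm y)\<^sup>2 - 2 * Re (cinner x y)"
      using norm_add_square[of x "- y"] cinner_diff_right[of x 0 y] by simp
    moreover have "(norm ((1/2) *\<^sub>R (x + y)))\<^sup>2 = (norm (x + y))\<^sup>2 / 4"
      by (simp only: norm_scaleR power_mult_distrib) (simp add: power2_eq_square)
    moreover have "Re (\<phi> ((1/2) *\<^sub>R (x + y))) = (Re (\<phi> x) + Re (\<phi> y)) / 2"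
      by (simp only: scaleR add) simp
    ultimately show ?thesis
      unfolding J_def norm_add_square by (simp add: field_simps)
  qed
  have dX: "(norm (X n - X k))\<^sup>2 \<le> 2 / real (Suc n) + 2 / real (Suc k)" for n k
    using par[of "X n" "X k"] X[of n] X[of k] m_le[of "(1/2) *\<^sub>R (X n + X k)"] by linarith
  have "Cauchy X"
  proof (rule metric_CauchyI)
    fix e :: real assume e: "0 < e"
    obtain M where M: "4 / e\<^sup>2 < real M"
      using reals_Archimedean2 by blast
    have "dist (X n) (X k) < e" if "n \<ge> M" "k \<ge> M" for n k
    proof -
      have M1: "1 / real (Suc i) < e\<^sup>2 / 4" if "i \<ge> M" for i
      proof -
        have "4 / e\<^sup>2 < real (Suc i)" using M that by simp
        then show ?thesis using e by (simp add: field_simps)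
      qed
      have "(norm (X n - X k))\<^sup>2 < e\<^sup>2"
        using dX[of n k] M1[OF that(1)] M1[OF that(2)] by simp
      then show ?thesis
        using e by (simp add: dist_norm power2_less_imp_less)
    qed
    then show "\<exists>M. \<forall>n\<ge>M. \<forall>k\<ge>M. dist (X n) (X k) < e" by blast
  qed
  then obtain v where v: "X \<longlonglongrightarrow> v"
    using Cauchy_convergent convergent_def by blast
  have "(\<lambda>n. J (X n)) \<longlonglongrightarrow> J v"
    unfolding J_def by (intro tendsto_intros v tendsto)
  moreover have "(\<lambda>n. m + 1 / real (Suc n)) \<longlonglongrightarrow> m + 0"
    by (intro tendsto_intros LIMSEQ_Suc lim_const_over_n)
  ultimately have "J v \<le> m + 0"
    using X by (intro LIMSEQ_le) (auto intro: less_imp_le)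
  then have Jv: "J v \<le> J x" for x
    using m_le[of x] by simp
  have re: "Re (cinner v h) = Re (\<phi> h)" for h
  proof (rule ccontr)
    define d where "d = Re (cinner v h) - Re (\<phi> h)"
    assume "Re (cinner v h) \<noteq> Re (\<phi> h)"
    then have d: "d \<noteq> 0" by (simp add: d_def)
    have q: "0 \<le> t\<^sup>2 * (norm h)\<^sup>2 + 2 * t * d" for t
    proof -
      have "(norm (v + t *\<^sub>R h))\<^sup>2 = (norm v)\<^sup>2 + t\<^sup>2 * (norm h)\<^sup>2 + 2 * t * Re (cinner v h)"
        unfolding norm_add_square
        by (simp add: power_mult_distrib) (simp add: scaleR_scaleC cinner_scaleC_right)
      moreover have "Re (\<phi> (v + t *\<^sub>R h)) = Re (\<phi> v) + t * Re (\<phi> h)"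
        by (simp add: add scaleR)
      ultimately show ?thesis
        using Jv[of "v + t *\<^sub>R h"] unfolding J_def d_def by (simp add: algebra_simps)
    qed
    define a where "a = (norm h)\<^sup>2 + 1"
    have a: "a > 0" "(norm h)\<^sup>2 < a" unfolding a_def by (auto intro: add_nonneg_pos)
    have "(- d / a)\<^sup>2 * (norm h)\<^sup>2 + 2 * (- d / a) * d = (d\<^sup>2 / a) * ((norm h)\<^sup>2 / a - 2)"
      using a by (simp add: field_simps power2_eq_square)
    moreover have "(d\<^sup>2 / a) * ((norm h)\<^sup>2 / a - 2) < 0"
      using a d by (intro mult_pos_neg) (simp_all add: field_simps)
    ultimately show False
      using q[of "- d / a"] by linarith
  qed
  have "\<phi> x = cinner v x" for x
  proof (rule complex_eqI)
    show "Re (\<phi> x) = Re (cinner v x)" by (simp add: re)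
    have "Re (\<phi> (\<i> *\<^sub>C x)) = Re (cinner v (\<i> *\<^sub>C x))" by (simp add: re)
    then show "Im (\<phi> x) = Im (cinner v x)" by (simp add: cl cinner_scaleC_right)
  qed
  then show ?thesis by blast
qed


section \<open>The C*-algebra of bounded operators on a Hilbert space\<close>

typedef (overloaded) 'h bop =
  "{T :: 'h::chilbert_space \<Rightarrow>\<^sub>L 'h. \<forall>c x. blinfun_apply T (c *\<^sub>C x) = c *\<^sub>C blinfun_apply T x}"
  morphisms blinfun_of_bop Bop
  by (rule exI[of _ 0]) simp

setup_lifting type_definition_bop

lift_definition apply_bop :: "'h::chilbert_space bop \<Rightarrow> 'h \<Rightarrow> 'h" (infixr "\<cdot>" 90)
  is blinfun_apply .

lemma apply_bop_scaleC: "T \<cdot> (c *\<^sub>C x) = c *\<^sub>C (T \<cdot> x)"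
  by transfer simp

lemma bop_eqI: "(\<And>x. S \<cdot> x = T \<cdot> x) \<Longrightarrow> S = T"
  by transfer (rule blinfun_eqI)

lemma bounded_linear_apply_bop: "bounded_linear ((\<cdot>) T)"
  by transfer (rule blinfun.bounded_linear_right)

lemma ex_adjoint:
  fixes T :: "'h::chilbert_space \<Rightarrow>\<^sub>L 'h"
  assumes T: "\<And>c x. blinfun_apply T (c *\<^sub>C x) = c *\<^sub>C blinfun_apply T x"
  shows "\<exists>S :: 'h \<Rightarrow>\<^sub>L 'h. (\<forall>c x. blinfun_apply S (c *\<^sub>C x) = c *\<^sub>C blinfun_apply S x) \<and>
    (\<forall>x y. cinner (blinfun_apply S x) y = cinner x (blinfun_apply T y))"
proof -
  have "\<exists>v. \<forall>y. cinner x (blinfun_apply T y) = cinner v y" for x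
  proof (rule riesz_representation)
    show "bounded_linear (\<lambda>y. cinner x (blinfun_apply T y))"
    proof (rule bounded_linear_intro[where K = "norm x * norm T"])
      show "norm (cinner x (blinfun_apply T y)) \<le> norm y * (norm x * norm T)" for y
        using order_trans[OF cinner_cauchy_schwarz mult_left_mono[OF norm_blinfun norm_ge_zero],
            of x T y] by (simp add: mult_ac)
    qed (simp_all add: blinfun.add_right blinfun.scaleR_right cinner_add_right,
         simp add: scaleR_scaleC cinner_scaleC_right scaleR_conv_of_real)
  qed (simp add: T cinner_scaleC_right)
  then obtain S where S: "\<And>x y. cinner x (blinfun_apply T y) = cinner (S x) y"
    by metis
  have S': "cinner y (S x) = cinner (blinfun_apply T y) x" for x y
    by (metis S cinner_commute)
  have add: "S (x + y) = S x + S y" for x y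
    by (rule cinner_ext) (simp add: S' cinner_add_right)
  have scale: "S (c *\<^sub>C x) = c *\<^sub>C S x" for c x
    by (rule cinner_ext) (simp add: S' cinner_scaleC_right)
  have "norm (S x) \<le> norm x * norm T" for x
  proof -
    have "(norm (S x))\<^sup>2 = cmod (cinner (S x) (S x))"
      by (simp only: cinner_self norm_of_real) simp
    also have "\<dots> \<le> norm (blinfun_apply T (S x)) * norm x"
      unfolding S' by (rule cinner_cauchy_schwarz)
    also have "\<dots> \<le> (norm T * norm (S x)) * norm x"
      by (intro mult_right_mono norm_blinfun norm_ge_zero)
    finally have "norm (S x) * norm (S x) \<le> norm (S x) * (norm x * norm T)"
      by (simp add: power2_eq_square mult_ac)
    then show ?thesis
      by (cases "norm (S x) = 0") (auto simp: mult_le_cancel_left intro: mult_nonneg_nonneg)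
  qed
  then have "bounded_linear S"
    by (intro bounded_linear_intro[where K = "norm T"])
      (auto simp: add scaleR_scaleC scale)
  then have "blinfun_apply (Blinfun S) = S"
    by (rule bounded_linear_Blinfun_apply)
  then show ?thesis
    using S scale by (intro exI[of _ "Blinfun S"]) simp
qed

instantiation bop :: (chilbert_space) "{real_normed_algebra, monoid_mult, complex_normed_vector}"
begin

lift_definition zero_bop :: "'a bop" is 0 by simp
lift_definition one_bop :: "'a bop" is id_blinfun by simp
lift_definition plus_bop :: "'a bop \<Rightarrow> 'a bop \<Rightarrow> 'a bop" is "(+)"
  by (simp add: blinfun.add_left scaleC_add_right)
lift_definition minus_bop :: "'a bop \<Rightarrow> 'a bop \<Rightarrow> 'a bop" is "(-)"
  by (simp add: blinfun.diff_left scaleC_diff_right)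
lift_definition uminus_bop :: "'a bop \<Rightarrow> 'a bop" is uminus
  by (simp add: blinfun.minus_left scaleC_minus1[symmetric] scaleC_scaleC)
lift_definition times_bop :: "'a bop \<Rightarrow> 'a bop \<Rightarrow> 'a bop" is blinfun_compose
  by simp
lift_definition scaleR_bop :: "real \<Rightarrow> 'a bop \<Rightarrow> 'a bop" is scaleR
  by (simp add: blinfun.scaleR_left scaleR_scaleC scaleC_scaleC mult.commute)
lift_definition scaleC_bop :: "complex \<Rightarrow> 'a bop \<Rightarrow> 'a bop"
  is "\<lambda>c T. Blinfun (\<lambda>x. c *\<^sub>C blinfun_apply T x)"
proof -
  fix c d x and T :: "'a \<Rightarrow>\<^sub>L 'a"
  assume T: "\<And>c x. blinfun_apply T (c *\<^sub>C x) = c *\<^sub>C blinfun_apply T x"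
  have "bounded_linear (\<lambda>x. c *\<^sub>C blinfun_apply T x)" for c
    by (rule bounded_linear_compose[OF bounded_linear_scaleC blinfun.bounded_linear_right])
  then show "blinfun_apply (Blinfun (\<lambda>x. c *\<^sub>C blinfun_apply T x)) (d *\<^sub>C x) =
      d *\<^sub>C blinfun_apply (Blinfun (\<lambda>x. c *\<^sub>C blinfun_apply T x)) x"
    by (simp add: bounded_linear_Blinfun_apply T scaleC_scaleC mult.commute)
qed
lift_definition norm_bop :: "'a bop \<Rightarrow> real" is norm .
definition dist_bop :: "'a bop \<Rightarrow> 'a bop \<Rightarrow> real" where "dist_bop S T = norm (S - T)"
definition [code del]: "(uniformity :: ('a bop \<times> 'a bop) filter) =
  (INF e\<in>{0 <..}. principal {(x, y). dist x y < e})"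
definition open_bop :: "'a bop set \<Rightarrow> bool" where [code del]:
  "open_bop S = (\<forall>x\<in>S. \<forall>\<^sub>F (x', y) in uniformity. x' = x \<longrightarrow> y \<in> S)"
definition sgn_bop :: "'a bop \<Rightarrow> 'a bop" where "sgn_bop T = scaleR (inverse (norm T)) T"

lemma apply_scaleC_bop: "(c *\<^sub>C T) \<cdot> x = c *\<^sub>C (T \<cdot> x)"
  by transfer (simp add: bounded_linear_Blinfun_apply
      bounded_linear_compose[OF bounded_linear_scaleC blinfun.bounded_linear_right])

lemma apply_bop_simps:
  "(0::'a bop) \<cdot> x = 0" "(1::'a bop) \<cdot> x = x" "(S + T) \<cdot> x = S \<cdot> x + T \<cdot> x"
  "(S - T) \<cdot> x = S \<cdot> x - T \<cdot> x" "(- T) \<cdot> x = - (T \<cdot> x)" "(S * T) \<cdot> x = S \<cdot> T \<cdot> x"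
  "(r *\<^sub>R T) \<cdot> x = r *\<^sub>R (T \<cdot> x)" "T \<cdot> (x + y) = T \<cdot> x + T \<cdot> y" "T \<cdot> 0 = 0"
  by (transfer; simp add: blinfun.add_left blinfun.diff_left blinfun.minus_left
      blinfun.scaleR_left blinfun.add_right)+

lemma norm_apply_bop: "norm (T \<cdot> x) \<le> norm T * norm x"
  by transfer (rule norm_blinfun)

lemma norm_bop_bound: "0 \<le> b \<Longrightarrow> (\<And>x. norm (T \<cdot> x) \<le> b * norm x) \<Longrightarrow> norm T \<le> b"
  by transfer (rule norm_blinfun_bound)

instance
proof
  fix S T U :: "'a bop" and r q :: real and c d :: complex
  show "S + T + U = S + (T + U)" "S + T = T + S" "0 + S = S" "- S + S = 0" "S - T = S + - T"
    by (transfer; simp)+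
  show "r *\<^sub>R (S + T) = r *\<^sub>R S + r *\<^sub>R T" "(r + q) *\<^sub>R S = r *\<^sub>R S + q *\<^sub>R S"
      "r *\<^sub>R q *\<^sub>R S = (r * q) *\<^sub>R S" "1 *\<^sub>R S = S"
    by (transfer; simp add: scaleR_add_right scaleR_add_left)+
  show "S * T * U = S * (T * U)" "1 * S = S" "S * 1 = S"
      "(S + T) * U = S * U + T * U" "S * (T + U) = S * T + S * U"
      "r *\<^sub>R S * T = r *\<^sub>R (S * T)"
    by (rule bop_eqI; simp add: apply_bop_simps apply_scaleC_bop)+
  show "S * r *\<^sub>R T = r *\<^sub>R (S * T)"
    by (rule bop_eqI) (simp add: apply_bop_simps apply_scaleC_bop apply_bop_scaleC scaleR_scaleC)
  show "c *\<^sub>C (S + T) = c *\<^sub>C S + c *\<^sub>C T" "(c + d) *\<^sub>C S = c *\<^sub>C S + d *\<^sub>C S"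
      "c *\<^sub>C d *\<^sub>C S = (c * d) *\<^sub>C S" "r *\<^sub>R S = complex_of_real r *\<^sub>C S"
    by (rule bop_eqI; simp add: apply_bop_simps apply_scaleC_bop scaleC_add_left scaleC_add_right scaleC_scaleC
        scaleR_scaleC apply_bop_scaleC)+
  show "dist S T = norm (S - T)" "sgn S = inverse (norm S) *\<^sub>R S"
    by (simp_all add: dist_bop_def sgn_bop_def)
  show "(uniformity :: ('a bop \<times> 'a bop) filter) =
      (INF e\<in>{0 <..}. principal {(x, y). dist x y < e})"
    by (rule uniformity_bop_def)
  show "open A = (\<forall>x\<in>A. \<forall>\<^sub>F (x', y) in uniformity. x' = x \<longrightarrow> y \<in> A)" for A :: "'a bop set"
    by (rule open_bop_def)
  show "norm S = 0 \<longleftrightarrow> S = 0" "norm (S + T) \<le> norm S + norm T"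
      "norm (r *\<^sub>R S) = \<bar>r\<bar> * norm S"
    by (transfer; simp add: norm_triangle_ineq)+
  show "norm (S * T) \<le> norm S * norm T"
    by transfer (rule norm_blinfun_compose)
  show nC: "norm (c *\<^sub>C S) = cmod c * norm S" for c and S :: "'a bop"
  proof -
    have le: "norm (c *\<^sub>C S) \<le> cmod c * norm S" for c and S :: "'a bop"
      by (rule norm_bop_bound)
        (simp add: mult_nonneg_nonneg norm_bop.rep_eq,
         simp add: apply_scaleC_bop norm_scaleC mult.assoc mult_left_mono norm_apply_bop)
    have "cmod c * norm S \<le> norm (c *\<^sub>C S)"
    proof (cases "c = 0")
      case False
      have "S = inverse c *\<^sub>C (c *\<^sub>C S)"
        using False by (intro bop_eqI) (simp add: apply_bop_simps apply_scaleC_bop scaleC_scaleC)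
      then have "norm S \<le> inverse (cmod c) * norm (c *\<^sub>C S)"
        using le[of "inverse c" "c *\<^sub>C S"] by (simp add: norm_inverse)
      then show ?thesis
        using False by (simp add: field_simps)
    qed (simp add: norm_bop.rep_eq)
    with le show ?thesis by (simp add: antisym)
  qed
qed

end

instance bop :: (chilbert_space) banach
proof
  fix X :: "nat \<Rightarrow> 'a::chilbert_space bop"
  assume "Cauchy X"
  have nr: "norm (blinfun_of_bop S - blinfun_of_bop T) = norm (S - T)" for S T :: "'a bop"
    by (simp add: norm_bop.rep_eq minus_bop.rep_eq)
  have dnorm: "dist S T = norm (S - T)" for S T :: "'a bop" by (rule dist_norm)
  have "Cauchy (\<lambda>n. blinfun_of_bop (X n))"
    using \<open>Cauchy X\<close> by (simp add: Cauchy_def dist_norm dnorm nr)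
  then obtain L where L: "(\<lambda>n. blinfun_of_bop (X n)) \<longlonglongrightarrow> L"
    using Cauchy_convergent convergent_def by blast
  have "blinfun_apply L (c *\<^sub>C x) = c *\<^sub>C blinfun_apply L x" for c x
  proof (rule LIMSEQ_unique)
    show "(\<lambda>n. blinfun_apply (blinfun_of_bop (X n)) (c *\<^sub>C x)) \<longlonglongrightarrow> blinfun_apply L (c *\<^sub>C x)"
      by (intro tendsto_intros L)
    have "(\<lambda>n. c *\<^sub>C blinfun_apply (blinfun_of_bop (X n)) x) \<longlonglongrightarrow> c *\<^sub>C blinfun_apply L x"
      by (intro bounded_linear.tendsto[OF bounded_linear_scaleC] tendsto_intros L)
    moreover have "blinfun_apply (blinfun_of_bop (X n)) (c *\<^sub>C x) =
        c *\<^sub>C blinfun_apply (blinfun_of_bop (X n)) x" for n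
      using blinfun_of_bop[of "X n"] by simp
    ultimately show "(\<lambda>n. blinfun_apply (blinfun_of_bop (X n)) (c *\<^sub>C x))
        \<longlonglongrightarrow> c *\<^sub>C blinfun_apply L x"
      by simp
  qed
  then have "blinfun_of_bop (Bop L) = L"
    by (intro Bop_inverse) simp
  then obtain T where T: "L = blinfun_of_bop T"
    by metis
  have "(\<lambda>n. norm (X n - T)) \<longlonglongrightarrow> 0"
    using L tendsto_norm_zero[OF LIM_zero[OF L]] by (simp add: T nr)
  then have "\<exists>T. \<forall>e>0. \<exists>M. \<forall>n\<ge>M. norm (X n - T) < e"
    unfolding LIMSEQ_iff by (intro exI[of _ T]) auto
  then show "convergent X"
    unfolding convergent_def lim_sequentially by (simp add: dnorm)
qed

instantiation bop :: (chilbert_space) cstar_algebra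
begin

definition star_bop :: "'a bop \<Rightarrow> 'a bop" where
  "star_bop T = (THE S. \<forall>x y. cinner (S \<cdot> x) y = cinner x (T \<cdot> y))"

lemma cinner_star_left: "cinner (star T \<cdot> x) y = cinner x (T \<cdot> y)"
proof -
  have "\<exists>S. \<forall>x y. cinner (S \<cdot> x) y = cinner x (T \<cdot> y)"
    by transfer (use ex_adjoint in blast)
  then obtain S where S: "\<And>x y. cinner (S \<cdot> x) y = cinner x (T \<cdot> y)"
    by blast
  have "R = S" if "\<forall>x y. cinner (R \<cdot> x) y = cinner x (T \<cdot> y)" for R
    by (rule bop_eqI, rule cinner_ext) (metis S that cinner_commute)
  with S have "star T = S"
    unfolding star_bop_def by (intro the_equality) auto
  with S show ?thesis by simp
qed

lemma cinner_star_right: "cinner x (star T \<cdot> y) = cinner (T \<cdot> x) y"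
  by (metis cinner_star_left cinner_commute)

instance
proof
  fix S T :: "'a bop" and c :: complex
  show "(c *\<^sub>C S) * T = c *\<^sub>C (S * T)" "S * (c *\<^sub>C T) = c *\<^sub>C (S * T)"
    by (rule bop_eqI; simp add: apply_bop_simps apply_scaleC_bop apply_bop_scaleC)+
  show "star (star S) = S" "star (S + T) = star S + star T" "star (S * T) = star T * star S"
      "star (c *\<^sub>C S) = cnj c *\<^sub>C star S"
    by (rule bop_eqI, rule cinner_ext; simp add: apply_bop_simps apply_scaleC_bop cinner_star_right cinner_star_left
        cinner_add_left cinner_add_right cinner_scaleC_left cinner_scaleC_right)+
  have sq: "(norm (S \<cdot> x))\<^sup>2 \<le> norm (star S * S) * (norm x)\<^sup>2" for S :: "'a bop" and x
  proof -
    have "(norm (S \<cdot> x))\<^sup>2 = cmod (cinner (S \<cdot> x) (S \<cdot> x))"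
      by (simp only: cinner_self norm_of_real) simp
    also have "\<dots> = cmod (cinner ((star S * S) \<cdot> x) x)"
      by (simp add: apply_bop_simps apply_scaleC_bop cinner_star_left)
    also have "\<dots> \<le> norm ((star S * S) \<cdot> x) * norm x"
      by (rule cinner_cauchy_schwarz)
    also have "\<dots> \<le> (norm (star S * S) * norm x) * norm x"
      by (intro mult_right_mono norm_apply_bop norm_ge_zero)
    finally show ?thesis by (simp add: power2_eq_square mult_ac)
  qed
  have n2: "(norm S)\<^sup>2 \<le> norm (star S * S)" for S :: "'a bop"
  proof -
    have "norm S \<le> sqrt (norm (star S * S))"
    proof (rule norm_bop_bound)
      show "norm (S \<cdot> x) \<le> sqrt (norm (star S * S)) * norm x" for x
        using real_le_rsqrt[OF sq[of S x]] by (simp add: real_sqrt_mult)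
    qed (simp add: norm_bop.rep_eq)
    moreover have "0 \<le> norm S" "0 \<le> norm (star S * S)"
      by (simp_all add: norm_bop.rep_eq)
    ultimately show ?thesis
      using power_mono[of "norm S" "sqrt (norm (star S * S))" 2] by simp
  qed
  have mle: "norm (S * T) \<le> norm S * norm T" for S T :: "'a bop"
    by transfer (rule norm_blinfun_compose)
  have ss: "star (star S) = S" for S :: "'a bop"
    by (rule bop_eqI, rule cinner_ext; simp add: cinner_star_right cinner_star_left)
  have le: "norm S \<le> norm (star S)" for S :: "'a bop"
  proof (cases "norm S = 0")
    case False
    have "norm S * norm S \<le> norm (star S) * norm S"
      using n2[of S] mle[of "star S" S] by (simp add: power2_eq_square)
    moreover have "0 < norm S"
      using False by (simp add: norm_bop.rep_eq)
    ultimately show ?thesis by (simp add: mult_le_cancel_right)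
  qed (simp add: norm_bop.rep_eq)
  have "norm (star S) = norm S"
    using le[of S] le[of "star S"] by (simp add: ss)
  then show "norm (star S * S) = (norm S)\<^sup>2"
    using n2[of S] mle[of "star S" S] by (simp add: power2_eq_square)
qed

end

section \<open>The Hilbert space of square-summable sequences\<close>

typedef ell2 = "{f :: nat \<Rightarrow> complex. summable (\<lambda>n. (cmod (f n))\<^sup>2)}"
  morphisms ell2_nth Ell2
  by (rule exI[of _ "\<lambda>_. 0"]) simp

setup_lifting type_definition_ell2

lemma summable_ell2_nth: "summable (\<lambda>n. (cmod (ell2_nth x n))\<^sup>2)"
  using ell2_nth by auto

lemma L2_set_le_ell2:
  assumes "summable (\<lambda>n. (cmod (f n))\<^sup>2)"
  shows "L2_set (\<lambda>n. cmod (f n)) {..<m} \<le> sqrt (\<Sum>n. (cmod (f n))\<^sup>2)"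
  unfolding L2_set_def by (intro real_sqrt_le_mono sum_le_suminf assms) auto

lemma ell2_bound:
  assumes "\<And>m. L2_set (\<lambda>n. cmod (f n)) {..<m} \<le> B"
  shows "summable (\<lambda>n. (cmod (f n))\<^sup>2)" "sqrt (\<Sum>n. (cmod (f n))\<^sup>2) \<le> B"
proof -
  have B: "0 \<le> B" using assms[of 0] by simp
  have le: "(\<Sum>n<m. (cmod (f n))\<^sup>2) \<le> B\<^sup>2" for m
    using power_mono[OF assms[of m], of 2] by (simp add: L2_set_def sum_nonneg)
  show s: "summable (\<lambda>n. (cmod (f n))\<^sup>2)"
    by (rule summableI_nonneg_bounded[of _ "B\<^sup>2"]) (simp_all add: le)
  show "sqrt (\<Sum>n. (cmod (f n))\<^sup>2) \<le> B"
    using suminf_le_const[OF s le] B real_le_lsqrt by blast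
qed

lemma ell2_add:
  assumes "summable (\<lambda>n. (cmod (f n))\<^sup>2)" "summable (\<lambda>n. (cmod (g n))\<^sup>2)"
  shows "summable (\<lambda>n. (cmod (f n + g n))\<^sup>2)"
    "sqrt (\<Sum>n. (cmod (f n + g n))\<^sup>2) \<le>
      sqrt (\<Sum>n. (cmod (f n))\<^sup>2) + sqrt (\<Sum>n. (cmod (g n))\<^sup>2)"
proof -
  have "L2_set (\<lambda>n. cmod (f n + g n)) {..<m} \<le>
      sqrt (\<Sum>n. (cmod (f n))\<^sup>2) + sqrt (\<Sum>n. (cmod (g n))\<^sup>2)" for m
  proof -
    have "L2_set (\<lambda>n. cmod (f n + g n)) {..<m} \<le> L2_set (\<lambda>n. cmod (f n) + cmod (g n)) {..<m}"
      by (rule L2_set_mono) (auto intro: norm_triangle_ineq)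
    also have "\<dots> \<le> L2_set (\<lambda>n. cmod (f n)) {..<m} + L2_set (\<lambda>n. cmod (g n)) {..<m}"
      by (rule L2_set_triangle_ineq)
    also have "\<dots> \<le> sqrt (\<Sum>n. (cmod (f n))\<^sup>2) + sqrt (\<Sum>n. (cmod (g n))\<^sup>2)"
      by (intro add_mono L2_set_le_ell2 assms)
    finally show ?thesis .
  qed
  from ell2_bound[of "\<lambda>n. f n + g n", OF this]
  show "summable (\<lambda>n. (cmod (f n + g n))\<^sup>2)"
    "sqrt (\<Sum>n. (cmod (f n + g n))\<^sup>2) \<le>
      sqrt (\<Sum>n. (cmod (f n))\<^sup>2) + sqrt (\<Sum>n. (cmod (g n))\<^sup>2)" by auto
qed

lemma ell2_scale:
  "summable (\<lambda>n. (cmod (f n))\<^sup>2) \<Longrightarrow> summable (\<lambda>n. (cmod (c * f n))\<^sup>2)"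
  by (simp add: norm_mult power_mult_distrib summable_mult)

lemma summable_cinner:
  assumes "summable (\<lambda>n. (cmod (f n))\<^sup>2)" "summable (\<lambda>n. (cmod (g n))\<^sup>2)"
  shows "summable (\<lambda>n. cnj (f n) * g n)"
proof (rule summable_comparison_test'[where N = 0])
  show "summable (\<lambda>n. (cmod (f n))\<^sup>2 + (cmod (g n))\<^sup>2)"
    by (intro summable_add assms)
  show "norm (cnj (f n) * g n) \<le> (cmod (f n))\<^sup>2 + (cmod (g n))\<^sup>2" for n
  proof -
    have "2 * (cmod (f n) * cmod (g n)) \<le> (cmod (f n))\<^sup>2 + (cmod (g n))\<^sup>2"
      using sum_squares_bound[of "cmod (f n)" "cmod (g n)"] by (simp add: mult.assoc)
    moreover have "0 \<le> cmod (f n) * cmod (g n)" by simp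
    ultimately have "cmod (f n) * cmod (g n) \<le> (cmod (f n))\<^sup>2 + (cmod (g n))\<^sup>2"
      by linarith
    then show ?thesis
      by (simp add: norm_mult)
  qed
qed

instantiation ell2 :: complex_inner
begin

lift_definition zero_ell2 :: ell2 is "\<lambda>_. 0" by simp
lift_definition plus_ell2 :: "ell2 \<Rightarrow> ell2 \<Rightarrow> ell2" is "\<lambda>f g n. f n + g n"
  by (rule ell2_add(1))
lift_definition uminus_ell2 :: "ell2 \<Rightarrow> ell2" is "\<lambda>f n. - f n" by simp
lift_definition minus_ell2 :: "ell2 \<Rightarrow> ell2 \<Rightarrow> ell2" is "\<lambda>f g n. f n - g n"
  using ell2_add(1)[of _ "\<lambda>n. - (_ n)"] by simp
lift_definition scaleC_ell2 :: "complex \<Rightarrow> ell2 \<Rightarrow> ell2" is "\<lambda>c f n. c * f n"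
  by (rule ell2_scale)
lift_definition scaleR_ell2 :: "real \<Rightarrow> ell2 \<Rightarrow> ell2" is "\<lambda>r f n. complex_of_real r * f n"
  by (rule ell2_scale)
lift_definition norm_ell2 :: "ell2 \<Rightarrow> real" is "\<lambda>f. sqrt (\<Sum>n. (cmod (f n))\<^sup>2)" .
lift_definition cinner_ell2 :: "ell2 \<Rightarrow> ell2 \<Rightarrow> complex" is "\<lambda>f g. \<Sum>n. cnj (f n) * g n" .
definition dist_ell2 :: "ell2 \<Rightarrow> ell2 \<Rightarrow> real" where "dist_ell2 x y = norm (x - y)"
definition [code del]: "(uniformity :: (ell2 \<times> ell2) filter) =
  (INF e\<in>{0 <..}. principal {(x, y). dist x y < e})"
definition open_ell2 :: "ell2 set \<Rightarrow> bool" where [code del]: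
  "open_ell2 S = (\<forall>x\<in>S. \<forall>\<^sub>F (x', y) in uniformity. x' = x \<longrightarrow> y \<in> S)"
definition sgn_ell2 :: "ell2 \<Rightarrow> ell2" where "sgn_ell2 x = scaleR (inverse (norm x)) x"

lemma norm_ell2_nth: "cmod (ell2_nth x k) \<le> norm x"
proof -
  have "(cmod (ell2_nth x k))\<^sup>2 \<le> (\<Sum>n<Suc k. (cmod (ell2_nth x n))\<^sup>2)"
    by (simp add: sum_nonneg)
  then have "cmod (ell2_nth x k) \<le> L2_set (\<lambda>n. cmod (ell2_nth x n)) {..<Suc k}"
    unfolding L2_set_def by (rule real_le_rsqrt)
  also have "\<dots> \<le> norm x"
    unfolding norm_ell2.rep_eq by (rule L2_set_le_ell2[OF summable_ell2_nth])
  finally show ?thesis .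
qed

instance
proof
  fix x y z :: ell2 and r q :: real and c d :: complex
  show "x + y + z = x + (y + z)" "x + y = y + x" "0 + x = x" "- x + x = 0" "x - y = x + - y"
    by (transfer; simp add: fun_eq_iff)+
  show "r *\<^sub>R (x + y) = r *\<^sub>R x + r *\<^sub>R y" "(r + q) *\<^sub>R x = r *\<^sub>R x + q *\<^sub>R x"
      "r *\<^sub>R q *\<^sub>R x = (r * q) *\<^sub>R x" "1 *\<^sub>R x = x"
      "c *\<^sub>C (x + y) = c *\<^sub>C x + c *\<^sub>C y" "(c + d) *\<^sub>C x = c *\<^sub>C x + d *\<^sub>C x"
      "c *\<^sub>C d *\<^sub>C x = (c * d) *\<^sub>C x" "r *\<^sub>R x = complex_of_real r *\<^sub>C x"
    by (transfer; simp add: fun_eq_iff algebra_simps)+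
  show "dist x y = norm (x - y)" "sgn x = inverse (norm x) *\<^sub>R x"
    by (simp_all add: dist_ell2_def sgn_ell2_def)
  show "(uniformity :: (ell2 \<times> ell2) filter) =
      (INF e\<in>{0 <..}. principal {(x, y). dist x y < e})"
    by (rule uniformity_ell2_def)
  show "open A = (\<forall>x\<in>A. \<forall>\<^sub>F (x', y) in uniformity. x' = x \<longrightarrow> y \<in> A)" for A :: "ell2 set"
    by (rule open_ell2_def)
  show "norm x = 0 \<longleftrightarrow> x = 0"
  proof
    assume "norm x = 0"
    then have "ell2_nth x k = 0" for k
      using norm_ell2_nth[of x k] by simp
    then show "x = 0"
      by transfer auto
  qed (transfer; simp)
  show "norm (x + y) \<le> norm x + norm y"
    by transfer (rule ell2_add(2))
  have nC: "norm (c *\<^sub>C x) = cmod c * norm x" for c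
    by transfer (simp add: norm_mult power_mult_distrib suminf_mult real_sqrt_mult)
  then show "norm (c *\<^sub>C x) = cmod c * norm x" .
  have "r *\<^sub>R x = complex_of_real r *\<^sub>C x"
    by transfer simp
  then show "norm (r *\<^sub>R x) = \<bar>r\<bar> * norm x"
    by (simp add: nC)
  show "cinner x y = cnj (cinner y x)"
  proof transfer
    fix f g :: "nat \<Rightarrow> complex"
    assume "summable (\<lambda>n. (cmod (f n))\<^sup>2)" "summable (\<lambda>n. (cmod (g n))\<^sup>2)"
    then have "(\<lambda>n. cnj (g n) * f n) sums (\<Sum>n. cnj (g n) * f n)"
      by (intro summable_sums summable_cinner)
    then have "(\<lambda>n. cnj (cnj (g n) * f n)) sums cnj (\<Sum>n. cnj (g n) * f n)"
      by (simp only: sums_cnj)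
    then show "(\<Sum>n. cnj (f n) * g n) = cnj (\<Sum>n. cnj (g n) * f n)"
      by (simp add: sums_iff mult.commute)
  qed
  show "cinner x (y + z) = cinner x y + cinner x z"
    by transfer (simp add: distrib_left suminf_add summable_cinner)
  show "cinner x (c *\<^sub>C y) = c * cinner x y"
    by transfer (simp add: mult.left_commute suminf_mult summable_cinner)
  show "cinner x x = complex_of_real ((norm x)\<^sup>2)"
  proof transfer
    fix f :: "nat \<Rightarrow> complex"
    assume f: "summable (\<lambda>n. (cmod (f n))\<^sup>2)"
    have "(\<Sum>n. cnj (f n) * f n) = (\<Sum>n. complex_of_real ((cmod (f n))\<^sup>2))"
      by (simp add: complex_norm_square mult.commute del: of_real_power)
    also have "\<dots> = complex_of_real (\<Sum>n. (cmod (f n))\<^sup>2)"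
      by (rule suminf_of_real[OF f, symmetric])
    finally show "(\<Sum>n. cnj (f n) * f n) = complex_of_real ((sqrt (\<Sum>n. (cmod (f n))\<^sup>2))\<^sup>2)"
      by (simp add: suminf_nonneg f)
  qed
qed

end

instance ell2 :: chilbert_space
proof
  fix X :: "nat \<Rightarrow> ell2"
  assume "Cauchy X"
  then have C: "\<exists>M. \<forall>i\<ge>M. \<forall>j\<ge>M. norm (X i - X j) < e" if "e > 0" for e
    using that by (auto simp: Cauchy_def dist_norm)
  have "Cauchy (\<lambda>i. ell2_nth (X i) k)" for k
  proof (rule metric_CauchyI)
    fix e :: real assume "0 < e"
    from C[OF this] obtain M where M: "\<And>i j. i \<ge> M \<Longrightarrow> j \<ge> M \<Longrightarrow> norm (X i - X j) < e"
      by blast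
    have "dist (ell2_nth (X i) k) (ell2_nth (X j) k) < e" if "i \<ge> M" "j \<ge> M" for i j
      using norm_ell2_nth[of "X i - X j" k] M[OF that]
      by (simp add: dist_norm minus_ell2.rep_eq)
    then show "\<exists>M. \<forall>i\<ge>M. \<forall>j\<ge>M. dist (ell2_nth (X i) k) (ell2_nth (X j) k) < e"
      by blast
  qed
  then have "\<exists>f. \<forall>k. (\<lambda>i. ell2_nth (X i) k) \<longlonglongrightarrow> f k"
    by (intro choice) (auto simp: Cauchy_convergent_iff convergent_def)
  then obtain f where f: "\<And>k. (\<lambda>i. ell2_nth (X i) k) \<longlonglongrightarrow> f k"
    by blast
  have key: "L2_set (\<lambda>k. cmod (ell2_nth (X i) k - f k)) {..<m} \<le> e"
    if M: "\<And>i j. i \<ge> M \<Longrightarrow> j \<ge> M \<Longrightarrow> norm (X i - X j) < e" and i: "i \<ge> M" for M e i m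
  proof (rule LIMSEQ_le_const2)
    show "(\<lambda>j. L2_set (\<lambda>k. cmod (ell2_nth (X i) k - ell2_nth (X j) k)) {..<m})
        \<longlonglongrightarrow> L2_set (\<lambda>k. cmod (ell2_nth (X i) k - f k)) {..<m}"
      unfolding L2_set_def by (intro tendsto_intros f)
    have "L2_set (\<lambda>k. cmod (ell2_nth (X i) k - ell2_nth (X j) k)) {..<m} \<le> e" if "j \<ge> M" for j
      using L2_set_le_ell2[OF summable_ell2_nth[of "X i - X j"], of m] M[OF i that]
      by (simp add: norm_ell2.rep_eq minus_ell2.rep_eq)
    then show "\<exists>J. \<forall>j\<ge>J. L2_set (\<lambda>k. cmod (ell2_nth (X i) k - ell2_nth (X j) k)) {..<m} \<le> e"
      by blast
  qed
  have sf: "summable (\<lambda>n. (cmod (f n))\<^sup>2)"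
  proof -
    from C[of 1] obtain M where M: "\<And>i j. i \<ge> M \<Longrightarrow> j \<ge> M \<Longrightarrow> norm (X i - X j) < 1"
      by auto
    have "summable (\<lambda>k. (cmod (ell2_nth (X M) k - f k))\<^sup>2)"
      by (rule ell2_bound(1)[OF key[OF M]]) auto
    then have "summable (\<lambda>k. (cmod (f k - ell2_nth (X M) k))\<^sup>2)"
      by (simp add: norm_minus_commute)
    from ell2_add(1)[OF this summable_ell2_nth[of "X M"]] show ?thesis by simp
  qed
  define L where "L = Ell2 f"
  have L: "ell2_nth L = f"
    unfolding L_def by (rule Ell2_inverse) (simp add: sf)
  have "\<exists>M. \<forall>i\<ge>M. norm (X i - L) < e" if e: "e > 0" for e
  proof -
    from C[of "e/2"] e obtain M where M: "\<And>i j. i \<ge> M \<Longrightarrow> j \<ge> M \<Longrightarrow> norm (X i - X j) < e/2"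
      by auto
    have "norm (X i - L) \<le> e/2" if "i \<ge> M" for i
      unfolding norm_ell2.rep_eq minus_ell2.rep_eq L
      by (rule ell2_bound(2)[OF key[OF M that]])
    then show ?thesis using e by (intro exI[of _ M]) fastforce
  qed
  then show "convergent X"
    unfolding convergent_def lim_sequentially by (auto simp: dist_norm)
qed

section \<open>The Cuntz algebra\<close>

lemma star_one [simp]: "star (1::'a::cstar_algebra) = 1"
  by (metis mult_1_left mult_1_right star_mult star_star)

lemma star_zero [simp]: "star (0::'a::cstar_algebra) = 0"
  using star_add[of "0::'a" 0] by simp

lemma star_diff: "star (x - y) = star x - star (y::'a::cstar_algebra)"
  using star_add[of "x - y" y] by simp

lemma norm_star: "norm (star x) = norm (x::'a::cstar_algebra)"
proof -
  have le: "norm x \<le> norm (star x)" for x :: 'a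
  proof (cases "x = 0")
    case False
    have "norm x * norm x \<le> norm (star x) * norm x"
      using norm_mult_ineq[of "star x" x] by (simp add: cstar_identity power2_eq_square)
    with False show ?thesis by simp
  qed simp
  show ?thesis
    using le[of x] le[of "star x"] by (simp add: star_star)
qed

lemma norm_one_le: "norm (1::'a::cstar_algebra) \<le> 1"
proof -
  have "norm (1::'a) = norm (1::'a) * norm (1::'a)"
    using cstar_identity[of "1::'a"] by (simp add: power2_eq_square)
  then show ?thesis
    by (metis dual_order.refl mult_cancel_right1 norm_zero zero_le_one)
qed

definition cuntz_family :: "('n::finite \<Rightarrow> 'a::cstar_algebra) \<Rightarrow> bool" where
  "cuntz_family t \<longleftrightarrow> (\<forall>i j. star (t i) * t j = (if i = j then 1 else 0)) \<and>
    (\<Sum>i\<in>UNIV. t i * star (t i)) = 1"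

text \<open>The Cuntz algebra with generators indexed by the finite type \<open>'n\<close> (so \<open>N = CARD('n)\<close>) is
  constructed as the universal C*-algebra of the Cuntz relations: a *-polynomial \<open>p\<close> in the
  generators is identified with the function \<open>t \<mapsto> p(t)\<close> on all Cuntz families \<open>t\<close> of operators on
  \<open>\<ell>\<^sup>2(\<nat>)\<close>, the norm is the supremum of \<open>\<parallel>p(t)\<parallel>\<close> over these \<open>t\<close>, and \<open>'n cuntz\<close> is the
  completion, that is, the uniform closure. Families on \<open>\<ell>\<^sup>2(\<nat>)\<close> suffice: for operators \<open>t\<^sub>i\<close> on any Hilbert space,
  \<open>\<parallel>p(t)\<xi>\<parallel>\<close> depends only on the reducing subspace generated by \<open>\<xi>\<close>, which is separable.
  Evaluation at \<open>t\<close> is a representation, see \<open>representation_eval_cuntz\<close> below.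
  Functions are set to 0 off the Cuntz families, so that they are determined by their values
  there.\<close>

inductive_set star_polynomials :: "(('n::finite \<Rightarrow> ell2 bop) \<Rightarrow> ell2 bop) set" where
  gen: "(\<lambda>t. t i) \<in> star_polynomials"
| one: "(\<lambda>t. 1) \<in> star_polynomials"
| add: "p \<in> star_polynomials \<Longrightarrow> q \<in> star_polynomials \<Longrightarrow> (\<lambda>t. p t + q t) \<in> star_polynomials"
| mult: "p \<in> star_polynomials \<Longrightarrow> q \<in> star_polynomials \<Longrightarrow> (\<lambda>t. p t * q t) \<in> star_polynomials"
| scaleC: "p \<in> star_polynomials \<Longrightarrow> (\<lambda>t. c *\<^sub>C p t) \<in> star_polynomials"
| star: "p \<in> star_polynomials \<Longrightarrow> (\<lambda>t. star (p t)) \<in> star_polynomials"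

definition cuntz_fun :: "(('n::finite \<Rightarrow> ell2 bop) \<Rightarrow> ell2 bop) \<Rightarrow> bool" where
  "cuntz_fun f \<longleftrightarrow> (\<forall>t. \<not> cuntz_family t \<longrightarrow> f t = 0) \<and>
    (\<forall>e>0. \<exists>p\<in>star_polynomials. \<forall>t. cuntz_family t \<longrightarrow> norm (f t - p t) \<le> e)"

lemma norm_cuntz_family:
  assumes "cuntz_family t"
  shows "norm (t i) \<le> 1"
proof -
  have "(norm (t i))\<^sup>2 \<le> 1"
    using assms norm_one_le unfolding cuntz_family_def by (metis cstar_identity)
  then show ?thesis
    by (simp add: power_le_one_iff abs_square_le_1)
qed

lemma star_polynomial_bounded:
  "p \<in> star_polynomials \<Longrightarrow> \<exists>B. \<forall>t. cuntz_family t \<longrightarrow> norm (p t) \<le> B"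
proof (induction rule: star_polynomials.induct)
  case (gen i)
  then show ?case using norm_cuntz_family by blast
next
  case one
  then show ?case using norm_one_le by blast
next
  case (add p q)
  then obtain B C where "\<forall>t. cuntz_family t \<longrightarrow> norm (p t) \<le> B"
      "\<forall>t. cuntz_family t \<longrightarrow> norm (q t) \<le> C" by blast
  then show ?case
    by (intro exI[of _ "B + C"]) (auto intro: order_trans[OF norm_triangle_ineq] add_mono)
next
  case (mult p q)
  then obtain B C where B: "\<forall>t. cuntz_family t \<longrightarrow> norm (p t) \<le> B"
      "\<forall>t. cuntz_family t \<longrightarrow> norm (q t) \<le> C" by blast
  have "norm (p t * q t) \<le> B * C" if t: "cuntz_family t" for t
  proof (rule order_trans[OF norm_mult_ineq mult_mono])
    show "norm (p t) \<le> B" "norm (q t) \<le> C" using B t by auto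
    then show "0 \<le> B" using norm_ge_zero order_trans by blast
  qed simp
  then show ?case by blast
next
  case (scaleC p c)
  then obtain B where "\<forall>t. cuntz_family t \<longrightarrow> norm (p t) \<le> B" by blast
  then show ?case
    by (intro exI[of _ "cmod c * B"]) (auto simp: norm_scaleC intro: mult_left_mono)
next
  case (star p)
  then show ?case by (simp add: norm_star)
qed

lemma cuntz_funI:
  assumes "\<And>t. \<not> cuntz_family t \<Longrightarrow> f t = 0"
    and "\<And>e. e > 0 \<Longrightarrow> \<exists>p\<in>star_polynomials. \<forall>t. cuntz_family t \<longrightarrow> norm (f t - p t) \<le> e"
  shows "cuntz_fun f"
  using assms by (auto simp: cuntz_fun_def)

lemma cuntz_funE:
  assumes "cuntz_fun f" "e > 0"
  obtains p where "p \<in> star_polynomials" "\<And>t. cuntz_family t \<Longrightarrow> norm (f t - p t) \<le> e"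
  using assms unfolding cuntz_fun_def by blast

lemma cuntz_fun_outside: "cuntz_fun f \<Longrightarrow> \<not> cuntz_family t \<Longrightarrow> f t = 0"
  by (simp add: cuntz_fun_def)

lemma cuntz_fun_bounded:
  assumes "cuntz_fun f"
  obtains B where "\<And>t. norm (f t) \<le> B" "B \<ge> 0"
proof -
  obtain p where p: "p \<in> star_polynomials" "\<And>t. cuntz_family t \<Longrightarrow> norm (f t - p t) \<le> 1"
    using cuntz_funE[OF assms zero_less_one] by blast
  from star_polynomial_bounded[OF p(1)] obtain B where
    B: "\<And>t. cuntz_family t \<Longrightarrow> norm (p t) \<le> B" by blast
  have "norm (f t) \<le> max 0 (B + 1)" for t
  proof (cases "cuntz_family t")
    case True
    have "norm (f t) \<le> norm (p t) + norm (f t - p t)"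
      by (metis add.commute diff_add_cancel norm_triangle_ineq)
    with p(2)[OF True] B[OF True] show ?thesis by simp
  qed (simp add: cuntz_fun_outside[OF assms])
  then show ?thesis using that by (meson max.cobounded1)
qed

lemma cuntz_fun_poly:
  assumes "p \<in> star_polynomials"
  shows "cuntz_fun (\<lambda>t. if cuntz_family t then p t else 0)"
  using assms by (intro cuntz_funI bexI[of _ p]) auto

lemma cuntz_fun_zero: "cuntz_fun (\<lambda>t. 0)"
  by (rule cuntz_funI)
    (auto intro!: bexI[OF _ star_polynomials.scaleC[OF star_polynomials.one, of 0]]
      simp: norm_scaleC)

lemma cuntz_fun_add:
  assumes "cuntz_fun f" "cuntz_fun g"
  shows "cuntz_fun (\<lambda>t. f t + g t)"
proof (rule cuntz_funI)
  fix e :: real assume "e > 0"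
  then have e: "e / 2 > 0" by simp
  obtain p where p: "p \<in> star_polynomials" "\<And>t. cuntz_family t \<Longrightarrow> norm (f t - p t) \<le> e / 2"
    using cuntz_funE[OF assms(1) e] by blast
  obtain q where q: "q \<in> star_polynomials" "\<And>t. cuntz_family t \<Longrightarrow> norm (g t - q t) \<le> e / 2"
    using cuntz_funE[OF assms(2) e] by blast
  have "norm (f t + g t - (p t + q t)) \<le> e" if "cuntz_family t" for t
    using norm_triangle_ineq[of "f t - p t" "g t - q t"] p(2)[OF that] q(2)[OF that]
    by (simp add: algebra_simps)
  then show "\<exists>p\<in>star_polynomials. \<forall>t. cuntz_family t \<longrightarrow> norm (f t + g t - p t) \<le> e"
    by (intro bexI[OF _ star_polynomials.add[OF p(1) q(1)]]) simp
qed (simp add: cuntz_fun_outside[OF assms(1)] cuntz_fun_outside[OF assms(2)])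

lemma cuntz_fun_scaleC:
  assumes "cuntz_fun f"
  shows "cuntz_fun (\<lambda>t. c *\<^sub>C f t)"
proof (rule cuntz_funI)
  fix e :: real assume "e > 0"
  then have e: "e / (cmod c + 1) > 0" by (simp add: add_nonneg_pos)
  obtain p where p: "p \<in> star_polynomials"
      "\<And>t. cuntz_family t \<Longrightarrow> norm (f t - p t) \<le> e / (cmod c + 1)"
    using cuntz_funE[OF assms e] by blast
  have "norm (c *\<^sub>C f t - c *\<^sub>C p t) \<le> e" if "cuntz_family t" for t
  proof -
    have "norm (c *\<^sub>C f t - c *\<^sub>C p t) = cmod c * norm (f t - p t)"
      by (simp only: scaleC_diff_right[symmetric] norm_scaleC)
    also have "\<dots> \<le> (cmod c + 1) * (e / (cmod c + 1))"
      using p(2)[OF that] by (intro mult_mono) auto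
    also have "\<dots> = e" by (simp add: add_nonneg_eq_0_iff)
    finally show ?thesis .
  qed
  then show "\<exists>p\<in>star_polynomials. \<forall>t. cuntz_family t \<longrightarrow> norm (c *\<^sub>C f t - p t) \<le> e"
    by (intro bexI[OF _ star_polynomials.scaleC[OF p(1), of c]]) simp
qed (simp add: cuntz_fun_outside[OF assms])

lemma cuntz_fun_star:
  assumes "cuntz_fun f"
  shows "cuntz_fun (\<lambda>t. star (f t))"
proof (rule cuntz_funI)
  fix e :: real assume e: "e > 0"
  obtain p where p: "p \<in> star_polynomials" "\<And>t. cuntz_family t \<Longrightarrow> norm (f t - p t) \<le> e"
    using cuntz_funE[OF assms e] by blast
  then show "\<exists>p\<in>star_polynomials. \<forall>t. cuntz_family t \<longrightarrow> norm (star (f t) - p t) \<le> e"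
    by (intro bexI[OF _ star_polynomials.star[OF p(1)]]) (simp add: star_diff[symmetric] norm_star)
qed (simp add: cuntz_fun_outside[OF assms])

lemma cuntz_fun_mult:
  assumes "cuntz_fun f" "cuntz_fun g"
  shows "cuntz_fun (\<lambda>t. f t * g t)"
proof (rule cuntz_funI)
  fix e :: real assume e: "e > 0"
  obtain B where B: "\<And>t. norm (f t) \<le> B" "B \<ge> 0"
    using cuntz_fun_bounded[OF assms(1)] by blast
  obtain C where C: "\<And>t. norm (g t) \<le> C" "C \<ge> 0"
    using cuntz_fun_bounded[OF assms(2)] by blast
  define d where "d = min 1 (e / (B + C + 1))"
  have d: "d > 0" "d \<le> 1" "(B + C + 1) * d \<le> e"
  proof -
    have "B + C + 1 > 0" using B C by simp
    moreover have "d \<le> e / (B + C + 1)" by (simp add: d_def)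
    ultimately show "(B + C + 1) * d \<le> e" by (simp add: pos_le_divide_eq mult.commute)
    show "d > 0" using \<open>B + C + 1 > 0\<close> e by (simp add: d_def)
  qed (simp add: d_def)
  obtain p where p: "p \<in> star_polynomials" "\<And>t. cuntz_family t \<Longrightarrow> norm (f t - p t) \<le> d"
    using cuntz_funE[OF assms(1) d(1)] by blast
  obtain q where q: "q \<in> star_polynomials" "\<And>t. cuntz_family t \<Longrightarrow> norm (g t - q t) \<le> d"
    using cuntz_funE[OF assms(2) d(1)] by blast
  have "norm (f t * g t - p t * q t) \<le> e" if t: "cuntz_family t" for t
  proof -
    have "norm (q t) \<le> norm (g t) + norm (g t - q t)"
      by (metis norm_minus_commute norm_triangle_sub)
    then have nq: "norm (q t) \<le> C + 1"
      using C(1)[of t] q(2)[OF t] d(2) by linarith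
    have "f t * g t - p t * q t = f t * (g t - q t) + (f t - p t) * q t"
      by (simp add: algebra_simps)
    then have "norm (f t * g t - p t * q t) \<le> norm (f t) * norm (g t - q t) + norm (f t - p t) * norm (q t)"
      by (simp add: order_trans[OF norm_triangle_ineq add_mono[OF norm_mult_ineq norm_mult_ineq]])
    also have "\<dots> \<le> B * d + d * (C + 1)"
      using B C p(2)[OF t] q(2)[OF t] nq d by (intro add_mono mult_mono) auto
    also have "\<dots> \<le> e" using d(3) by (simp add: algebra_simps)
    finally show ?thesis .
  qed
  then show "\<exists>p\<in>star_polynomials. \<forall>t. cuntz_family t \<longrightarrow> norm (f t * g t - p t) \<le> e"
    by (intro bexI[OF _ star_polynomials.mult[OF p(1) q(1)]]) simp
qed (simp add: cuntz_fun_outside[OF assms(1)])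

lemma cuntz_fun_limit:
  assumes "\<And>e. e > 0 \<Longrightarrow> \<exists>g. cuntz_fun g \<and> (\<forall>t. norm (f t - g t) \<le> e)"
  shows "cuntz_fun f"
proof (rule cuntz_funI)
  fix t :: "'a \<Rightarrow> ell2 bop" assume t: "\<not> cuntz_family t"
  have "norm (f t) \<le> e" if e: "e > 0" for e
  proof -
    from assms[OF e] obtain g where "cuntz_fun g" "norm (f t - g t) \<le> e" by blast
    then show ?thesis using cuntz_fun_outside[OF \<open>cuntz_fun g\<close> t] by simp
  qed
  then have "norm (f t) \<le> 0" by (meson dense_ge)
  then show "f t = 0" by simp
next
  fix e :: real assume "e > 0"
  then have e: "e / 2 > 0" by simp
  obtain g where g: "cuntz_fun g" "\<And>t. norm (f t - g t) \<le> e / 2"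
    using assms[OF e] by blast
  obtain p where p: "p \<in> star_polynomials" "\<And>t. cuntz_family t \<Longrightarrow> norm (g t - p t) \<le> e / 2"
    using cuntz_funE[OF g(1) e] by blast
  have "norm (f t - p t) \<le> e" if "cuntz_family t" for t
    using norm_triangle_ineq[of "f t - g t" "g t - p t"] g(2)[of t] p(2)[OF that] by simp
  then show "\<exists>p\<in>star_polynomials. \<forall>t. cuntz_family t \<longrightarrow> norm (f t - p t) \<le> e"
    using p(1) by blast
qed

typedef 'n cuntz = "{f :: ('n::finite \<Rightarrow> ell2 bop) \<Rightarrow> ell2 bop. cuntz_fun f}"
  morphisms eval_cuntz Cuntz
  using cuntz_fun_zero by blast

setup_lifting type_definition_cuntz

lemma eval_cuntz_ext: "(\<And>t. eval_cuntz x t = eval_cuntz y t) \<Longrightarrow> x = y"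
  by (simp add: eval_cuntz_inject[symmetric] fun_eq_iff)

lemma eval_cuntz_bounded: "\<exists>B\<ge>0. \<forall>t. norm (eval_cuntz x t) \<le> B"
  using eval_cuntz[of x] cuntz_fun_bounded by (metis mem_Collect_eq)

instantiation cuntz :: (finite) "{real_normed_algebra, monoid_mult, complex_normed_vector}"
begin

lift_definition zero_cuntz :: "'a cuntz" is "\<lambda>t. 0" by (rule cuntz_fun_zero)
lift_definition one_cuntz :: "'a cuntz" is "\<lambda>t. if cuntz_family t then 1 else 0"
  by (rule cuntz_fun_poly[OF star_polynomials.one])
lift_definition plus_cuntz :: "'a cuntz \<Rightarrow> 'a cuntz \<Rightarrow> 'a cuntz" is "\<lambda>f g t. f t + g t"
  by (rule cuntz_fun_add)
lift_definition scaleC_cuntz :: "complex \<Rightarrow> 'a cuntz \<Rightarrow> 'a cuntz" is "\<lambda>c f t. c *\<^sub>C f t"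
  by (rule cuntz_fun_scaleC)
lift_definition uminus_cuntz :: "'a cuntz \<Rightarrow> 'a cuntz" is "\<lambda>f t. - f t"
  using cuntz_fun_scaleC[of _ "- 1"] by (simp add: scaleC_minus1)
lift_definition minus_cuntz :: "'a cuntz \<Rightarrow> 'a cuntz \<Rightarrow> 'a cuntz" is "\<lambda>f g t. f t - g t"
  using cuntz_fun_add[OF _ cuntz_fun_scaleC[of _ "- 1"]] by (simp add: scaleC_minus1)
lift_definition times_cuntz :: "'a cuntz \<Rightarrow> 'a cuntz \<Rightarrow> 'a cuntz" is "\<lambda>f g t. f t * g t"
  by (rule cuntz_fun_mult)
lift_definition scaleR_cuntz :: "real \<Rightarrow> 'a cuntz \<Rightarrow> 'a cuntz" is "\<lambda>r f t. r *\<^sub>R f t"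
  by (simp add: scaleR_scaleC cuntz_fun_scaleC)
lift_definition norm_cuntz :: "'a cuntz \<Rightarrow> real" is "\<lambda>f. SUP t. norm (f t)" .
definition dist_cuntz :: "'a cuntz \<Rightarrow> 'a cuntz \<Rightarrow> real" where "dist_cuntz x y = norm (x - y)"
definition [code del]: "(uniformity :: ('a cuntz \<times> 'a cuntz) filter) =
  (INF e\<in>{0 <..}. principal {(x, y). dist x y < e})"
definition open_cuntz :: "'a cuntz set \<Rightarrow> bool" where [code del]:
  "open_cuntz S = (\<forall>x\<in>S. \<forall>\<^sub>F (x', y) in uniformity. x' = x \<longrightarrow> y \<in> S)"
definition sgn_cuntz :: "'a cuntz \<Rightarrow> 'a cuntz" where "sgn_cuntz x = scaleR (inverse (norm x)) x"

lemma norm_eval_cuntz: "norm (eval_cuntz x t) \<le> norm x"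
proof -
  obtain B where "\<forall>t. norm (eval_cuntz x t) \<le> B"
    using eval_cuntz_bounded by blast
  then show ?thesis
    unfolding norm_cuntz.rep_eq by (intro cSUP_upper) (auto intro: bdd_aboveI)
qed

lemma norm_cuntz_le: "(\<And>t. norm (eval_cuntz x t) \<le> B) \<Longrightarrow> norm x \<le> B"
  unfolding norm_cuntz.rep_eq by (rule cSUP_least) auto

lemma norm_cuntz_ge_0: "0 \<le> norm (x :: 'a cuntz)"
  using norm_eval_cuntz[of x undefined] norm_ge_zero order_trans by blast

lemmas eval_cuntz_simps = zero_cuntz.rep_eq one_cuntz.rep_eq plus_cuntz.rep_eq uminus_cuntz.rep_eq
  minus_cuntz.rep_eq times_cuntz.rep_eq scaleR_cuntz.rep_eq scaleC_cuntz.rep_eq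

instance
proof
  fix x y z :: "'a cuntz" and r q :: real and c d :: complex
  have out: "eval_cuntz x t = 0" if "\<not> cuntz_family t" for x :: "'a cuntz" and t
    by (rule cuntz_fun_outside[of "eval_cuntz x"]) (use eval_cuntz[of x] that in simp_all)
  show "x + y + z = x + (y + z)" "x + y = y + x" "0 + x = x" "- x + x = 0" "x - y = x + - y"
    by (rule eval_cuntz_ext; simp add: eval_cuntz_simps ac_simps)+
  show "r *\<^sub>R (x + y) = r *\<^sub>R x + r *\<^sub>R y" "(r + q) *\<^sub>R x = r *\<^sub>R x + q *\<^sub>R x"
      "r *\<^sub>R q *\<^sub>R x = (r * q) *\<^sub>R x" "1 *\<^sub>R x = x"
    by (rule eval_cuntz_ext; simp add: eval_cuntz_simps scaleR_add_left scaleR_add_right)+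
  show "x * y * z = x * (y * z)" "(x + y) * z = x * z + y * z" "x * (y + z) = x * y + x * z"
      "r *\<^sub>R x * y = r *\<^sub>R (x * y)" "x * r *\<^sub>R y = r *\<^sub>R (x * y)"
    by (rule eval_cuntz_ext; simp add: eval_cuntz_simps mult.assoc distrib_left distrib_right)+
  show "c *\<^sub>C (x + y) = c *\<^sub>C x + c *\<^sub>C y" "(c + d) *\<^sub>C x = c *\<^sub>C x + d *\<^sub>C x"
      "c *\<^sub>C d *\<^sub>C x = (c * d) *\<^sub>C x"
    by (rule eval_cuntz_ext; simp add: eval_cuntz_simps scaleC_add_left scaleC_add_right
        scaleC_scaleC)+
  show "r *\<^sub>R x = complex_of_real r *\<^sub>C x"
    by (rule eval_cuntz_ext) (simp add: eval_cuntz_simps scaleR_scaleC)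
  show "1 * x = x" "x * 1 = x"
    by (rule eval_cuntz_ext; simp add: eval_cuntz_simps out)+
  show "dist x y = norm (x - y)" "sgn x = inverse (norm x) *\<^sub>R x"
    by (simp_all add: dist_cuntz_def sgn_cuntz_def)
  show "(uniformity :: ('a cuntz \<times> 'a cuntz) filter) =
      (INF e\<in>{0 <..}. principal {(x, y). dist x y < e})"
    by (rule uniformity_cuntz_def)
  show "open A = (\<forall>x\<in>A. \<forall>\<^sub>F (x', y) in uniformity. x' = x \<longrightarrow> y \<in> A)" for A :: "'a cuntz set"
    by (rule open_cuntz_def)
  show "norm x = 0 \<longleftrightarrow> x = 0"
  proof
    assume "norm x = 0"
    then have "eval_cuntz x t = 0" for t
      using norm_eval_cuntz[of x t] by simp
    then show "x = 0"
      by (intro eval_cuntz_ext) (simp add: eval_cuntz_simps)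
  qed (simp add: norm_cuntz.rep_eq eval_cuntz_simps)
  show "norm (x + y) \<le> norm x + norm y"
    by (rule norm_cuntz_le)
      (auto simp: eval_cuntz_simps intro: order_trans[OF norm_triangle_ineq] add_mono norm_eval_cuntz)
  show "norm (x * y) \<le> norm x * norm y"
    by (rule norm_cuntz_le)
      (auto simp: eval_cuntz_simps norm_cuntz_ge_0 intro!: order_trans[OF norm_mult_ineq] mult_mono norm_eval_cuntz)
  have le: "norm (c *\<^sub>C x) \<le> cmod c * norm x" for c and x :: "'a cuntz"
    by (rule norm_cuntz_le)
      (auto simp: eval_cuntz_simps norm_scaleC intro: mult_left_mono norm_eval_cuntz)
  have nC: "norm (c *\<^sub>C x) = cmod c * norm x" for c
  proof (cases "c = 0")
    case True
    then show ?thesis using le[of c x] norm_cuntz_ge_0[of "c *\<^sub>C x"] by simp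
  next
    case False
    have "x = inverse c *\<^sub>C (c *\<^sub>C x)"
      using False by (intro eval_cuntz_ext) (simp add: eval_cuntz_simps scaleC_scaleC)
    then have "norm x \<le> inverse (cmod c) * norm (c *\<^sub>C x)"
      using le[of "inverse c" "c *\<^sub>C x"] by (simp add: norm_inverse)
    then have "cmod c * norm x \<le> norm (c *\<^sub>C x)"
      using False by (simp add: field_simps)
    with le[of c x] show ?thesis by (rule antisym)
  qed
  then show "norm (c *\<^sub>C x) = cmod c * norm x" .
  have "r *\<^sub>R x = complex_of_real r *\<^sub>C x"
    by (rule eval_cuntz_ext) (simp add: eval_cuntz_simps scaleR_scaleC)
  then show "norm (r *\<^sub>R x) = \<bar>r\<bar> * norm x"
    by (simp add: nC)
qed

end

instance cuntz :: (finite) banach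
proof
  fix X :: "nat \<Rightarrow> 'a cuntz"
  assume "Cauchy X"
  then have C: "\<exists>M. \<forall>i\<ge>M. \<forall>j\<ge>M. norm (X i - X j) < e" if "e > 0" for e
    using that by (auto simp: Cauchy_def dist_norm)
  have le: "norm (eval_cuntz (X i) t - eval_cuntz (X j) t) \<le> norm (X i - X j)" for i j t
    using norm_eval_cuntz[of "X i - X j" t] by (simp add: minus_cuntz.rep_eq)
  have "Cauchy (\<lambda>i. eval_cuntz (X i) t)" for t
  proof (rule CauchyI)
    fix e :: real assume "0 < e"
    from C[OF this] show "\<exists>M. \<forall>i\<ge>M. \<forall>j\<ge>M. norm (eval_cuntz (X i) t - eval_cuntz (X j) t) < e"
      using le by (meson le_less_trans)
  qed
  then have "\<exists>f. \<forall>t. (\<lambda>i. eval_cuntz (X i) t) \<longlonglongrightarrow> f t"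
    by (intro choice) (auto simp: Cauchy_convergent_iff convergent_def)
  then obtain f where f: "\<And>t. (\<lambda>i. eval_cuntz (X i) t) \<longlonglongrightarrow> f t"
    by blast
  have key: "norm (eval_cuntz (X i) t - f t) \<le> e"
    if M: "\<And>i j. i \<ge> M \<Longrightarrow> j \<ge> M \<Longrightarrow> norm (X i - X j) < e" and i: "i \<ge> M" for M e i t
  proof (rule LIMSEQ_le_const2)
    show "(\<lambda>j. norm (eval_cuntz (X i) t - eval_cuntz (X j) t)) \<longlonglongrightarrow> norm (eval_cuntz (X i) t - f t)"
      by (intro tendsto_intros f)
    have "norm (eval_cuntz (X i) t - eval_cuntz (X j) t) \<le> e" if "j \<ge> M" for j
      using le[of i t j] M[OF i that] by linarith
    then show "\<exists>J. \<forall>j\<ge>J. norm (eval_cuntz (X i) t - eval_cuntz (X j) t) \<le> e"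
      by blast
  qed
  have "cuntz_fun f"
  proof (rule cuntz_fun_limit)
    fix e :: real assume "e > 0"
    from C[OF this] obtain M where M: "\<And>i j. i \<ge> M \<Longrightarrow> j \<ge> M \<Longrightarrow> norm (X i - X j) < e" by blast
    have "norm (f t - eval_cuntz (X M) t) \<le> e" for t
      using key[OF M order_refl] by (simp add: norm_minus_commute)
    then show "\<exists>g. cuntz_fun g \<and> (\<forall>t. norm (f t - g t) \<le> e)"
      using eval_cuntz[of "X M"] by auto
  qed
  then have L: "eval_cuntz (Cuntz f) = f"
    by (simp add: Cuntz_inverse)
  have "\<exists>M. \<forall>i\<ge>M. norm (X i - Cuntz f) < e" if e: "e > 0" for e
  proof -
    from C[of "e/2"] e obtain M where M: "\<And>i j. i \<ge> M \<Longrightarrow> j \<ge> M \<Longrightarrow> norm (X i - X j) < e/2"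
      by auto
    have "norm (X i - Cuntz f) \<le> e/2" if "i \<ge> M" for i
      by (rule norm_cuntz_le) (use key[OF M that] in \<open>simp add: minus_cuntz.rep_eq L\<close>)
    then show ?thesis using e by (intro exI[of _ M]) fastforce
  qed
  then show "convergent X"
    unfolding convergent_def lim_sequentially by (auto simp: dist_norm)
qed

instantiation cuntz :: (finite) cstar_algebra
begin

lift_definition star_cuntz :: "'a cuntz \<Rightarrow> 'a cuntz" is "\<lambda>f t. star (f t)"
  by (rule cuntz_fun_star)

instance
proof
  fix x y :: "'a cuntz" and c :: complex
  show "(c *\<^sub>C x) * y = c *\<^sub>C (x * y)" "x * (c *\<^sub>C y) = c *\<^sub>C (x * y)"
      "star (star x) = x" "star (x + y) = star x + star y" "star (x * y) = star y * star x"
      "star (c *\<^sub>C x) = cnj c *\<^sub>C star x"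
    by (rule eval_cuntz_ext; simp add: eval_cuntz_simps star_cuntz.rep_eq mult_scaleC_left
        mult_scaleC_right star_star star_add star_mult star_scaleC)+
  have ns: "norm (star x) \<le> norm x"
    by (rule norm_cuntz_le) (simp add: star_cuntz.rep_eq norm_star norm_eval_cuntz)
  have "norm (star x * x) \<le> norm (star x) * norm x"
    by (rule norm_mult_ineq)
  also have "\<dots> \<le> (norm x)\<^sup>2"
    using ns by (simp add: power2_eq_square mult_right_mono)
  finally have "norm (star x * x) \<le> (norm x)\<^sup>2" .
  moreover have "norm x \<le> sqrt (norm (star x * x))"
  proof (rule norm_cuntz_le)
    fix t
    have "(norm (eval_cuntz x t))\<^sup>2 = norm (eval_cuntz (star x * x) t)"
      by (simp add: times_cuntz.rep_eq star_cuntz.rep_eq cstar_identity)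
    also have "\<dots> \<le> norm (star x * x)"
      by (rule norm_eval_cuntz)
    finally show "norm (eval_cuntz x t) \<le> sqrt (norm (star x * x))"
      by (rule real_le_rsqrt)
  qed
  then have "(norm x)\<^sup>2 \<le> norm (star x * x)"
    using power_mono[of "norm x" "sqrt (norm (star x * x))" 2] by simp
  ultimately show "norm (star x * x) = (norm x)\<^sup>2"
    by (rule antisym)
qed

end

lift_definition cuntz_gen :: "'n::finite \<Rightarrow> 'n cuntz" is "\<lambda>i t. if cuntz_family t then t i else 0"
  by (rule cuntz_fun_poly[OF star_polynomials.gen])

lemma cuntz_family_cuntz_gen: "cuntz_family (cuntz_gen :: 'n::finite \<Rightarrow> 'n cuntz)"
proof -
  have sum: "eval_cuntz (sum f A) t = (\<Sum>i\<in>A. eval_cuntz (f i) t)"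
    for f :: "'n \<Rightarrow> 'n cuntz" and A t
    by (induction A rule: infinite_finite_induct) (simp_all add: eval_cuntz_simps)
  have "(\<Sum>i\<in>UNIV. cuntz_gen i * star (cuntz_gen i)) = (1 :: 'n cuntz)"
  proof (rule eval_cuntz_ext)
    show "eval_cuntz (\<Sum>i\<in>UNIV. cuntz_gen i * star (cuntz_gen i)) t = eval_cuntz (1 :: 'n cuntz) t"
      for t :: "'n \<Rightarrow> ell2 bop"
      by (cases "cuntz_family t")
        (simp_all add: sum eval_cuntz_simps star_cuntz.rep_eq cuntz_gen.rep_eq,
         simp add: cuntz_family_def)
  qed
  moreover have "star (cuntz_gen i) * cuntz_gen j = (if i = j then 1 else 0)" for i j :: 'n
  proof (rule eval_cuntz_ext)
    show "eval_cuntz (star (cuntz_gen i) * cuntz_gen j) t = eval_cuntz (if i = j then 1 else 0) t"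
      for t :: "'n \<Rightarrow> ell2 bop"
      by (cases "cuntz_family t")
        (simp_all add: eval_cuntz_simps star_cuntz.rep_eq cuntz_gen.rep_eq,
         simp add: cuntz_family_def)
  qed
  ultimately show ?thesis
    by (simp add: cuntz_family_def)
qed

definition cuntz_comb :: "complex ^ 'n \<Rightarrow> 'n::finite cuntz" where
  "cuntz_comb w = (\<Sum>i\<in>UNIV. (w $ i) *\<^sub>C cuntz_gen i)"

definition cuntz_word :: "'n::finite list \<Rightarrow> 'n cuntz" where
  "cuntz_word J = prod_list (map cuntz_gen J)"

section \<open>Representations\<close>

text \<open>Unital *-homomorphisms on a unital *-subalgebra \<open>A\<close>; the values off \<open>A\<close> are irrelevant.
  With values in \<open>'h bop\<close> these are the representations of \<open>A\<close> on the Hilbert space \<open>'h\<close>.\<close>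

definition star_hom_on :: "'a::cstar_algebra set \<Rightarrow> ('a \<Rightarrow> 'b::cstar_algebra) \<Rightarrow> bool" where
  "star_hom_on A \<pi> \<longleftrightarrow>
    (\<forall>x\<in>A. \<forall>y\<in>A. \<pi> (x + y) = \<pi> x + \<pi> y \<and> \<pi> (x * y) = \<pi> x * \<pi> y) \<and>
    (\<forall>x\<in>A. \<forall>c. \<pi> (c *\<^sub>C x) = c *\<^sub>C \<pi> x) \<and>
    (\<forall>x\<in>A. \<pi> (star x) = star (\<pi> x)) \<and> \<pi> 1 = 1"

abbreviation representation :: "('a::cstar_algebra \<Rightarrow> 'h::chilbert_space bop) \<Rightarrow> bool" where
  "representation \<pi> \<equiv> star_hom_on UNIV \<pi>"

definition unitarily_equivalent ::
  "('a::cstar_algebra \<Rightarrow> 'h::chilbert_space bop) \<Rightarrow> ('a \<Rightarrow> 'g::chilbert_space bop) \<Rightarrow> bool" where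
  "unitarily_equivalent \<pi> \<rho> \<longleftrightarrow> (\<exists>U. surj U \<and>
    (\<forall>x y. U (x + y) = U x + U y) \<and> (\<forall>c x. U (c *\<^sub>C x) = c *\<^sub>C U x) \<and>
    (\<forall>x y. cinner (U x) (U y) = cinner x y) \<and> (\<forall>a x. U (\<pi> a \<cdot> x) = \<rho> a \<cdot> U x))"

definition closed_csubspace :: "'h::chilbert_space set \<Rightarrow> bool" where
  "closed_csubspace M \<longleftrightarrow> closed M \<and> 0 \<in> M \<and> (\<forall>x\<in>M. \<forall>y\<in>M. x + y \<in> M) \<and>
    (\<forall>c. \<forall>x\<in>M. c *\<^sub>C x \<in> M)"

definition subrepresentation_on ::
  "'a::cstar_algebra set \<Rightarrow> ('a \<Rightarrow> 'h::chilbert_space bop) \<Rightarrow> 'h set \<Rightarrow> bool" where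
  "subrepresentation_on A \<pi> M \<longleftrightarrow> closed_csubspace M \<and> (\<forall>a\<in>A. \<forall>x\<in>M. \<pi> a \<cdot> x \<in> M)"

definition irreducible_representation :: "('a::cstar_algebra \<Rightarrow> 'h::chilbert_space bop) \<Rightarrow> bool" where
  "irreducible_representation \<pi> \<longleftrightarrow> representation \<pi> \<and> (UNIV :: 'h set) \<noteq> {0} \<and>
    (\<forall>M. subrepresentation_on UNIV \<pi> M \<longrightarrow> M = {0} \<or> M = UNIV)"

definition orthogonal_direct_sum :: "('i \<Rightarrow> 'h::chilbert_space set) \<Rightarrow> bool" where
  "orthogonal_direct_sum M \<longleftrightarrow>
    (\<forall>i j. i \<noteq> j \<longrightarrow> (\<forall>x\<in>M i. \<forall>y\<in>M j. cinner x y = 0)) \<and>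
    closure {\<Sum>i\<in>F. v i | F v. finite F \<and> (\<forall>i\<in>F. v i \<in> M i)} = UNIV"

definition cyclic_vector :: "('a::cstar_algebra \<Rightarrow> 'h::chilbert_space bop) \<Rightarrow> 'h \<Rightarrow> bool" where
  "cyclic_vector \<pi> \<Omega> \<longleftrightarrow> closure (range (\<lambda>a. \<pi> a \<cdot> \<Omega>)) = UNIV"

text \<open>The GNS representation of a state is determined up to unitary equivalence by these
  properties.\<close>

definition gns_representation ::
  "('a::cstar_algebra \<Rightarrow> complex) \<Rightarrow> ('a \<Rightarrow> 'h::chilbert_space bop) \<Rightarrow> bool" where
  "gns_representation F \<pi> \<longleftrightarrow> representation \<pi> \<and>
    (\<exists>\<Omega>. cyclic_vector \<pi> \<Omega> \<and> (\<forall>a. F a = cinner \<Omega> (\<pi> a \<cdot> \<Omega>)))"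

text \<open>Throughout, only the terms \<open>z 1, z 2, \<dots>\<close> of a sequence \<open>z\<close> matter.
  \<open>annihilators z n\<close> is \<open>s(z\<^sup>(\<^sup>n\<^sup>))\<^sup>* \<cdots> s(z\<^sup>(\<^sup>1\<^sup>))\<^sup>*\<close>.\<close>

fun annihilators :: "(nat \<Rightarrow> complex ^ 'n::finite) \<Rightarrow> nat \<Rightarrow> 'n cuntz" where
  "annihilators z 0 = 1"
| "annihilators z (Suc n) = star (cuntz_comb (z (Suc n))) * annihilators z n"

definition GP_representation ::
  "(nat \<Rightarrow> complex ^ 'n) \<Rightarrow> ('n::finite cuntz \<Rightarrow> 'h::chilbert_space bop) \<Rightarrow> bool" where
  "GP_representation z \<pi> \<longleftrightarrow> representation \<pi> \<and>
    (\<exists>\<Omega>. norm \<Omega> = 1 \<and> cyclic_vector \<pi> \<Omega> \<and>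
      (\<forall>m\<ge>1. \<forall>n\<ge>1. cinner (\<pi> (annihilators z m) \<cdot> \<Omega>) (\<pi> (annihilators z n) \<cdot> \<Omega>) =
        (if m = n then 1 else 0)))"

lemma representation_eval_cuntz:
  "cuntz_family t \<Longrightarrow> representation (\<lambda>x. eval_cuntz x t) \<and> eval_cuntz (cuntz_gen i) t = t i"
  by (simp add: star_hom_on_def eval_cuntz_simps star_cuntz.rep_eq cuntz_gen.rep_eq)

section \<open>The gauge action\<close>

lemma cuntz_family_rotate [simp]:
  "cuntz_family (\<lambda>i. cis \<theta> *\<^sub>C t i) \<longleftrightarrow> cuntz_family t"
  by (simp add: cuntz_family_def star_scaleC mult_scaleC_left mult_scaleC_right scaleC_scaleC
      cis_cnj cis_mult)

lemma star_polynomials_rotate: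
  "p \<in> star_polynomials \<Longrightarrow> (\<lambda>t. p (\<lambda>i. c *\<^sub>C t i)) \<in> star_polynomials"
  by (induction rule: star_polynomials.induct) (auto intro: star_polynomials.intros)

text \<open>\<open>gauge \<theta>\<close> is the automorphism \<open>s\<^sub>i \<mapsto> e\<^sup>i\<^sup>\<theta> s\<^sub>i\<close>; in the above model it is the
  substitution of \<open>(e\<^sup>i\<^sup>\<theta> t\<^sub>i)\<close> for the Cuntz family \<open>(t\<^sub>i)\<close>.\<close>

lift_definition gauge :: "real \<Rightarrow> 'n::finite cuntz \<Rightarrow> 'n cuntz" is
  "\<lambda>\<theta> f t. f (\<lambda>i. cis \<theta> *\<^sub>C t i)"
proof (rule cuntz_funI)
  fix \<theta> and f :: "('n \<Rightarrow> ell2 bop) \<Rightarrow> ell2 bop"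
  assume f: "cuntz_fun f"
  show "f (\<lambda>i. cis \<theta> *\<^sub>C t i) = 0" if "\<not> cuntz_family t" for t
    using cuntz_fun_outside[OF f] that by simp
  fix e :: real assume "e > 0"
  obtain p where p: "p \<in> star_polynomials"
      "\<And>t. cuntz_family t \<Longrightarrow> norm (f t - p t) \<le> e"
    using cuntz_funE[OF f \<open>e > 0\<close>] by blast
  then show "\<exists>p\<in>star_polynomials. \<forall>t. cuntz_family t \<longrightarrow> norm (f (\<lambda>i. cis \<theta> *\<^sub>C t i) - p t) \<le> e"
    by (intro bexI[OF _ star_polynomials_rotate[OF p(1), of "cis \<theta>"]]) simp
qed

lemma gauge_cuntz_gen: "gauge \<theta> (cuntz_gen i) = cis \<theta> *\<^sub>C cuntz_gen i"
  by (rule eval_cuntz_ext) (simp add: gauge.rep_eq cuntz_gen.rep_eq eval_cuntz_simps)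

lemma star_hom_gauge: "star_hom_on UNIV (gauge \<theta>)"
  unfolding star_hom_on_def
  by (intro conjI ballI allI eval_cuntz_ext)
    (simp_all add: gauge.rep_eq eval_cuntz_simps star_cuntz.rep_eq)

definition gauge_fixed :: "'n::finite cuntz set" where
  "gauge_fixed = {x. \<forall>\<theta>. gauge \<theta> x = x}"

definition gauge_expectation :: "'n::finite cuntz \<Rightarrow> 'n cuntz" where
  "gauge_expectation x = (1 / (2 * pi)) *\<^sub>R integral {0..2 * pi} (\<lambda>\<theta>. gauge \<theta> x)"

section \<open>The induced product representation\<close>

text \<open>\<open>\<K>\<^sup>\<otimes>\<^sup>r\<close> is represented by coordinates with respect to the orthonormal basis
  \<open>v\<^sub>L = s\<^bsub>l\<^sub>1\<^esub> \<otimes> \<dots> \<otimes> s\<^bsub>l\<^sub>r\<^esub>\<close>: its elements are the functions on words that vanish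
  on words of length other than \<open>r\<close>.\<close>

definition tensor_power :: "nat \<Rightarrow> ('n::finite list \<Rightarrow> complex) set" where
  "tensor_power r = {\<xi>. \<forall>L. length L \<noteq> r \<longrightarrow> \<xi> L = 0}"

definition tensor_inner :: "nat \<Rightarrow> ('n::finite list \<Rightarrow> complex) \<Rightarrow> ('n list \<Rightarrow> complex) \<Rightarrow> complex" where
  "tensor_inner r \<xi> \<eta> = (\<Sum>L | length L = r. cnj (\<xi> L) * \<eta> L)"

text \<open>\<open>\<xi> \<otimes> w\<close> for \<open>w\<close> in \<open>\<K> = \<complex>\<^sup>N\<close>.\<close>

definition tensor_snoc :: "('n::finite list \<Rightarrow> complex) \<Rightarrow> complex ^ 'n \<Rightarrow> 'n list \<Rightarrow> complex" where
  "tensor_snoc \<xi> w L = (if L = [] then 0 else \<xi> (butlast L) * w $ last L)"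

text \<open>\<open>product_tensor z r\<close> is \<open>z\<^sup>(\<^sup>1\<^sup>) \<otimes> \<cdots> \<otimes> z\<^sup>(\<^sup>r\<^sup>)\<close>.\<close>

fun product_tensor :: "(nat \<Rightarrow> complex ^ 'n::finite) \<Rightarrow> nat \<Rightarrow> 'n list \<Rightarrow> complex" where
  "product_tensor z 0 = (\<lambda>L. if L = [] then 1 else 0)"
| "product_tensor z (Suc r) = tensor_snoc (product_tensor z r) (z (Suc r))"

text \<open>The action of \<open>s\<^sub>J s\<^sub>K\<^sup>*\<close> on tensors, \<open>v\<^sub>L \<mapsto> \<delta>\<^sub>K\<^sub>L v\<^sub>J\<close>.\<close>

definition tensor_matrix_unit ::
  "'n::finite list \<Rightarrow> 'n list \<Rightarrow> ('n list \<Rightarrow> complex) \<Rightarrow> 'n list \<Rightarrow> complex" where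
  "tensor_matrix_unit J K \<xi> L = (if L = J then \<xi> K else 0)"

text \<open>The Hilbert space \<open>'k\<close> with the isometries \<open>\<iota> r : \<K>\<^sup>\<otimes>\<^sup>r \<rightarrow> 'k\<close> (\<open>r \<ge> 1\<close>) is the Hilbert space
  inductive limit of the maps \<open>\<xi> \<mapsto> \<xi> \<otimes> z\<^sup>(\<^sup>r\<^sup>+\<^sup>1\<^sup>)\<close>.\<close>

definition product_limit ::
  "(nat \<Rightarrow> complex ^ 'n) \<Rightarrow> (nat \<Rightarrow> ('n::finite list \<Rightarrow> complex) \<Rightarrow> 'k::chilbert_space) \<Rightarrow> bool" where
  "product_limit z \<iota> \<longleftrightarrow>
    (\<forall>r\<ge>1. \<forall>\<xi>\<in>tensor_power r. \<forall>\<eta>\<in>tensor_power r.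
      \<iota> r (\<lambda>L. \<xi> L + \<eta> L) = \<iota> r \<xi> + \<iota> r \<eta> \<and> cinner (\<iota> r \<xi>) (\<iota> r \<eta>) = tensor_inner r \<xi> \<eta>) \<and>
    (\<forall>r\<ge>1. \<forall>\<xi>\<in>tensor_power r. \<forall>c. \<iota> r (\<lambda>L. c * \<xi> L) = c *\<^sub>C \<iota> r \<xi>) \<and>
    (\<forall>r\<ge>1. \<forall>\<xi>\<in>tensor_power r. \<iota> (Suc r) (tensor_snoc \<xi> (z (Suc r))) = \<iota> r \<xi>) \<and>
    closure (\<Union>r\<in>{1..}. \<iota> r ` tensor_power r) = UNIV"

text \<open>The representation \<open>a\<^sub>0\<close> of the gauge-fixed algebra that is the inductive limit of the actions
  of \<open>C*\<langle>s\<^sub>J s\<^sub>K\<^sup>* : |J| = |K| = r\<rangle>\<close> on \<open>\<K>\<^sup>\<otimes>\<^sup>r\<close>; it is determined by its values on the \<open>s\<^sub>J s\<^sub>K\<^sup>*\<close>.\<close>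

definition product_limit_representation ::
  "(nat \<Rightarrow> complex ^ 'n) \<Rightarrow> (nat \<Rightarrow> ('n::finite list \<Rightarrow> complex) \<Rightarrow> 'k::chilbert_space) \<Rightarrow>
    ('n cuntz \<Rightarrow> 'k bop) \<Rightarrow> bool" where
  "product_limit_representation z \<iota> a\<^sub>0 \<longleftrightarrow> product_limit z \<iota> \<and> star_hom_on gauge_fixed a\<^sub>0 \<and>
    (\<forall>r\<ge>1. \<forall>J K. length J = r \<longrightarrow> length K = r \<longrightarrow> (\<forall>\<xi>\<in>tensor_power r.
      a\<^sub>0 (cuntz_word J * star (cuntz_word K)) \<cdot> \<iota> r \<xi> = \<iota> r (tensor_matrix_unit J K \<xi>)))"

definition product_vector ::
  "(nat \<Rightarrow> complex ^ 'n) \<Rightarrow> (nat \<Rightarrow> ('n::finite list \<Rightarrow> complex) \<Rightarrow> 'k::chilbert_space) \<Rightarrow> 'k" where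
  "product_vector z \<iota> = lim (\<lambda>r. \<iota> r (product_tensor z r))"

definition induced_state ::
  "(nat \<Rightarrow> complex ^ 'n) \<Rightarrow> (nat \<Rightarrow> ('n::finite list \<Rightarrow> complex) \<Rightarrow> 'k::chilbert_space) \<Rightarrow>
    ('n cuntz \<Rightarrow> 'k bop) \<Rightarrow> 'n cuntz \<Rightarrow> complex" where
  "induced_state z \<iota> a\<^sub>0 x =
    cinner (product_vector z \<iota>) (a\<^sub>0 (gauge_expectation x) \<cdot> product_vector z \<iota>)"

text \<open>\<open>a\<close> is the induced product representation by \<open>z\<close>, built from the realisation \<open>(\<iota>, a\<^sub>0)\<close> of the
  inductive limit. The inductive limit and the GNS representation are unique up to unitary
  equivalence only; a theorem about them is stated for all realisations.\<close>

definition induced_product_representation ::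
  "(nat \<Rightarrow> complex ^ 'n) \<Rightarrow> (nat \<Rightarrow> ('n::finite list \<Rightarrow> complex) \<Rightarrow> 'k::chilbert_space) \<Rightarrow>
    ('n cuntz \<Rightarrow> 'k bop) \<Rightarrow> ('n cuntz \<Rightarrow> 'h::chilbert_space bop) \<Rightarrow> bool" where
  "induced_product_representation z \<iota> a\<^sub>0 a \<longleftrightarrow>
    product_limit_representation z \<iota> a\<^sub>0 \<and> gns_representation (induced_state z \<iota> a\<^sub>0) a"

definition vinner :: "complex ^ 'n \<Rightarrow> complex ^ 'n::finite \<Rightarrow> complex" where
  "vinner v w = (\<Sum>i\<in>UNIV. cnj (v $ i) * w $ i)"

end

theory Submission
  imports Defs
begin

text \<open>Put \<open>\<Omega>\<^sub>n = a(s(z\<^sub>n)\<^sup>* \<cdots> s(z\<^sub>1)\<^sup>*) \<Omega>\<close>. The values of the state on the \<open>s\<^sub>J s\<^sub>K\<^sup>*\<close> say that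
  \<open>(\<Omega>\<^sub>n)\<close> is an orthonormal family with \<open>s\<^sub>i\<^sup>* \<Omega>\<^sub>n = z\<^bsub>n+1,i\<^esub> \<Omega>\<^bsub>n+1\<^esub>\<close>, which is (iv). Such a chain determines
  all inner products of the vectors \<open>s\<^sub>J \<Omega>\<^sub>n\<close>, hence the representation up to equivalence.

  If \<open>(\<omega>\<^sub>n)\<close> is a chain for \<open>y\<close> and \<open>(\<xi>\<^sub>n)\<close> one for \<open>z\<close> in the same representation, then
  \<open>|\<langle>\<omega>\<^sub>m|\<xi>\<^sub>n\<rangle>| \<le> \<Prod>\<^sub>i |\<langle>y\<^bsub>m+i\<^esub>|z\<^bsub>n+i\<^esub>\<rangle>|\<close>, which vanishes unless the overlaps are summable up to a shift. If all
  these inner products vanish, then \<open>\<xi> = 0\<close>. Conversely, summable overlaps make the vectors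
  \<open>s(z\<^bsub>m+1\<^esub>) \<cdots> s(z\<^sub>t) \<omega>\<^bsub>k+t\<^esub>\<close> with suitable phases converge to a chain for \<open>z\<close>, and this gives (i). For
  \<open>y = z\<close> and \<open>k \<ge> 1\<close> the resulting unitary commutes with the representation and is not a scalar,
  whereas without summability every projection in the commutant maps \<open>\<Omega>\<^sub>0\<close> to a multiple of itself; this
  gives (ii). The summands in (iii) are the spectral subspaces of the gauge action.\<close>

section \<open>Square roots by the binomial series\<close>

text \<open>The Taylor coefficients of the square root of \<open>1 - x\<close> at
  \<open>0\<close>.\<close>

definition sqrt_coeff :: "nat \<Rightarrow> real" where
  "sqrt_coeff n = (- 1) ^ n * ((1 / 2) gchoose n)"

lemma sqrt_coeff_0 [simp]: "sqrt_coeff 0 = 1"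
  by (simp add: sqrt_coeff_def)

lemma sqrt_coeff_1: "sqrt_coeff (Suc 0) = - 1 / 2"
  by (simp add: sqrt_coeff_def)

text \<open>The quantity equals \<open>pochhammer (1/2) n / fact n\<close>. Both the signs of the
  coefficients and the signs of their partial sums reduce to it.\<close>

lemma minus_half_gbinomial_nonneg: "0 \<le> (- 1) ^ n * ((- 1 / 2 :: real) gchoose n)"
proof -
  have "((- 1 / 2 :: real) gchoose n) = (- 1) ^ n * pochhammer (1 / 2) n / fact n"
    by (simp add: gbinomial_pochhammer)
  then show ?thesis
    by (simp add: pochhammer_nonneg flip: power_mult_distrib)
qed

lemma sqrt_coeff_Suc_nonpos: "sqrt_coeff (Suc n) \<le> 0"
proof -
  have "sqrt_coeff (Suc n) = - ((1 / 2) / real (Suc n)) * ((- 1) ^ n * ((- 1 / 2) gchoose n))"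
    using gbinomial_absorption'[of "Suc n" "1/2 :: real"] by (simp add: sqrt_coeff_def)
  then show ?thesis
    using minus_half_gbinomial_nonneg[of n] by (simp add: mult_le_0_iff)
qed

text \<open>Alternating partial sums of a binomial row telescope: with upper entry
  \<open>1/2\<close> they equal the signed coefficient with upper entry \<open>-1/2\<close>.\<close>

lemma sum_sqrt_coeff_nonneg: "0 \<le> sum sqrt_coeff {..n}"
  using gbinomial_sum_lower_neg[of "1/2 :: real" n] minus_half_gbinomial_nonneg[of n]
  by (simp add: sqrt_coeff_def mult.commute)

text \<open>Only the constant coefficient is positive, so a nonempty partial sum of absolute values
  is 2 minus the plain partial sum, and the latter is nonnegative.\<close>

lemma summable_abs_sqrt_coeff: "summable (\<lambda>n. \<bar>sqrt_coeff n\<bar>)"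
proof (rule summableI_nonneg_bounded)
  have eq: "\<bar>sqrt_coeff k\<bar> = (if k = 0 then 2 else 0) - sqrt_coeff k" for k
    using sqrt_coeff_Suc_nonpos[of "k - 1"] by (cases k) auto
  show "(\<Sum>k<n. \<bar>sqrt_coeff k\<bar>) \<le> 2" for n
  proof (cases n)
    case (Suc m)
    have "(\<Sum>k<n. \<bar>sqrt_coeff k\<bar>) = (\<Sum>k<n. if k = 0 then 2 else 0) - sum sqrt_coeff {..<n}"
      unfolding eq by (rule sum_subtractf)
    then show ?thesis
      using sum_sqrt_coeff_nonneg[of m] unfolding Suc
      by (simp add: lessThan_Suc_atMost)
  qed simp
qed simp

lemma suminf_sqrt_coeff_nonneg: "0 \<le> suminf sqrt_coeff"
proof (rule LIMSEQ_le_const)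
  show "(\<lambda>n. sum sqrt_coeff {..n}) \<longlonglongrightarrow> suminf sqrt_coeff"
    using summable_LIMSEQ'[OF summable_rabs_cancel[OF summable_abs_sqrt_coeff]] .
qed (use sum_sqrt_coeff_nonneg in blast)

text \<open>Vandermonde's identity turns the convolution into the binomial row of
  \<open>1/2 + 1/2 = 1\<close>. These are the coefficients of \<open>1 - x\<close>.\<close>

lemma sqrt_coeff_convolution:
  "(\<Sum>i\<le>n. sqrt_coeff i * sqrt_coeff (n - i)) = (if n = 0 then 1 else if n = 1 then - 1 else 0)"
proof -
  have "(\<Sum>i\<le>n. sqrt_coeff i * sqrt_coeff (n - i)) =
      (- 1) ^ n * (\<Sum>i\<le>n. ((1 / 2) gchoose i) * ((1 / 2) gchoose (n - i)))"
    unfolding sum_distrib_left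
  proof (rule sum.cong)
    fix i assume "i \<in> {..n}"
    then have "(- 1 :: real) ^ n = (- 1) ^ i * (- 1) ^ (n - i)"
      by (simp flip: power_add)
    then show "sqrt_coeff i * sqrt_coeff (n - i) =
        (- 1) ^ n * (((1 / 2) gchoose i) * ((1 / 2) gchoose (n - i)))"
      by (simp add: sqrt_coeff_def)
  qed simp
  also have "\<dots> = (- 1) ^ n * ((1 :: real) gchoose n)"
    using gbinomial_Vandermonde[of "1/2 :: real" "1/2" n] by (simp add: atLeast0AtMost)
  also have "((1 :: real) gchoose n) = of_nat (1 choose n)"
    by (simp add: binomial_gbinomial)
  finally show ?thesis
    by (cases n) (auto simp: binomial_eq_0)
qed

lemma star_scaleR: "star (r *\<^sub>R x) = r *\<^sub>R star (x::'a::cstar_algebra)"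
  by (simp add: scaleR_scaleC star_scaleC)

lemma bounded_linear_star: "bounded_linear (star :: 'a::cstar_algebra \<Rightarrow> 'a)"
  by (rule bounded_linear_intro[where K = 1]) (simp_all add: star_add star_scaleR norm_star)

lemma star_power: "star (x ^ n) = star (x::'a::cstar_algebra) ^ n"
  by (induction n) (simp_all add: star_mult power_commutes)

lemma norm_power_le_one: "norm x \<le> 1 \<Longrightarrow> norm (x ^ n) \<le> 1" for x :: "'a::cstar_algebra"
proof (induction n)
  case (Suc n)
  then show ?case
    using mult_mono[of "norm x" 1 "norm (x ^ n)" 1] norm_mult_ineq[of x "x ^ n"] by simp
qed (simp add: norm_one_le)

text \<open>Since the coefficients are absolutely summable, the series converges on the whole closed
  unit ball, boundary included; the contractions to which it is applied may have norm exactly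
  1.\<close>

definition sqrt_one_minus :: "'a::cstar_algebra \<Rightarrow> 'a" where
  "sqrt_one_minus x = (\<Sum>n. sqrt_coeff n *\<^sub>R x ^ n)"

lemma summable_norm_sqrt_one_minus:
  assumes "norm (x::'a::cstar_algebra) \<le> 1"
  shows "summable (\<lambda>n. norm (sqrt_coeff n *\<^sub>R x ^ n))"
  by (rule summable_comparison_test'[OF summable_abs_sqrt_coeff, of 0])
    (simp add: mult_left_le norm_power_le_one[OF assms])

lemma sqrt_one_minus_sums:
  assumes "norm (x::'a::cstar_algebra) \<le> 1"
  shows "(\<lambda>n. sqrt_coeff n *\<^sub>R x ^ n) sums sqrt_one_minus x"
  unfolding sqrt_one_minus_def
  by (rule summable_sums[OF summable_norm_cancel[OF summable_norm_sqrt_one_minus[OF assms]]])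

lemma sqrt_one_minus_square:
  assumes "norm (x::'a::cstar_algebra) \<le> 1"
  shows "sqrt_one_minus x * sqrt_one_minus x = 1 - x"
proof (rule sums_unique2)
  show "(\<lambda>n. \<Sum>i\<le>n. (sqrt_coeff i *\<^sub>R x ^ i) * (sqrt_coeff (n - i) *\<^sub>R x ^ (n - i))) sums
      (sqrt_one_minus x * sqrt_one_minus x)"
    unfolding sqrt_one_minus_def
    by (intro Cauchy_product_sums summable_norm_sqrt_one_minus assms)
  have "(\<Sum>i\<le>n. (sqrt_coeff i *\<^sub>R x ^ i) * (sqrt_coeff (n - i) *\<^sub>R x ^ (n - i))) =
      (\<Sum>i\<le>n. sqrt_coeff i * sqrt_coeff (n - i)) *\<^sub>R x ^ n" for n
    unfolding scaleR_sum_left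
    by (rule sum.cong) (simp_all flip: power_add)
  then have eq: "(\<Sum>i\<le>n. (sqrt_coeff i *\<^sub>R x ^ i) * (sqrt_coeff (n - i) *\<^sub>R x ^ (n - i))) =
      (if n = 0 then 1 else if n = 1 then - x else 0)" for n
    unfolding sqrt_coeff_convolution by simp
  have "(\<lambda>n. if n = 0 then 1 else if n = 1 then - x else 0) sums
      (\<Sum>n\<in>{0, 1 :: nat}. if n = 0 then 1 else if n = 1 then - x else 0)"
    by (rule sums_finite) auto
  then show "(\<lambda>n. \<Sum>i\<le>n. (sqrt_coeff i *\<^sub>R x ^ i) * (sqrt_coeff (n - i) *\<^sub>R x ^ (n - i))) sums (1 - x)"
    unfolding eq by simp
qed

lemma star_sqrt_one_minus:
  assumes "norm (x::'a::cstar_algebra) \<le> 1" "star x = x"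
  shows "star (sqrt_one_minus x) = sqrt_one_minus x"
proof (rule sums_unique2)
  show "(\<lambda>n. star (sqrt_coeff n *\<^sub>R x ^ n)) sums star (sqrt_one_minus x)"
    by (rule bounded_linear.sums[OF bounded_linear_star sqrt_one_minus_sums[OF assms(1)]])
  show "(\<lambda>n. star (sqrt_coeff n *\<^sub>R x ^ n)) sums sqrt_one_minus x"
    using sqrt_one_minus_sums[OF assms(1)] by (simp add: star_scaleR star_power assms(2))
qed

lemma sqrt_one_minus_commute:
  assumes "norm (x::'a::cstar_algebra) \<le> 1" "w * x = x * w"
  shows "w * sqrt_one_minus x = sqrt_one_minus x * w"
proof (rule sums_unique2)
  have "w * x ^ n = x ^ n * w" for n
    by (rule power_commuting_commutes[symmetric]) (simp add: assms(2))
  then show "(\<lambda>n. w * (sqrt_coeff n *\<^sub>R x ^ n)) sums (sqrt_one_minus x * w)"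
    using bounded_linear.sums[OF bounded_linear_mult_left sqrt_one_minus_sums[OF assms(1)], of w]
    by simp
  show "(\<lambda>n. w * (sqrt_coeff n *\<^sub>R x ^ n)) sums (w * sqrt_one_minus x)"
    by (rule bounded_linear.sums[OF bounded_linear_mult_right sqrt_one_minus_sums[OF assms(1)]])
qed

lemma bounded_linear_cinner: "bounded_linear (cinner (v::'a::complex_inner))"
proof (rule bounded_linear_intro[where K = "norm v"])
  show "cinner v (r *\<^sub>R x) = r *\<^sub>R cinner v x" for r and x :: 'a
    by (simp add: scaleR_scaleC cinner_scaleC_right scaleR_conv_of_real)
  show "norm (cinner v x) \<le> norm x * norm v" for x
    using cinner_cauchy_schwarz[of v x] by (simp add: mult.commute)
qed (rule cinner_add_right)

lemma bounded_linear_apply_bop_left: "bounded_linear (\<lambda>T. T \<cdot> x)"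
  by (rule bounded_linear_intro[where K = "norm x"]) (simp_all add: apply_bop_simps norm_apply_bop)

text \<open>Put \<open>r n = Re \<langle>v|X^n v\<rangle> \<le> 1\<close>. As the coefficients
  beyond the constant one are nonpositive, replacing each \<open>r n\<close> by 1 only lowers the
  series, down to the nonnegative sum of the coefficients. The bound on \<open>r 1\<close> leaves a
  strict surplus.\<close>

lemma cinner_sqrt_one_minus_pos:
  fixes X :: "'h::chilbert_space bop"
  assumes X: "norm X \<le> 1" and v: "norm v = 1" and half: "Re (cinner v (X \<cdot> v)) \<le> 1 / 2"
  shows "0 < Re (cinner v (sqrt_one_minus X \<cdot> v))"
proof -
  define r where "r n = Re (cinner v ((X ^ n) \<cdot> v))" for n
  have "(\<lambda>n. Re (cinner v ((sqrt_coeff n *\<^sub>R X ^ n) \<cdot> v))) sums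
      Re (cinner v (sqrt_one_minus X \<cdot> v))"
    by (intro bounded_linear.sums[OF bounded_linear_Re]
        bounded_linear.sums[OF bounded_linear_cinner]
        bounded_linear.sums[OF bounded_linear_apply_bop_left] sqrt_one_minus_sums X)
  then have sums: "(\<lambda>n. sqrt_coeff n * r n) sums Re (cinner v (sqrt_one_minus X \<cdot> v))"
    by (simp add: apply_bop_simps(7) linear_cmul[OF bounded_linear.linear[OF bounded_linear_cinner]] r_def)
  have r_le: "r n \<le> 1" for n
  proof -
    have "r n \<le> norm v * norm ((X ^ n) \<cdot> v)"
      unfolding r_def by (rule order_trans[OF complex_Re_le_cmod cinner_cauchy_schwarz])
    also have "\<dots> \<le> norm (X ^ n) * norm v"
      using norm_apply_bop[of "X ^ n" v] v by simp
    finally show ?thesis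
      using norm_power_le_one[OF X, of n] v by simp
  qed
  have r0: "r 0 = 1"
    using v by (simp add: r_def apply_bop_simps cinner_self)
  have r1: "r 1 \<le> 1 / 2"
    using half by (simp add: r_def)
  \<comment> \<open>The surplus \<open>1/4\<close> is the product of the coefficient
    \<open>-1/2\<close> with \<open>r 1 - 1 \<le> -1/2\<close>.\<close>
  have le: "sqrt_coeff n + (if n = 1 then 1 / 4 else 0) \<le> sqrt_coeff n * r n" for n
  proof (cases n)
    case (Suc m)
    have "sqrt_coeff (Suc m) * 1 \<le> sqrt_coeff (Suc m) * r n"
      using sqrt_coeff_Suc_nonpos r_le by (intro mult_left_mono_neg)
    then show ?thesis
      using r1 Suc by (auto simp: sqrt_coeff_1)
  qed (simp add: r0)
  have "(\<lambda>n. sqrt_coeff n + (if n = 1 then 1 / 4 else (0::real))) sums (suminf sqrt_coeff + 1 / 4)"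
    by (rule sums_add[OF summable_sums[OF summable_rabs_cancel[OF summable_abs_sqrt_coeff]] sums_single, of 1 "\<lambda>_. 1/4"])
  then have "suminf sqrt_coeff + 1 / 4 \<le> Re (cinner v (sqrt_one_minus X \<cdot> v))"
    by (rule sums_le[OF le _ sums])
  then show ?thesis
    using suminf_sqrt_coeff_nonneg by linarith
qed

section \<open>Contractivity of representations\<close>

lemma star_hom_onD:
  assumes "star_hom_on UNIV \<pi>"
  shows "\<pi> (x + y) = \<pi> x + \<pi> y" "\<pi> (x * y) = \<pi> x * \<pi> y" "\<pi> (c *\<^sub>C x) = c *\<^sub>C \<pi> x"
    "\<pi> (star x) = star (\<pi> x)" "\<pi> 1 = 1" "\<pi> 0 = 0" "\<pi> (- x) = - \<pi> x" "\<pi> (x - y) = \<pi> x - \<pi> y"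
proof -
  show *: "\<pi> (x + y) = \<pi> x + \<pi> y" "\<pi> (x * y) = \<pi> x * \<pi> y" "\<pi> (c *\<^sub>C x) = c *\<^sub>C \<pi> x"
    "\<pi> (star x) = star (\<pi> x)" "\<pi> 1 = 1" for x y c
    using assms by (auto simp: star_hom_on_def)
  show "\<pi> 0 = 0"
    using *(1)[of 0 0] by simp
  show m: "\<pi> (- x) = - \<pi> x" for x
    using *(3)[of "-1" x] by (simp add: scaleC_minus1)
  show "\<pi> (x - y) = \<pi> x - \<pi> y"
    using *(1)[of x "- y"] m[of y] by simp
qed

text \<open>Automatic contractivity: \<open>1 - x\<^sup>* x\<close> has a selfadjoint square root, so its image is
  positive.\<close>

lemma norm_representation_le:
  fixes \<pi> :: "'a::cstar_algebra \<Rightarrow> 'h::chilbert_space bop"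
  assumes \<pi>: "representation \<pi>"
  shows "norm (\<pi> x) \<le> norm x"
proof -
  note hom = star_hom_onD[OF \<pi>]
  have unit: "norm (\<pi> x \<cdot> v) \<le> norm v" if "norm x \<le> 1" for x v
  proof -
    let ?x = "star x * x"
    have n: "norm ?x \<le> 1"
      using that by (simp add: cstar_identity power_le_one)
    have s: "star ?x = ?x"
      by (simp add: star_mult star_star)
    define y where "y = sqrt_one_minus ?x"
    have y: "star y * y = 1 - ?x"
      unfolding y_def star_sqrt_one_minus[OF n s] by (rule sqrt_one_minus_square[OF n])
    have "star (\<pi> y) * \<pi> y = 1 - star (\<pi> x) * \<pi> x"
      using arg_cong[OF y, of \<pi>] by (simp add: hom)
    then have "cinner v ((star (\<pi> y) * \<pi> y) \<cdot> v) = cinner v v - cinner v ((star (\<pi> x) * \<pi> x) \<cdot> v)"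
      by (simp add: apply_bop_simps cinner_diff_right)
    then have "complex_of_real ((norm (\<pi> y \<cdot> v))\<^sup>2) =
        complex_of_real ((norm v)\<^sup>2 - (norm (\<pi> x \<cdot> v))\<^sup>2)"
      by (simp add: apply_bop_simps cinner_star_right cinner_self)
    then have "(norm (\<pi> y \<cdot> v))\<^sup>2 = (norm v)\<^sup>2 - (norm (\<pi> x \<cdot> v))\<^sup>2"
      unfolding of_real_eq_iff .
    then have "(norm (\<pi> x \<cdot> v))\<^sup>2 \<le> (norm v)\<^sup>2"
      using zero_le_power2[of "norm (\<pi> y \<cdot> v)"] by linarith
    then show ?thesis
      by (rule power2_le_imp_le) simp
  qed
  show ?thesis
  proof (cases "x = 0")
    case False
    define x' where "x' = complex_of_real (inverse (norm x)) *\<^sub>C x"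
    have x: "x = complex_of_real (norm x) *\<^sub>C x'"
      using False by (simp add: x'_def scaleC_scaleC)
    have "norm x' \<le> 1"
      using False by (simp add: x'_def norm_scaleC norm_inverse)
    then have "norm (\<pi> x') \<le> 1"
      by (intro norm_bop_bound) (simp_all add: unit)
    then have "norm x * norm (\<pi> x') \<le> norm x"
      by (simp add: mult_left_le)
    then show ?thesis
      by (subst x) (simp add: hom(3) norm_scaleC)
  qed (simp add: hom(6))
qed

section \<open>Hilbert space preliminaries\<close>

lemma bounded_bilinear_cinner: "bounded_bilinear (cinner :: 'a::complex_inner \<Rightarrow> 'a \<Rightarrow> complex)"
proof
  show "\<exists>K. \<forall>a b::'a. norm (cinner a b) \<le> norm a * norm b * K"
    by (rule exI[of _ 1]) (simp add: cinner_cauchy_schwarz)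
qed (simp_all add: cinner_add_left cinner_add_right scaleR_scaleC[where 'a = 'a] cinner_scaleC_left
      cinner_scaleC_right scaleR_conv_of_real)

lemmas tendsto_cinner = bounded_bilinear.tendsto[OF bounded_bilinear_cinner]
lemmas continuous_on_cinner = bounded_bilinear.continuous_on[OF bounded_bilinear_cinner]
lemmas continuous_on_apply_bop = bounded_linear.continuous_on[OF bounded_linear_apply_bop]
lemmas tendsto_apply_bop = bounded_linear.tendsto[OF bounded_linear_apply_bop]
lemmas tendsto_scaleC = bounded_linear.tendsto[OF bounded_linear_scaleC]

lemma apply_bop_minus: "T \<cdot> (- x) = - (T \<cdot> x)"
  using apply_bop_scaleC[of T "-1" x] by (simp add: scaleC_minus1)

lemma apply_bop_diff: "T \<cdot> (x - y) = T \<cdot> x - T \<cdot> y"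
  using apply_bop_simps(8)[of T x "- y"] by (simp add: apply_bop_minus)

lemma sum_apply_bop: "(\<Sum>i\<in>A. T i) \<cdot> x = (\<Sum>i\<in>A. T i \<cdot> x)"
  by (rule linear_sum[OF bounded_linear.linear[OF bounded_linear_apply_bop_left]])

lemma apply_bop_sum: "T \<cdot> (\<Sum>i\<in>A. f i) = (\<Sum>i\<in>A. T \<cdot> f i)"
  by (rule linear_sum[OF bounded_linear.linear[OF bounded_linear_apply_bop]])

lemma cinner_sum_right: "cinner x (\<Sum>i\<in>A. f i) = (\<Sum>i\<in>A. cinner x (f i))"
  by (rule linear_sum[OF bounded_linear.linear[OF bounded_linear_cinner]])

lemma cinner_sum_left: "cinner (\<Sum>i\<in>A. f i) (x::'a::complex_inner) = (\<Sum>i\<in>A. cinner (f i) x)"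
  by (induction A rule: infinite_finite_induct) (simp_all add: cinner_add_left)

lemma star_sum: "star (\<Sum>i\<in>A. f i) = (\<Sum>i\<in>A. star (f i :: 'a::cstar_algebra))"
  by (rule linear_sum[OF bounded_linear.linear[OF bounded_linear_star]])

lemma scaleC_sum_right: "c *\<^sub>C (\<Sum>i\<in>A. f i :: 'a::complex_normed_vector) = (\<Sum>i\<in>A. c *\<^sub>C f i)"
  by (rule linear_sum[OF bounded_linear.linear[OF bounded_linear_scaleC]])

lemma scaleC_sum_left:
  "(\<Sum>i\<in>A. f i) *\<^sub>C (x :: 'a::complex_normed_vector) = (\<Sum>i\<in>A. f i *\<^sub>C x)"
proof (induction A rule: infinite_finite_induct)
  case (insert i A)
  then show ?case by (simp add: scaleC_add_left)
qed (simp_all flip: norm_eq_zero add: norm_scaleC)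

lemma scaleC_left_0 [simp]: "0 *\<^sub>C (x :: 'a::complex_normed_vector) = 0"
  by (simp flip: norm_eq_zero add: norm_scaleC)

lemma norm_diff_square:
  "(norm (x - y))\<^sup>2 = (norm x)\<^sup>2 + (norm y)\<^sup>2 - 2 * Re (cinner x (y::'a::complex_inner))"
  using norm_add_square[of x "- y"] cinner_diff_right[of x 0 y] by simp

lemma norm_eq_of_cinner:
  "cinner x x = cinner y y \<Longrightarrow> norm (x::'a::complex_inner) = norm (y::'b::complex_inner)"
  unfolding cinner_self of_real_eq_iff by simp

lemma ex_bop:
  fixes f :: "'h::chilbert_space \<Rightarrow> 'h"
  assumes add: "\<And>x y. f (x + y) = f x + f y" and scale: "\<And>c x. f (c *\<^sub>C x) = c *\<^sub>C f x"
    and bound: "\<And>x. norm (f x) \<le> norm x * K"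
  obtains T where "\<And>x. T \<cdot> x = f x"
proof
  have "bounded_linear f"
    by (rule bounded_linear_intro[OF add _ bound]) (simp add: scaleR_scaleC scale)
  then have "blinfun_apply (Blinfun f) = f"
    by (rule bounded_linear_Blinfun_apply)
  then show "Bop (Blinfun f) \<cdot> x = f x" for x
    by (simp add: apply_bop.rep_eq Bop_inverse scale)
qed

lemma bop_commute_star:
  fixes S T :: "'h::chilbert_space bop"
  assumes "star S * T = T * star S"
  shows "S * star T = star T * S"
  using arg_cong[OF assms, of star] by (simp add: star_mult star_star)

section \<open>Closed subspaces and orthogonal projections\<close>

lemma closed_csubspaceD:
  assumes "closed_csubspace M"
  shows "closed M" "0 \<in> M" "x \<in> M \<Longrightarrow> y \<in> M \<Longrightarrow> x + y \<in> M" "x \<in> M \<Longrightarrow> c *\<^sub>C x \<in> M"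
    "x \<in> M \<Longrightarrow> y \<in> M \<Longrightarrow> x - y \<in> M" "(\<And>i. i \<in> A \<Longrightarrow> f i \<in> M) \<Longrightarrow> (\<Sum>i\<in>A. f i) \<in> M"
proof -
  show *: "closed M" "0 \<in> M" "x \<in> M \<Longrightarrow> y \<in> M \<Longrightarrow> x + y \<in> M" "x \<in> M \<Longrightarrow> c *\<^sub>C x \<in> M"
    for x y c
    using assms by (auto simp: closed_csubspace_def)
  show "x \<in> M \<Longrightarrow> y \<in> M \<Longrightarrow> x - y \<in> M"
    using *(3)[of x "- y"] *(4)[of y "-1"] by (simp add: scaleC_minus1)
  show "(\<And>i. i \<in> A \<Longrightarrow> f i \<in> M) \<Longrightarrow> (\<Sum>i\<in>A. f i) \<in> M"
    by (induction A rule: infinite_finite_induct) (simp_all add: *)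
qed

lemma closed_csubspace_closure:
  assumes "0 \<in> S" "\<And>x y. x \<in> S \<Longrightarrow> y \<in> S \<Longrightarrow> x + y \<in> S" "\<And>c x. x \<in> S \<Longrightarrow> c *\<^sub>C x \<in> S"
  shows "closed_csubspace (closure S)"
  unfolding closed_csubspace_def
proof (intro conjI ballI allI)
  show "0 \<in> closure S"
    using assms(1) closure_subset by blast
  fix x assume "x \<in> closure S"
  then obtain X where X: "\<And>n. X n \<in> S" "X \<longlonglongrightarrow> x"
    by (auto simp: closure_sequential)
  show "c *\<^sub>C x \<in> closure S" for c
    unfolding closure_sequential
    by (rule exI[of _ "\<lambda>n. c *\<^sub>C X n"]) (simp add: X assms(3) tendsto_scaleC)
  fix y assume "y \<in> closure S"
  then obtain Y where Y: "\<And>n. Y n \<in> S" "Y \<longlonglongrightarrow> y"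
    by (auto simp: closure_sequential)
  show "x + y \<in> closure S"
    unfolding closure_sequential
    by (rule exI[of _ "\<lambda>n. X n + Y n"]) (simp add: X Y assms(2) tendsto_add)
qed simp

lemma apply_bop_closure:
  assumes "\<And>x. x \<in> S \<Longrightarrow> T \<cdot> x \<in> closure S'" "x \<in> closure S"
  shows "T \<cdot> x \<in> closure S'"
proof -
  have "((\<cdot>) T) ` closure S \<subseteq> closure S'"
    using assms(1)
    by (intro image_closure_subset[OF continuous_on_apply_bop[OF continuous_on_id]]) auto
  with assms(2) show ?thesis by auto
qed

lemma closed_csubspace_orthogonal: "closed_csubspace {x. \<forall>v\<in>V. cinner v x = 0}"
proof -
  have "{x. \<forall>v\<in>V. cinner v x = 0} = (\<Inter>v\<in>V. {x. cinner v x = 0})"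
    by auto
  moreover have "closed {x. cinner v x = 0}" for v :: 'a
    by (rule closed_Collect_eq[OF continuous_on_cinner[OF continuous_on_const continuous_on_id]
          continuous_on_const])
  then have "closed (\<Inter>v\<in>V. {x. cinner v x = 0})"
    by (simp add: closed_INT)
  ultimately show ?thesis
    unfolding closed_csubspace_def
    by (simp add: cinner_add_right cinner_scaleC_right)
qed

lemma closed_csubspace_kernel: "closed_csubspace {x. T \<cdot> x = 0}"
proof -
  have "closed {x. T \<cdot> x = 0}"
    by (rule closed_Collect_eq[OF continuous_on_apply_bop[OF continuous_on_id] continuous_on_const])
  then show ?thesis
    unfolding closed_csubspace_def by (simp add: apply_bop_simps apply_bop_scaleC)
qed

text \<open>\<open>p\<close> is the point of \<open>S\<close> closest to \<open>x\<close>: a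
  minimising sequence is Cauchy by the parallelogram law, and comparing \<open>p\<close> with
  \<open>p + c y\<close> forces orthogonality.\<close>

lemma orthogonal_projection_exists:
  fixes S :: "'h::chilbert_space set"
  assumes S: "closed_csubspace S"
  obtains p where "p \<in> S" "\<And>y. y \<in> S \<Longrightarrow> cinner y (x - p) = 0"
proof -
  note sub = closed_csubspaceD[OF S]
  define m where "m = Inf ((\<lambda>y. (norm (x - y))\<^sup>2) ` S)"
  have bdd: "bdd_below ((\<lambda>y. (norm (x - y))\<^sup>2) ` S)"
    by (auto intro: bdd_belowI[of _ 0])
  have m_le: "m \<le> (norm (x - y))\<^sup>2" if "y \<in> S" for y
    unfolding m_def using that bdd by (intro cInf_lower) auto
  have "\<exists>y\<in>S. (norm (x - y))\<^sup>2 < m + 1 / real (Suc n)" for n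
    using cInf_lessD[of "(\<lambda>y. (norm (x - y))\<^sup>2) ` S" "m + 1 / real (Suc n)"] sub(2)
    by (auto simp: m_def)
  then obtain Y where Y: "\<And>n. Y n \<in> S" "\<And>n. (norm (x - Y n))\<^sup>2 < m + 1 / real (Suc n)"
    by metis
  have dY: "(norm (Y n - Y k))\<^sup>2 \<le> 2 / real (Suc n) + 2 / real (Suc k)" for n k
  proof -
    let ?u = "x - Y n" and ?v = "x - Y k"
    have "(norm (?u - ?v))\<^sup>2 + (norm (?u + ?v))\<^sup>2 = 2 * (norm ?u)\<^sup>2 + 2 * (norm ?v)\<^sup>2"
      unfolding norm_add_square norm_diff_square by simp
    moreover have "?u + ?v = 2 *\<^sub>R (x - (1 / 2) *\<^sub>R (Y n + Y k))"
      by (simp add: algebra_simps scaleR_2)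
    then have "(norm (?u + ?v))\<^sup>2 = 4 * (norm (x - (1 / 2) *\<^sub>R (Y n + Y k)))\<^sup>2"
      by (simp add: power_mult_distrib)
    moreover have "m \<le> (norm (x - (1 / 2) *\<^sub>R (Y n + Y k)))\<^sup>2"
      by (intro m_le) (auto simp: scaleR_scaleC intro: sub Y)
    moreover have "norm (?u - ?v) = norm (Y n - Y k)"
      by (simp add: norm_minus_commute)
    ultimately show ?thesis
      using Y(2)[of n] Y(2)[of k] by simp
  qed
  have "Cauchy Y"
  proof (rule CauchyI)
    fix e :: real assume e: "0 < e"
    obtain M where M: "4 / e\<^sup>2 < real M"
      using reals_Archimedean2 by blast
    have M1: "1 / real (Suc i) < e\<^sup>2 / 4" if "i \<ge> M" for i
    proof -
      have "4 / e\<^sup>2 < real (Suc i)" using M that by simp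
      then show ?thesis using e by (simp add: field_simps)
    qed
    have "norm (Y n - Y k) < e" if "n \<ge> M" "k \<ge> M" for n k
    proof -
      have "(norm (Y n - Y k))\<^sup>2 < e\<^sup>2"
        using dY[of n k] M1[OF that(1)] M1[OF that(2)] by simp
      then show ?thesis
        using e by (simp add: power2_less_imp_less)
    qed
    then show "\<exists>M. \<forall>n\<ge>M. \<forall>k\<ge>M. norm (Y n - Y k) < e" by blast
  qed
  then obtain p where p: "Y \<longlonglongrightarrow> p"
    using Cauchy_convergent convergent_def by blast
  have pS: "p \<in> S"
    using closed_sequentially[OF sub(1)] Y(1) p by blast
  have "(\<lambda>n. (norm (x - Y n))\<^sup>2) \<longlonglongrightarrow> (norm (x - p))\<^sup>2"
    by (intro tendsto_intros p)
  moreover have "(\<lambda>n. m + 1 / real (Suc n)) \<longlonglongrightarrow> m + 0"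
    by (intro tendsto_intros LIMSEQ_Suc lim_const_over_n)
  ultimately have "(norm (x - p))\<^sup>2 \<le> m + 0"
    using Y(2) by (intro LIMSEQ_le) (auto intro: less_imp_le)
  then have min: "(norm (x - p))\<^sup>2 \<le> (norm (x - y))\<^sup>2" if "y \<in> S" for y
    using m_le[OF that] by linarith
  have "cinner y (x - p) = 0" if y: "y \<in> S" for y
  proof -
    define a where "a = cinner y (x - p)"
    \<comment> \<open>Moving from \<open>p\<close> to \<open>p + s a y\<close> changes the squared
      distance by \<open>s |a|^2 (s |y|^2 - 2)\<close>; this \<open>s\<close> makes the last factor
      negative.\<close>
    define s where "s = 1 / ((norm y)\<^sup>2 + 1)"
    have pos: "0 < (norm y)\<^sup>2 + 1"
      by (intro add_nonneg_pos) auto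
    have s: "0 < s" "s * (norm y)\<^sup>2 < 1"
      using pos by (simp_all add: s_def)
    define c where "c = complex_of_real s * a"
    have "(norm (x - p))\<^sup>2 \<le> (norm (x - (p + c *\<^sub>C y)))\<^sup>2"
      by (intro min sub pS y)
    also have "x - (p + c *\<^sub>C y) = (x - p) - c *\<^sub>C y"
      by simp
    also have "(norm \<dots>)\<^sup>2 = (norm (x - p))\<^sup>2 + (cmod c * norm y)\<^sup>2 - 2 * Re (c * cnj a)"
      unfolding norm_diff_square a_def
      by (simp only: norm_scaleC cinner_scaleC_right cinner_commute[of "x - p" y])
    also have "c * cnj a = complex_of_real (s * (cmod a)\<^sup>2)"
      unfolding c_def by (simp only: mult.assoc complex_norm_square[symmetric] of_real_mult)
    finally have "0 \<le> (cmod c * norm y)\<^sup>2 - 2 * (s * (cmod a)\<^sup>2)"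
      by simp
    also have "\<dots> = s * (cmod a)\<^sup>2 * (s * (norm y)\<^sup>2 - 2)"
      using s(1) by (simp add: c_def norm_mult power2_eq_square algebra_simps)
    finally have "s * (cmod a)\<^sup>2 \<le> 0"
      using s(2) by (simp add: zero_le_mult_iff)
    then show ?thesis
      using s(1) by (simp add: mult_le_0_iff a_def)
  qed
  with pS show ?thesis using that by blast
qed

section \<open>Induction on the Cuntz algebra\<close>

lemma eval_cuntz_outside: "\<not> cuntz_family t \<Longrightarrow> eval_cuntz x t = 0"
  by (rule cuntz_fun_outside[of "eval_cuntz x"]) (use eval_cuntz[of x] in simp_all)

text \<open>Elements of the Cuntz algebra are uniform limits of *-polynomials, so a closed property
  needs checking on polynomials only. No case for \<open>star\<close> of a general element arises,
  since the adjoint can be pushed down to the generators.\<close>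

lemma cuntz_induct [case_names gen star_gen one add mult scaleC closed]:
  fixes x :: "'n::finite cuntz"
  assumes gen: "\<And>i. P (cuntz_gen i)" and star_gen: "\<And>i. P (star (cuntz_gen i))" and one: "P 1"
    and add: "\<And>x y. P x \<Longrightarrow> P y \<Longrightarrow> P (x + y)" and mult: "\<And>x y. P x \<Longrightarrow> P y \<Longrightarrow> P (x * y)"
    and scaleC: "\<And>c x. P x \<Longrightarrow> P (c *\<^sub>C x)" and closed: "closed {x. P x}"
  shows "P x"
proof -
  \<comment> \<open>Carrying \<open>P (star y)\<close> along is what disposes of the
    \<open>star\<close> rule. Agreement is demanded on Cuntz families only, because elements of the
    algebra vanish elsewhere.\<close>
  have poly: "\<exists>y. P y \<and> P (star y) \<and> (\<forall>t. cuntz_family t \<longrightarrow> eval_cuntz y t = p t)"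
    if "p \<in> star_polynomials" for p
    using that
  proof induction
    case (gen i)
    show ?case
      by (rule exI[of _ "cuntz_gen i"]) (simp add: assms cuntz_gen.rep_eq)
  next
    case one
    show ?case
      by (rule exI[of _ 1]) (simp add: assms eval_cuntz_simps)
  next
    case (add p q)
    then obtain y y' where "P y \<and> P (star y) \<and> (\<forall>t. cuntz_family t \<longrightarrow> eval_cuntz y t = p t)"
        "P y' \<and> P (star y') \<and> (\<forall>t. cuntz_family t \<longrightarrow> eval_cuntz y' t = q t)"
      by blast
    then show ?case
      by (intro exI[of _ "y + y'"]) (simp add: assms eval_cuntz_simps star_add)
  next
    case (mult p q)
    then obtain y y' where "P y \<and> P (star y) \<and> (\<forall>t. cuntz_family t \<longrightarrow> eval_cuntz y t = p t)"
        "P y' \<and> P (star y') \<and> (\<forall>t. cuntz_family t \<longrightarrow> eval_cuntz y' t = q t)"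
      by blast
    then show ?case
      by (intro exI[of _ "y * y'"]) (simp add: assms eval_cuntz_simps star_mult)
  next
    case (scaleC p c)
    then obtain y where "P y \<and> P (star y) \<and> (\<forall>t. cuntz_family t \<longrightarrow> eval_cuntz y t = p t)"
      by blast
    then show ?case
      by (intro exI[of _ "c *\<^sub>C y"]) (simp add: assms eval_cuntz_simps star_scaleC)
  next
    case (star p)
    then obtain y where "P y \<and> P (star y) \<and> (\<forall>t. cuntz_family t \<longrightarrow> eval_cuntz y t = p t)"
      by blast
    then show ?case
      by (intro exI[of _ "star y"]) (simp add: star_cuntz.rep_eq star_star)
  qed
  have "\<exists>y\<in>{x. P x}. dist y x < e" if "0 < e" for e
  proof -
    have "cuntz_fun (eval_cuntz x)" "0 < e / 2"
      using eval_cuntz[of x] \<open>0 < e\<close> by simp_all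
    then obtain p where p: "p \<in> star_polynomials"
        "\<And>t. cuntz_family t \<Longrightarrow> norm (eval_cuntz x t - p t) \<le> e / 2"
      by (rule cuntz_funE) blast
    from poly[OF p(1)] obtain y where y: "P y" "\<And>t. cuntz_family t \<Longrightarrow> eval_cuntz y t = p t"
      by blast
    have "norm (x - y) \<le> e / 2"
    proof (rule norm_cuntz_le)
      show "norm (eval_cuntz (x - y) t) \<le> e / 2" for t
        by (cases "cuntz_family t") (use p(2) y(2) \<open>0 < e\<close> in
            \<open>simp_all add: minus_cuntz.rep_eq eval_cuntz_outside\<close>)
    qed
    then show ?thesis
      using y(1) \<open>0 < e\<close> by (intro bexI[of _ y]) (simp_all add: dist_norm norm_minus_commute)
  qed
  then have "x \<in> {x. P x}"
    using closed_approachable[OF closed] by blast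
  then show ?thesis by simp
qed

lemma bounded_linear_representation:
  assumes "representation \<pi>"
  shows "bounded_linear \<pi>"
  using norm_representation_le[OF assms]
  by (intro bounded_linear_intro[where K = 1])
    (simp_all add: star_hom_onD[OF assms] scaleR_scaleC)

lemmas continuous_on_representation =
  bounded_linear.continuous_on[OF bounded_linear_compose[OF bounded_linear_apply_bop_left
    bounded_linear_representation]]

lemma representation_invariant:
  fixes \<pi> :: "'n::finite cuntz \<Rightarrow> 'h::chilbert_space bop"
  assumes \<pi>: "representation \<pi>" and S: "closed_csubspace S"
    and gen: "\<And>i v. v \<in> S \<Longrightarrow> \<pi> (cuntz_gen i) \<cdot> v \<in> S"
    and star_gen: "\<And>i v. v \<in> S \<Longrightarrow> star (\<pi> (cuntz_gen i)) \<cdot> v \<in> S"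
    and v: "v \<in> S"
  shows "\<pi> x \<cdot> v \<in> S"
proof -
  note hom = star_hom_onD[OF \<pi>] and sub = closed_csubspaceD[OF S]
  \<comment> \<open>The quantifier over \<open>v\<close> belongs to the induction predicate: the
    product case applies one factor to the image under the other.\<close>
  have "\<forall>v\<in>S. \<pi> x \<cdot> v \<in> S"
  proof (induction x rule: cuntz_induct)
    case closed
    have "{x. \<forall>v\<in>S. \<pi> x \<cdot> v \<in> S} = (\<Inter>v\<in>S. (\<lambda>x. \<pi> x \<cdot> v) -` S)"
      by auto
    moreover have "closed ((\<lambda>x. \<pi> x \<cdot> v) -` S)" for v
      by (rule closed_vimage[OF sub(1) continuous_on_representation[OF \<pi> continuous_on_id]])
    ultimately show ?case
      by (simp add: closed_INT)
  qed (simp_all add: hom(1-5) apply_bop_simps(2,3,6) apply_scaleC_bop gen star_gen sub(3,4))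
  with v show ?thesis by blast
qed

lemma cyclic_vector_subspace:
  assumes "cyclic_vector \<pi> \<Omega>" "closed S" "\<And>x. \<pi> x \<cdot> \<Omega> \<in> S"
  shows "S = UNIV"
  using closure_minimal[of "range (\<lambda>a. \<pi> a \<cdot> \<Omega>)" S] assms by (auto simp: cyclic_vector_def)

section \<open>Chains\<close>

text \<open>Working with a relation avoids defining a map on words and proving it well defined:
  preservation of inner products already makes the closure of \<open>G\<close> the graph of an
  isometry, and density on both sides makes it a unitary.\<close>

lemma unitary_of_relation:
  fixes G :: "('h::chilbert_space \<times> 'g::chilbert_space) set"
    and \<pi> :: "'n::finite cuntz \<Rightarrow> 'h bop" and \<rho> :: "'n cuntz \<Rightarrow> 'g bop"
  assumes \<pi>: "representation \<pi>" and \<rho>: "representation \<rho>"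
    and add: "\<And>x x' y y'. (x, x') \<in> G \<Longrightarrow> (y, y') \<in> G \<Longrightarrow> (x + y, x' + y') \<in> G"
    and scaleC: "\<And>c x x'. (x, x') \<in> G \<Longrightarrow> (c *\<^sub>C x, c *\<^sub>C x') \<in> G"
    and gen: "\<And>i x x'. (x, x') \<in> G \<Longrightarrow> (\<pi> (cuntz_gen i) \<cdot> x, \<rho> (cuntz_gen i) \<cdot> x') \<in> G"
    and star_gen: "\<And>i x x'. (x, x') \<in> G \<Longrightarrow>
      (star (\<pi> (cuntz_gen i)) \<cdot> x, star (\<rho> (cuntz_gen i)) \<cdot> x') \<in> G"
    and inner: "\<And>x x' y y'. (x, x') \<in> G \<Longrightarrow> (y, y') \<in> G \<Longrightarrow> cinner x y = cinner x' y'"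
    and dense: "closure (fst ` G) = UNIV" "closure (snd ` G) = UNIV"
  obtains U where "surj U" "\<And>x y. U (x + y) = U x + U y" "\<And>c x. U (c *\<^sub>C x) = c *\<^sub>C U x"
    "\<And>x y. cinner (U x) (U y) = cinner x y" "\<And>a x. U (\<pi> a \<cdot> x) = \<rho> a \<cdot> U x"
    "\<And>x x'. (x, x') \<in> G \<Longrightarrow> U x = x'"
proof -
  note hom\<pi> = star_hom_onD[OF \<pi>] and hom\<rho> = star_hom_onD[OF \<rho>]
  define R where
    "R x x' \<longleftrightarrow> (\<exists>X X'. (\<forall>n. (X n, X' n) \<in> G) \<and> X \<longlonglongrightarrow> x \<and> X' \<longlonglongrightarrow> x')" for x x'
  have RI: "R x x'" if "\<And>n. (X n, X' n) \<in> G" "X \<longlonglongrightarrow> x" "X' \<longlonglongrightarrow> x'" for x x' X X'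
    unfolding R_def using that by blast
  have R_inner: "cinner x y = cinner x' y'" if R: "R x x'" "R y y'" for x x' y y'
  proof -
    obtain X X' where X: "\<And>n. (X n, X' n) \<in> G" "X \<longlonglongrightarrow> x" "X' \<longlonglongrightarrow> x'"
      using R(1) by (auto simp: R_def)
    obtain Y Y' where Y: "\<And>n. (Y n, Y' n) \<in> G" "Y \<longlonglongrightarrow> y" "Y' \<longlonglongrightarrow> y'"
      using R(2) by (auto simp: R_def)
    have "cinner (X n) (Y n) = cinner (X' n) (Y' n)" for n
      by (rule inner[OF X(1) Y(1)])
    then show ?thesis
      using LIMSEQ_unique[OF tendsto_cinner[OF X(2) Y(2)]] tendsto_cinner[OF X(3) Y(3)] by simp
  qed
  have R_add: "R (x + y) (x' + y')" if R: "R x x'" "R y y'" for x x' y y'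
  proof -
    obtain X X' where X: "\<And>n. (X n, X' n) \<in> G" "X \<longlonglongrightarrow> x" "X' \<longlonglongrightarrow> x'"
      using R(1) by (auto simp: R_def)
    obtain Y Y' where Y: "\<And>n. (Y n, Y' n) \<in> G" "Y \<longlonglongrightarrow> y" "Y' \<longlonglongrightarrow> y'"
      using R(2) by (auto simp: R_def)
    show ?thesis
      by (rule RI[OF add[OF X(1) Y(1)] tendsto_add[OF X(2) Y(2)] tendsto_add[OF X(3) Y(3)]])
  qed
  have R_scaleC: "R (c *\<^sub>C x) (c *\<^sub>C x')" if R: "R x x'" for c x x'
  proof -
    obtain X X' where X: "\<And>n. (X n, X' n) \<in> G" "X \<longlonglongrightarrow> x" "X' \<longlonglongrightarrow> x'"
      using R by (auto simp: R_def)
    show ?thesis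
      by (rule RI[OF scaleC[OF X(1)] tendsto_scaleC[OF X(2)] tendsto_scaleC[OF X(3)]])
  qed
  have R_apply: "R (S \<cdot> x) (S' \<cdot> x')"
    if R: "R x x'" and S: "\<And>x x'. (x, x') \<in> G \<Longrightarrow> (S \<cdot> x, S' \<cdot> x') \<in> G" for x x' S S'
  proof -
    obtain X X' where X: "\<And>n. (X n, X' n) \<in> G" "X \<longlonglongrightarrow> x" "X' \<longlonglongrightarrow> x'"
      using R by (auto simp: R_def)
    show ?thesis
      by (rule RI[OF S[OF X(1)] tendsto_apply_bop[OF X(2)] tendsto_apply_bop[OF X(3)]])
  qed
  have R_diff: "R (x - y) (x' - y')" if "R x x'" "R y y'" for x x' y y'
    using R_add[OF that(1) R_scaleC[OF that(2), of "-1"]] by (simp add: scaleC_minus1)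
  \<comment> \<open>Related sequences have equal mutual distances, so convergence of one side yields
    convergence of the other, in both directions.\<close>
  have dist: "dist (X n) (X m) = dist (X' n) (X' m)" if "\<And>n. (X n, X' n) \<in> G" for X X' n m
  proof -
    have "R (X n) (X' n)" for n
      using that by (intro RI[of "\<lambda>_. X n" "\<lambda>_. X' n"]) auto
    then have "R (X n - X m) (X' n - X' m)"
      by (intro R_diff)
    then show ?thesis
      unfolding dist_norm by (intro norm_eq_of_cinner R_inner)
  qed
  have ex1: "\<exists>x'. R x x'" for x
  proof -
    have "x \<in> closure (fst ` G)"
      by (simp add: dense)
    then obtain X where X: "\<And>n. X n \<in> fst ` G" "X \<longlonglongrightarrow> x"
      unfolding closure_sequential by blast
    then have "\<exists>X'. \<forall>n. (X n, X' n) \<in> G"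
      by (intro choice) force
    then obtain X' where X': "\<And>n. (X n, X' n) \<in> G" by blast
    have "Cauchy X'"
      using LIMSEQ_imp_Cauchy[OF X(2)] dist[of X X', OF X'] unfolding Cauchy_def by simp
    then obtain x' where "X' \<longlonglongrightarrow> x'"
      using Cauchy_convergent convergent_def by blast
    then show ?thesis
      using RI[OF X' X(2)] by blast
  qed
  have ex2: "\<exists>x. R x x'" for x'
  proof -
    have "x' \<in> closure (snd ` G)"
      by (simp add: dense)
    then obtain X' where X': "\<And>n. X' n \<in> snd ` G" "X' \<longlonglongrightarrow> x'"
      unfolding closure_sequential by blast
    then have "\<exists>X. \<forall>n. (X n, X' n) \<in> G"
      by (intro choice) force
    then obtain X where X: "\<And>n. (X n, X' n) \<in> G" by blast
    have "Cauchy X"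
      using LIMSEQ_imp_Cauchy[OF X'(2)] dist[of X X', OF X] unfolding Cauchy_def by simp
    then obtain x where "X \<longlonglongrightarrow> x"
      using Cauchy_convergent convergent_def by blast
    then show ?thesis
      using RI[OF X _ X'(2)] by blast
  qed
  define U where "U x = (SOME x'. R x x')" for x
  have RU: "R x (U x)" for x
    unfolding U_def using ex1 by (rule someI_ex)
  \<comment> \<open>Single-valuedness: two partners of \<open>x\<close> differ by a partner of 0,
    which has norm 0.\<close>
  have U_eq: "U x = x'" if "R x x'" for x x'
  proof -
    have R0: "R 0 (U x - x')"
      using R_diff[OF RU[of x] that] by simp
    have "norm (U x - x') = norm (0::'h)"
      using R_inner[OF R0 R0] by (intro norm_eq_of_cinner) simp
    then show ?thesis by simp
  qed
  have U_add: "U (x + y) = U x + U y" for x y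
    by (intro U_eq R_add RU)
  have U_scaleC: "U (c *\<^sub>C x) = c *\<^sub>C U x" for c x
    by (intro U_eq R_scaleC RU)
  have U_inner: "cinner (U x) (U y) = cinner x y" for x y
    by (rule R_inner[OF RU RU, symmetric])
  have "bounded_linear U"
  proof (rule bounded_linear_intro[where K = 1])
    show "norm (U x) \<le> norm x * 1" for x
      using norm_eq_of_cinner[OF U_inner, of x] by simp
  qed (simp_all add: U_add U_scaleC scaleR_scaleC)
  note continuous_U = bounded_linear.continuous_on[OF this]
  have "\<forall>x. U (\<pi> a \<cdot> x) = \<rho> a \<cdot> U x" for a
  proof (induction a rule: cuntz_induct)
    case (gen i)
    show ?case
      by (intro allI U_eq R_apply RU assms(5))
  next
    case (star_gen i)
    show ?case
      unfolding hom\<pi> hom\<rho> by (intro allI U_eq R_apply RU assms(6))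
  next
    case closed
    have "closed {a. U (\<pi> a \<cdot> x) = \<rho> a \<cdot> U x}" for x
      by (rule closed_Collect_eq[OF continuous_U[OF continuous_on_representation[OF \<pi> continuous_on_id]]
            continuous_on_representation[OF \<rho> continuous_on_id]])
    moreover have "{a. \<forall>x. U (\<pi> a \<cdot> x) = \<rho> a \<cdot> U x} = (\<Inter>x. {a. U (\<pi> a \<cdot> x) = \<rho> a \<cdot> U x})"
      by auto
    ultimately show ?case
      by (simp add: closed_INT)
  qed (simp_all add: hom\<pi>(1-5) hom\<rho>(1-5) apply_bop_simps(2,3,6) apply_scaleC_bop U_add U_scaleC)
  moreover have "surj U"
    using ex2 U_eq by (metis surjI)
  moreover have "U x = x'" if "(x, x') \<in> G" for x x'
    using that by (intro U_eq RI[of "\<lambda>_. x" "\<lambda>_. x'"]) auto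
  ultimately show ?thesis
    using that U_add U_scaleC U_inner by blast
qed

section \<open>The Cuntz relations and the operators \<open>s(w)\<close>\<close>

lemma star_gen_gen:
  fixes \<pi> :: "'n::finite cuntz \<Rightarrow> 'h::chilbert_space bop"
  assumes "representation \<pi>"
  shows "star (\<pi> (cuntz_gen i)) \<cdot> \<pi> (cuntz_gen j) \<cdot> v = (if i = j then v else 0)"
proof -
  note hom = star_hom_onD[OF assms]
  have "star (\<pi> (cuntz_gen i)) * \<pi> (cuntz_gen j) = \<pi> (star (cuntz_gen i) * cuntz_gen j)"
    by (simp add: hom)
  also have "star (cuntz_gen i) * cuntz_gen j = (if i = j then 1 else 0)"
    using cuntz_family_cuntz_gen[where 'n = 'n] by (auto simp: cuntz_family_def)
  finally show ?thesis
    by (auto simp: apply_bop_simps hom simp flip: apply_bop_simps(6))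
qed

lemma sum_gen_star_gen:
  fixes \<pi> :: "'n::finite cuntz \<Rightarrow> 'h::chilbert_space bop"
  assumes "representation \<pi>"
  shows "(\<Sum>i\<in>UNIV. \<pi> (cuntz_gen i) \<cdot> star (\<pi> (cuntz_gen i)) \<cdot> v) = v"
proof -
  note hom = star_hom_onD[OF assms]
  have sum: "\<pi> (sum f A) = (\<Sum>i\<in>A. \<pi> (f i))" for f and A :: "'n set"
    by (rule linear_sum[OF bounded_linear.linear[OF bounded_linear_representation[OF assms]]])
  have "(\<Sum>i\<in>UNIV. \<pi> (cuntz_gen i) * star (\<pi> (cuntz_gen i))) =
      \<pi> (\<Sum>i\<in>UNIV. cuntz_gen i * star (cuntz_gen i))"
    by (simp add: sum hom)
  also have "(\<Sum>i\<in>UNIV. cuntz_gen i * star (cuntz_gen i :: 'n cuntz)) = 1"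
    using cuntz_family_cuntz_gen[where 'n = 'n] by (simp add: cuntz_family_def)
  finally have "(\<Sum>i\<in>UNIV. \<pi> (cuntz_gen i) * star (\<pi> (cuntz_gen i))) \<cdot> v = v"
    by (simp add: hom apply_bop_simps)
  then show ?thesis
    by (simp add: sum_apply_bop apply_bop_simps)
qed

definition comb_op :: "('n::finite cuntz \<Rightarrow> 'h::chilbert_space bop) \<Rightarrow> complex ^ 'n \<Rightarrow> 'h bop" where
  "comb_op \<pi> w = (\<Sum>i\<in>UNIV. (w $ i) *\<^sub>C \<pi> (cuntz_gen i))"

lemma comb_op_eq:
  fixes \<pi> :: "'n::finite cuntz \<Rightarrow> 'h::chilbert_space bop"
  assumes "representation \<pi>"
  shows "\<pi> (cuntz_comb w) = comb_op \<pi> w"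
proof -
  have sum: "\<pi> (sum f A) = (\<Sum>i\<in>A. \<pi> (f i))" for f and A :: "'n set"
    by (rule linear_sum[OF bounded_linear.linear[OF bounded_linear_representation[OF assms]]])
  show ?thesis
    by (simp add: cuntz_comb_def comb_op_def sum star_hom_onD[OF assms])
qed

lemma apply_comb_op: "comb_op \<pi> w \<cdot> v = (\<Sum>i\<in>UNIV. (w $ i) *\<^sub>C \<pi> (cuntz_gen i) \<cdot> v)"
  by (simp add: comb_op_def sum_apply_bop apply_scaleC_bop)

lemma apply_star_comb_op:
  "star (comb_op \<pi> w) \<cdot> v = (\<Sum>i\<in>UNIV. cnj (w $ i) *\<^sub>C star (\<pi> (cuntz_gen i)) \<cdot> v)"
  by (simp add: comb_op_def star_sum star_scaleC sum_apply_bop apply_scaleC_bop)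

lemma star_gen_comb_op:
  assumes "representation \<pi>"
  shows "star (\<pi> (cuntz_gen i)) \<cdot> comb_op \<pi> w \<cdot> v = (w $ i) *\<^sub>C v"
  by (simp add: apply_comb_op apply_bop_sum apply_bop_scaleC star_gen_gen[OF assms] if_distrib cong: if_cong)

lemma star_comb_op_comb_op:
  assumes "representation \<pi>"
  shows "star (comb_op \<pi> w) \<cdot> comb_op \<pi> w' \<cdot> v = vinner w w' *\<^sub>C v"
  by (simp add: apply_star_comb_op star_gen_comb_op[OF assms] scaleC_scaleC vinner_def
      scaleC_sum_left)

lemma cinner_comb_op:
  assumes "representation \<pi>"
  shows "cinner (comb_op \<pi> w \<cdot> u) (comb_op \<pi> w' \<cdot> v) = vinner w w' * cinner u v"
  by (simp add: star_comb_op_comb_op[OF assms] cinner_scaleC_right flip: cinner_star_right)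

lemma vinner_self: "vinner w w = complex_of_real ((norm w)\<^sup>2)"
  by (simp add: vinner_def norm_vec_def L2_set_def sum_nonneg complex_norm_square mult.commute
      del: of_real_power)

lemma cnj_vinner: "cnj (vinner v w) = vinner w v"
  by (simp add: vinner_def mult.commute)

lemma cmod_vinner_commute: "cmod (vinner v w) = cmod (vinner w v)"
  by (metis cnj_vinner complex_mod_cnj)

lemma cmod_vinner_le: "cmod (vinner v w) \<le> norm v * norm w"
proof -
  have "cmod (vinner v w) \<le> (\<Sum>i\<in>UNIV. \<bar>cmod (v $ i)\<bar> * \<bar>cmod (w $ i)\<bar>)"
    unfolding vinner_def by (rule order_trans[OF norm_sum]) (simp add: norm_mult)
  also have "\<dots> \<le> norm v * norm w"
    unfolding norm_vec_def by (rule L2_set_mult_ineq)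
  finally show ?thesis .
qed

lemma norm_comb_op:
  assumes "representation \<pi>" "norm w = 1"
  shows "norm (comb_op \<pi> w \<cdot> v) = norm v"
  by (rule norm_eq_of_cinner) (simp add: cinner_comb_op[OF assms(1)] vinner_self assms(2))

text \<open>Asking for the equation with every generator, not just for \<open>s(z)\<close> as a
  whole, makes the linear span of the \<open>s_J \<omega>_n\<close> invariant under the adjoints of
  the generators. Norms and orthogonality are kept out of the notion so that projections and
  differences of chains are again chains.\<close>

definition product_chain ::
  "('n::finite cuntz \<Rightarrow> 'h::chilbert_space bop) \<Rightarrow> (nat \<Rightarrow> complex ^ 'n) \<Rightarrow> (nat \<Rightarrow> 'h) \<Rightarrow> bool" where
  "product_chain \<pi> z \<omega> \<longleftrightarrow>
    (\<forall>m i. star (\<pi> (cuntz_gen i)) \<cdot> \<omega> m = (z (Suc m) $ i) *\<^sub>C \<omega> (Suc m))"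

definition orthonormal :: "(nat \<Rightarrow> 'h::chilbert_space) \<Rightarrow> bool" where
  "orthonormal \<omega> \<longleftrightarrow> (\<forall>m n. cinner (\<omega> m) (\<omega> n) = (if m = n then 1 else 0))"

lemma orthonormal_norm: "orthonormal \<omega> \<Longrightarrow> norm (\<omega> m) = 1"
  using cinner_self[of "\<omega> m"] norm_ge_zero[of "\<omega> m"]
  by (simp add: orthonormal_def power2_eq_1_iff flip: of_real_power)

lemma star_comb_op_chain:
  assumes "product_chain \<pi> z \<omega>"
  shows "star (comb_op \<pi> w) \<cdot> \<omega> m = vinner w (z (Suc m)) *\<^sub>C \<omega> (Suc m)"
  using assms by (simp add: product_chain_def apply_star_comb_op scaleC_scaleC vinner_def
      scaleC_sum_left)

text \<open>Inserting \<open>1 = \<Sum> s_i s_i^*\<close> turns the lowering relation of a chain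
  into a raising relation.\<close>

lemma comb_op_chain:
  assumes "representation \<pi>" "product_chain \<pi> z \<omega>"
  shows "comb_op \<pi> (z (Suc m)) \<cdot> \<omega> (Suc m) = \<omega> m"
proof -
  have "comb_op \<pi> (z (Suc m)) \<cdot> \<omega> (Suc m) =
      (\<Sum>i\<in>UNIV. \<pi> (cuntz_gen i) \<cdot> star (\<pi> (cuntz_gen i)) \<cdot> \<omega> m)"
    using assms(2) by (simp add: product_chain_def apply_comb_op apply_bop_scaleC)
  also have "\<dots> = \<omega> m"
    by (rule sum_gen_star_gen[OF assms(1)])
  finally show ?thesis .
qed

text \<open>Adjoints of generators are left out of the rules; for a chain the set is invariant under
  them anyway, and inductions then meet generators only.\<close>

inductive_set chain_span ::
  "('n::finite cuntz \<Rightarrow> 'h::chilbert_space bop) \<Rightarrow> (nat \<Rightarrow> 'h) \<Rightarrow> 'h set" for \<pi> \<omega> where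
  base: "\<omega> m \<in> chain_span \<pi> \<omega>"
| add: "x \<in> chain_span \<pi> \<omega> \<Longrightarrow> y \<in> chain_span \<pi> \<omega> \<Longrightarrow> x + y \<in> chain_span \<pi> \<omega>"
| scaleC: "x \<in> chain_span \<pi> \<omega> \<Longrightarrow> c *\<^sub>C x \<in> chain_span \<pi> \<omega>"
| gen: "x \<in> chain_span \<pi> \<omega> \<Longrightarrow> \<pi> (cuntz_gen i) \<cdot> x \<in> chain_span \<pi> \<omega>"

text \<open>Pairs obtained by the same construction from the two chains: the graph of the
  intertwiner to be, before it is known to be single-valued.\<close>

inductive_set chain_relation ::
  "('n::finite cuntz \<Rightarrow> 'h::chilbert_space bop) \<Rightarrow> (nat \<Rightarrow> 'h) \<Rightarrow>
    ('n::finite cuntz \<Rightarrow> 'g::chilbert_space bop) \<Rightarrow> (nat \<Rightarrow> 'g) \<Rightarrow> ('h \<times> 'g) set" for \<pi> \<omega> \<rho> \<eta> where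
  base: "(\<omega> m, \<eta> m) \<in> chain_relation \<pi> \<omega> \<rho> \<eta>"
| add: "(x, x') \<in> chain_relation \<pi> \<omega> \<rho> \<eta> \<Longrightarrow> (y, y') \<in> chain_relation \<pi> \<omega> \<rho> \<eta> \<Longrightarrow>
    (x + y, x' + y') \<in> chain_relation \<pi> \<omega> \<rho> \<eta>"
| scaleC: "(x, x') \<in> chain_relation \<pi> \<omega> \<rho> \<eta> \<Longrightarrow> (c *\<^sub>C x, c *\<^sub>C x') \<in> chain_relation \<pi> \<omega> \<rho> \<eta>"
| gen: "(x, x') \<in> chain_relation \<pi> \<omega> \<rho> \<eta> \<Longrightarrow>
    (\<pi> (cuntz_gen i) \<cdot> x, \<rho> (cuntz_gen i) \<cdot> x') \<in> chain_relation \<pi> \<omega> \<rho> \<eta>"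

lemma chain_span_star_gen:
  assumes "representation \<pi>" "product_chain \<pi> z \<omega>" "x \<in> chain_span \<pi> \<omega>"
  shows "star (\<pi> (cuntz_gen i)) \<cdot> x \<in> chain_span \<pi> \<omega>"
  using assms(3)
proof induction
  case (base m)
  then show ?case
    using assms(2) by (simp add: product_chain_def chain_span.intros)
next
  case (gen x j)
  then show ?case
    using chain_span.scaleC[of x \<pi> \<omega> 0] by (simp add: star_gen_gen[OF assms(1)])
qed (simp_all add: apply_bop_simps apply_bop_scaleC chain_span.intros)

text \<open>The closure is a subspace invariant under the generators and their adjoints, hence
  contains the orbit of \<open>\<Omega>\<close>. Having \<open>\<Omega>\<close> in the closure only
  is the situation for chains that arise as limits.\<close>

lemma chain_span_dense:
  assumes \<pi>: "representation \<pi>" and chain: "product_chain \<pi> z \<omega>"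
    and cyc: "cyclic_vector \<pi> \<Omega>" and \<Omega>: "\<Omega> \<in> closure (chain_span \<pi> \<omega>)"
  shows "closure (chain_span \<pi> \<omega>) = UNIV"
proof (rule cyclic_vector_subspace[OF cyc])
  have zero: "0 \<in> chain_span \<pi> \<omega>"
    using chain_span.scaleC[OF chain_span.base[of \<omega> 0 \<pi>], of 0] by simp
  have sub: "closed_csubspace (closure (chain_span \<pi> \<omega>))"
    by (rule closed_csubspace_closure[OF zero chain_span.add chain_span.scaleC])
  show "\<pi> x \<cdot> \<Omega> \<in> closure (chain_span \<pi> \<omega>)" for x
  proof (rule representation_invariant[OF \<pi> sub _ _ \<Omega>])
    show "\<pi> (cuntz_gen i) \<cdot> v \<in> closure (chain_span \<pi> \<omega>)"
      if "v \<in> closure (chain_span \<pi> \<omega>)" for i v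
      using that by (rule apply_bop_closure[rotated])
        (intro subsetD[OF closure_subset] chain_span.gen)
    show "star (\<pi> (cuntz_gen i)) \<cdot> v \<in> closure (chain_span \<pi> \<omega>)"
      if "v \<in> closure (chain_span \<pi> \<omega>)" for i v
      using that by (rule apply_bop_closure[rotated])
        (intro subsetD[OF closure_subset] chain_span_star_gen[OF \<pi> chain])
  qed
qed simp

lemma chain_relation_star_gen:
  assumes "representation \<pi>" "product_chain \<pi> z \<omega>" "representation \<rho>" "product_chain \<rho> z \<eta>"
    "(x, x') \<in> chain_relation \<pi> \<omega> \<rho> \<eta>"
  shows "(star (\<pi> (cuntz_gen i)) \<cdot> x, star (\<rho> (cuntz_gen i)) \<cdot> x') \<in> chain_relation \<pi> \<omega> \<rho> \<eta>"
  using assms(5)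
proof induction
  case (base m)
  then show ?case
    using assms(2,4) by (simp add: product_chain_def chain_relation.intros)
next
  case (gen x x' j)
  then show ?case
    using chain_relation.scaleC[of x x' \<pi> \<omega> \<rho> \<eta> 0]
    by (simp add: star_gen_gen[OF assms(1)] star_gen_gen[OF assms(3)])
qed (simp_all add: apply_bop_simps apply_bop_scaleC chain_relation.intros)

text \<open>A generator on one side of the inner product moves to the other side as an adjoint.
  There it either cancels against a generator or advances the index of a chain vector, so everything
  reduces to the Gram matrices of the chains.\<close>

lemma chain_relation_inner:
  assumes \<pi>: "representation \<pi>" and \<omega>: "product_chain \<pi> z \<omega>"
    and \<rho>: "representation \<rho>" and \<eta>: "product_chain \<rho> z \<eta>"
    and gram: "\<And>m n. cinner (\<omega> m) (\<omega> n) = cinner (\<eta> m) (\<eta> n)"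
    and x: "(x, x') \<in> chain_relation \<pi> \<omega> \<rho> \<eta>" and y: "(y, y') \<in> chain_relation \<pi> \<omega> \<rho> \<eta>"
  shows "cinner x y = cinner x' y'"
proof -
  have base: "cinner (\<omega> m) y = cinner (\<eta> m) y'" if "(y, y') \<in> chain_relation \<pi> \<omega> \<rho> \<eta>" for m y y'
    using that
  proof (induction arbitrary: m)
    case (gen x x' i)
    then show ?case
      using \<omega> \<eta> by (simp add: product_chain_def cinner_scaleC_left flip: cinner_star_left)
  qed (simp_all add: gram cinner_add_right cinner_scaleC_right)
  show ?thesis
    using x y
  proof (induction arbitrary: y y')
    case (gen x x' i)
    have "cinner x (star (\<pi> (cuntz_gen i)) \<cdot> y) = cinner x' (star (\<rho> (cuntz_gen i)) \<cdot> y')"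
      by (intro gen.IH chain_relation_star_gen[OF \<pi> \<omega> \<rho> \<eta>] gen.prems)
    then show ?case
      by (simp add: cinner_star_right)
  qed (simp_all add: base cinner_add_left cinner_scaleC_left)
qed

lemma chain_span_eq_fst: "fst ` chain_relation \<pi> \<omega> \<rho> \<eta> = chain_span \<pi> \<omega>"
proof (intro antisym subsetI)
  fix x assume "x \<in> fst ` chain_relation \<pi> \<omega> \<rho> \<eta>"
  then obtain x' where "(x, x') \<in> chain_relation \<pi> \<omega> \<rho> \<eta>" by auto
  then show "x \<in> chain_span \<pi> \<omega>"
    by induction (auto intro: chain_span.intros)
next
  fix x assume "x \<in> chain_span \<pi> \<omega>"
  then have "\<exists>x'. (x, x') \<in> chain_relation \<pi> \<omega> \<rho> \<eta>"
    by induction (blast intro: chain_relation.intros)+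
  then show "x \<in> fst ` chain_relation \<pi> \<omega> \<rho> \<eta>" by force
qed

lemma chain_span_eq_snd: "snd ` chain_relation \<pi> \<omega> \<rho> \<eta> = chain_span \<rho> \<eta>"
proof (intro antisym subsetI)
  fix x assume "x \<in> snd ` chain_relation \<pi> \<omega> \<rho> \<eta>"
  then obtain x' where "(x', x) \<in> chain_relation \<pi> \<omega> \<rho> \<eta>" by auto
  then show "x \<in> chain_span \<rho> \<eta>"
    by induction (auto intro: chain_span.intros)
next
  fix x assume "x \<in> chain_span \<rho> \<eta>"
  then have "\<exists>x'. (x', x) \<in> chain_relation \<pi> \<omega> \<rho> \<eta>"
    by induction (blast intro: chain_relation.intros)+
  then show "x \<in> snd ` chain_relation \<pi> \<omega> \<rho> \<eta>" by force
qed

lemma chain_unitary: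
  fixes \<pi> :: "'n::finite cuntz \<Rightarrow> 'h::chilbert_space bop"
    and \<rho> :: "'n cuntz \<Rightarrow> 'g::chilbert_space bop"
  assumes "representation \<pi>" "product_chain \<pi> z \<omega>" "orthonormal \<omega>"
    and "closure (chain_span \<pi> \<omega>) = UNIV"
    and "representation \<rho>" "product_chain \<rho> z \<eta>" "orthonormal \<eta>"
    and "closure (chain_span \<rho> \<eta>) = UNIV"
  obtains U where "surj U" "\<And>x y. U (x + y) = U x + U y" "\<And>c x. U (c *\<^sub>C x) = c *\<^sub>C U x"
    "\<And>x y. cinner (U x) (U y) = cinner x y" "\<And>a x. U (\<pi> a \<cdot> x) = \<rho> a \<cdot> U x"
    "\<And>m. U (\<omega> m) = \<eta> m"
proof (rule unitary_of_relation[OF assms(1,5) chain_relation.add chain_relation.scaleC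
      chain_relation.gen chain_relation_star_gen[OF assms(1,2,5,6)]
      chain_relation_inner[OF assms(1,2,5,6)]])
  show "cinner (\<omega> m) (\<omega> n) = cinner (\<eta> m) (\<eta> n)" for m n
    using assms(3,7) by (simp add: orthonormal_def)
  show "closure (fst ` chain_relation \<pi> \<omega> \<rho> \<eta>) = UNIV" "closure (snd ` chain_relation \<pi> \<omega> \<rho> \<eta>) = UNIV"
    by (simp_all add: chain_span_eq_fst chain_span_eq_snd assms)
  fix U :: "'h \<Rightarrow> 'g"
  assume "\<And>x x'. (x, x') \<in> chain_relation \<pi> \<omega> \<rho> \<eta> \<Longrightarrow> U x = x'"
  note base = this[OF chain_relation.base]
  assume "surj U" "\<And>x y. U (x + y) = U x + U y" "\<And>c x. U (c *\<^sub>C x) = c *\<^sub>C U x"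
    "\<And>x y. cinner (U x) (U y) = cinner x y" "\<And>a x. U (\<pi> a \<cdot> x) = \<rho> a \<cdot> U x"
  then show thesis
    using base by (rule that)
qed

text \<open>Each step \<open>\<omega>\<^sub>m = s(y\<^bsub>m+1\<^esub>) \<omega>\<^bsub>m+1\<^esub>\<close> splits off one factor \<open>\<langle>y\<^bsub>m+1\<^esub>|z\<^bsub>n+1\<^esub>\<rangle>\<close>.\<close>

lemma cinner_chains:
  assumes "representation \<pi>" "product_chain \<pi> y \<omega>" "product_chain \<pi> z \<xi>"
  shows "cinner (\<omega> m) (\<xi> n) = (\<Prod>i<r. vinner (y (Suc (m + i))) (z (Suc (n + i)))) *
    cinner (\<omega> (m + r)) (\<xi> (n + r))"
proof (induction r)
  case (Suc r)
  have "cinner (\<omega> (m + r)) (\<xi> (n + r)) =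
      cinner (comb_op \<pi> (y (Suc (m + r))) \<cdot> \<omega> (Suc (m + r))) (\<xi> (n + r))"
    by (simp add: comb_op_chain[OF assms(1,2)])
  also have "\<dots> = vinner (y (Suc (m + r))) (z (Suc (n + r))) *
      cinner (\<omega> (Suc (m + r))) (\<xi> (Suc (n + r)))"
    by (simp add: star_comb_op_chain[OF assms(3)] cinner_scaleC_right flip: cinner_star_right)
  finally show ?case
    by (simp add: Suc)
qed simp

text \<open>Moving a generator across the inner product only advances the index of
  \<open>\<xi>\<close>, so orthogonality to the chain vectors extends to their dense span, and
  \<open>\<xi> n\<close> is orthogonal to itself.\<close>

lemma chain_orthogonal_span:
  assumes \<omega>: "closure (chain_span \<pi> \<omega>) = UNIV" and \<xi>: "product_chain \<pi> z \<xi>"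
    and orth: "\<And>m n. cinner (\<omega> m) (\<xi> n) = 0"
  shows "\<xi> n = 0"
proof -
  have span: "cinner x (\<xi> n) = 0" if "x \<in> chain_span \<pi> \<omega>" for x n
    using that
  proof (induction arbitrary: n)
    case (gen x i)
    then show ?case
      using \<xi> by (simp add: product_chain_def cinner_scaleC_right flip: cinner_star_right)
  qed (simp_all add: orth cinner_add_left cinner_scaleC_left)
  have "chain_span \<pi> \<omega> \<subseteq> {x. cinner x (\<xi> n) = 0}"
    using span by blast
  moreover have "closed {x. cinner x (\<xi> n) = 0}"
    by (rule closed_Collect_eq[OF continuous_on_cinner[OF continuous_on_id continuous_on_const]
          continuous_on_const])
  ultimately have "\<xi> n \<in> {x. cinner x (\<xi> n) = 0}"
    using closure_minimal[of "chain_span \<pi> \<omega>"] \<omega> by blast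
  then show ?thesis
    by (simp add: cinner_self)
qed

section \<open>Chains with summable overlaps\<close>

text \<open>The Weierstrass product inequality. It bounds the distance between successive
  approximants by a tail of the overlap series.\<close>

lemma one_minus_sum_le_prod:
  fixes a :: "nat \<Rightarrow> real"
  assumes "\<And>i. 0 \<le> a i" "\<And>i. a i \<le> 1"
  shows "1 - (\<Sum>i<n. 1 - a i) \<le> (\<Prod>i<n. a i)"
proof (induction n)
  case (Suc n)
  have "(\<Prod>i<n. a i) * (1 - a n) \<le> 1 * (1 - a n)"
    using assms by (intro mult_right_mono prod_le_1) auto
  then have "(\<Prod>i<n. a i) - (1 - a n) \<le> (\<Prod>i<n. a i) * a n"
    by (simp add: algebra_simps)
  with Suc show ?case by simp
qed simp

text \<open>From \<open>a \<le> exp (- (1 - a))\<close>, a lower bound \<open>\<delta>\<close> for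
  the partial products bounds the partial sums of \<open>1 - a\<close> by
  \<open>- ln \<delta>\<close>.\<close>

lemma summable_of_prod_bounded_below:
  fixes a :: "nat \<Rightarrow> real"
  assumes a: "\<And>i. 0 \<le> a i" "\<And>i. a i \<le> 1" and \<delta>: "0 < \<delta>" "\<And>n. \<delta> \<le> (\<Prod>i<n. a i)"
  shows "summable (\<lambda>i. 1 - a i)"
proof (rule summableI_nonneg_bounded)
  show "(\<Sum>i<n. 1 - a i) \<le> - ln \<delta>" for n
  proof -
    have "(\<Prod>i<n. a i) \<le> (\<Prod>i<n. exp (- (1 - a i)))"
      using a exp_ge_add_one_self[of "- (1 - a _)"] by (intro prod_mono) simp
    also have "\<dots> = exp (- (\<Sum>i<n. 1 - a i))"
      by (simp add: exp_sum sum_negf[symmetric] del: sum_negf minus_diff_eq)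
    finally have "\<delta> \<le> exp (- (\<Sum>i<n. 1 - a i))"
      using \<delta>(2)[of n] by linarith
    then have "ln \<delta> \<le> - (\<Sum>i<n. 1 - a i)"
      using \<delta>(1) ln_le_cancel_iff[of \<delta> "exp (- (\<Sum>i<n. 1 - a i))"] by simp
    then show ?thesis by linarith
  qed
qed (simp add: a)

text \<open>By \<open>cinner_chains\<close> and Cauchy-Schwarz, a nonzero inner product would bound
  all partial products of overlaps from below and so force summability. Norms at most 1 are allowed,
  so that a projected chain qualifies.\<close>

lemma chains_orthogonal:
  assumes \<pi>: "representation \<pi>" and \<omega>: "product_chain \<pi> y \<omega>" and \<xi>: "product_chain \<pi> z \<xi>"
    and norms: "\<And>n. norm (\<omega> n) \<le> 1" "\<And>n. norm (\<xi> n) \<le> 1"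
      "\<And>n. norm (y (Suc n)) = 1" "\<And>n. norm (z (Suc n)) = 1"
    and div: "\<not> summable (\<lambda>i. 1 - cmod (vinner (y (Suc (m + i))) (z (Suc (n + i)))))"
  shows "cinner (\<omega> m) (\<xi> n) = 0"
proof (rule ccontr)
  define a where "a i = cmod (vinner (y (Suc (m + i))) (z (Suc (n + i))))" for i
  assume "cinner (\<omega> m) (\<xi> n) \<noteq> 0"
  have "summable (\<lambda>i. 1 - a i)"
  proof (rule summable_of_prod_bounded_below)
    show "0 < cmod (cinner (\<omega> m) (\<xi> n))"
      using \<open>cinner (\<omega> m) (\<xi> n) \<noteq> 0\<close> by simp
    show "a i \<le> 1" for i
      using cmod_vinner_le[of "y (Suc (m + i))" "z (Suc (n + i))"] by (simp add: a_def norms)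
    show "cmod (cinner (\<omega> m) (\<xi> n)) \<le> (\<Prod>i<r. a i)" for r
    proof -
      have "cmod (cinner (\<omega> (m + r)) (\<xi> (n + r))) \<le> norm (\<omega> (m + r)) * norm (\<xi> (n + r))"
        by (rule cinner_cauchy_schwarz)
      also have "\<dots> \<le> 1 * 1"
        using norms by (intro mult_mono) auto
      finally have "(\<Prod>i<r. a i) * cmod (cinner (\<omega> (m + r)) (\<xi> (n + r))) \<le> (\<Prod>i<r. a i) * 1"
        by (intro mult_left_mono prod_nonneg) (auto simp: a_def)
      then show ?thesis
        unfolding cinner_chains[OF \<pi> \<omega> \<xi>, of m n r] by (simp add: norm_mult a_def prod_norm)
    qed
  qed (simp add: a_def)
  with div show False by (simp add: a_def)
qed

lemma chain_span_comb_op: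
  fixes \<pi> :: "'n::finite cuntz \<Rightarrow> 'h::chilbert_space bop"
  assumes "x \<in> chain_span \<pi> \<omega>"
  shows "comb_op \<pi> w \<cdot> x \<in> chain_span \<pi> \<omega>"
proof -
  have zero: "0 \<in> chain_span \<pi> \<omega>"
    using chain_span.scaleC[OF assms, of 0] by simp
  have "(\<Sum>i\<in>A. f i) \<in> chain_span \<pi> \<omega>" if "\<And>i. f i \<in> chain_span \<pi> \<omega>" for f and A :: "'n set"
    using that by (induction A rule: infinite_finite_induct) (simp_all add: zero chain_span.add)
  then show ?thesis
    by (simp add: apply_comb_op chain_span.scaleC chain_span.gen assms)
qed

text \<open>In closed form \<open>s(z_(m+1)) \<cdots> s(z_(m+d)) \<omega>_(m+d)\<close>: if
  \<open>\<omega>\<close> is a chain for \<open>y\<close>, this is \<open>\<omega> m\<close> with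
  its first \<open>d\<close> factors \<open>y\<close> replaced by those of \<open>z\<close>.\<close>

fun chain_approx ::
  "('n::finite cuntz \<Rightarrow> 'h::chilbert_space bop) \<Rightarrow> (nat \<Rightarrow> complex ^ 'n) \<Rightarrow> (nat \<Rightarrow> 'h) \<Rightarrow>
    nat \<Rightarrow> nat \<Rightarrow> 'h" where
  "chain_approx \<pi> z \<omega> m 0 = \<omega> m"
| "chain_approx \<pi> z \<omega> m (Suc d) = comb_op \<pi> (z (Suc m)) \<cdot> chain_approx \<pi> z \<omega> (Suc m) d"

text \<open>The limits \<open>\<xi>\<^sub>m = lim s(z\<^bsub>m+1\<^esub>) \<cdots> s(z\<^bsub>t\<^esub>) \<omega>\<^sub>t\<close> exist since the inner product of the terms
  with indices \<open>t \<le> t'\<close> is the product of the \<open>\<langle>z\<^sub>i|y\<^sub>i\<rangle>\<close> over \<open>t < i \<le> t'\<close>.\<close>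

lemma chain_of_positive_overlaps:
  fixes \<pi> :: "'n::finite cuntz \<Rightarrow> 'h::chilbert_space bop"
  assumes \<pi>: "representation \<pi>" and \<omega>: "product_chain \<pi> y \<omega>" "orthonormal \<omega>"
    and norms: "\<And>n. norm (y (Suc n)) = 1" "\<And>n. norm (z (Suc n)) = 1"
    and a: "\<And>m. vinner (z (Suc m)) (y (Suc m)) = complex_of_real (a m)" "\<And>m. 0 \<le> a m"
    and sum: "summable (\<lambda>m. 1 - a m)"
  obtains \<xi> where "product_chain \<pi> z \<xi>" "orthonormal \<xi>" "\<omega> 0 \<in> closure (chain_span \<pi> \<xi>)"
    "\<And>m n. m \<noteq> n \<Longrightarrow> cinner (\<omega> m) (\<xi> n) = 0"
proof -
  define E where "E = chain_approx \<pi> z \<omega>"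
  have E_simps: "E m 0 = \<omega> m" "E m (Suc d) = comb_op \<pi> (z (Suc m)) \<cdot> E (Suc m) d" for m d
    by (simp_all add: E_def)
  have a_le: "a m \<le> 1" for m
    using cmod_vinner_le[of "z (Suc m)" "y (Suc m)"] a(2)[of m] by (simp add: a(1) norms)
  have E_orth: "cinner (E m d) (E n d) = (if m = n then 1 else 0)" for m n d
  proof (induction d arbitrary: m n)
    case 0
    then show ?case using \<omega>(2) by (simp add: E_simps orthonormal_def)
  qed (auto simp: E_simps cinner_comb_op[OF \<pi>] vinner_self norms)
  have \<omega>_E: "cinner (\<omega> m) (E n (Suc d)) =
      cnj (vinner (z (Suc n)) (y (Suc m))) * cinner (\<omega> (Suc m)) (E (Suc n) d)" for m n d
    by (simp add: E_simps star_comb_op_chain[OF \<omega>(1)] cinner_scaleC_left flip: cinner_star_left)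
  \<comment> \<open>Each step advances both indices by one, so unequal indices stay unequal until
    the orthonormality of \<open>\<omega>\<close> applies.\<close>
  have \<omega>_E_orth: "cinner (\<omega> m) (E n d) = 0" if "m \<noteq> n" for m n d
    using that
  proof (induction d arbitrary: m n)
    case 0
    then show ?case using \<omega>(2) by (simp add: E_simps orthonormal_def)
  qed (simp add: \<omega>_E)
  have \<omega>_E_prod: "cinner (\<omega> m) (E m d) = complex_of_real (\<Prod>i<d. a (m + i))" for m d
  proof (induction d arbitrary: m)
    case 0
    then show ?case using \<omega>(2) by (simp add: E_simps orthonormal_def)
  next
    case (Suc d)
    show ?case
      by (simp add: \<omega>_E Suc a(1) prod.lessThan_Suc_shift del: prod.lessThan_Suc)
  qed
  \<comment> \<open>The \<open>d\<close> common leading factors are the same isometries on both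
    sides and cancel.\<close>
  have E_E: "cinner (E m d) (E m (d + e)) = cinner (\<omega> (m + d)) (E (m + d) e)" for m d e
  proof (induction d arbitrary: m)
    case (Suc d)
    then show ?case
      by (simp add: E_simps cinner_comb_op[OF \<pi>] vinner_self norms)
  qed (simp add: E_simps)
  have norm_E: "norm (E m d) = 1" for m d
    using E_orth[of m d m] cinner_self[of "E m d"] norm_ge_zero[of "E m d"]
    by (simp add: power2_eq_1_iff flip: of_real_power)
  define s where "s n = (\<Sum>i<n. 1 - a i)" for n
  have s: "s \<longlonglongrightarrow> suminf (\<lambda>m. 1 - a m)"
    unfolding s_def by (rule summable_LIMSEQ[OF sum])
  have s_le: "s n \<le> suminf (\<lambda>m. 1 - a m)" for n
    unfolding s_def using a_le by (intro sum_le_suminf sum) auto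
  \<comment> \<open>For unit vectors the squared distance is 2 minus twice the real part of the
    inner product, here a product of overlaps.\<close>
  have E_diff: "(norm (E m d - E m (d + e)))\<^sup>2 \<le> 2 * (s (m + d + e) - s (m + d))" for m d e
  proof -
    have "(norm (E m d - E m (d + e)))\<^sup>2 = 2 - 2 * (\<Prod>i<e. a (m + d + i))"
      by (simp add: norm_diff_square norm_E E_E \<omega>_E_prod del: of_real_prod)
    also have "\<dots> \<le> 2 * (\<Sum>i<e. 1 - a (m + d + i))"
      using one_minus_sum_le_prod[of "\<lambda>i. a (m + d + i)" e] a(2) a_le by simp
    also have "(\<Sum>i<e. 1 - a (m + d + i)) = s (m + d + e) - s (m + d)"
      unfolding s_def by (induction e) simp_all
    finally show ?thesis .
  qed
  have "convergent (E m)" for m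
  proof -
    have "Cauchy (E m)"
    proof (rule CauchyI')
      fix e :: real assume e: "0 < e"
      obtain M where M: "\<And>i j. i \<ge> M \<Longrightarrow> j \<ge> M \<Longrightarrow> norm (s i - s j) < e\<^sup>2 / 2"
        using CauchyD[OF LIMSEQ_imp_Cauchy[OF s], of "e\<^sup>2 / 2"] e by auto
      have "norm (E m i - E m j) < e" if "i \<ge> M" "j > i" for i j
      proof -
        have j: "j = i + (j - i)" using that by simp
        have "(norm (E m i - E m j))\<^sup>2 \<le> 2 * (s (m + j) - s (m + i))"
          using E_diff[of m i "j - i"] j by (simp add: add.assoc)
        moreover have "norm (s (m + j) - s (m + i)) < e\<^sup>2 / 2"
          using that by (intro M) auto
        ultimately have "(norm (E m i - E m j))\<^sup>2 < e\<^sup>2"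
          using abs_ge_self[of "s (m + j) - s (m + i)"] unfolding real_norm_def by argo
        then show ?thesis
          using e by (simp add: power2_less_imp_less)
      qed
      then show "\<exists>M. \<forall>i\<ge>M. \<forall>j>i. dist (E m i) (E m j) < e"
        unfolding dist_norm by blast
    qed
    then show ?thesis by (rule Cauchy_convergent)
  qed
  then obtain \<xi> where \<xi>: "\<And>m. E m \<longlonglongrightarrow> \<xi> m"
    unfolding convergent_def by metis
  have \<xi>_comb: "\<xi> m = comb_op \<pi> (z (Suc m)) \<cdot> \<xi> (Suc m)" for m
  proof (rule LIMSEQ_unique)
    show "(\<lambda>d. E m (Suc d)) \<longlonglongrightarrow> \<xi> m"
      by (rule LIMSEQ_Suc[OF \<xi>])
    show "(\<lambda>d. E m (Suc d)) \<longlonglongrightarrow> comb_op \<pi> (z (Suc m)) \<cdot> \<xi> (Suc m)"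
      unfolding E_simps by (rule tendsto_apply_bop[OF \<xi>])
  qed
  have chain: "product_chain \<pi> z \<xi>"
    unfolding product_chain_def
  proof (intro allI)
    show "star (\<pi> (cuntz_gen i)) \<cdot> \<xi> m = (z (Suc m) $ i) *\<^sub>C \<xi> (Suc m)" for m i
      by (subst \<xi>_comb) (rule star_gen_comb_op[OF \<pi>])
  qed
  have "cinner (\<xi> m) (\<xi> n) = (if m = n then 1 else 0)" for m n
    using tendsto_cinner[OF \<xi>[of m] \<xi>[of n]] by (simp only: E_orth LIMSEQ_const_iff)
  then have ortho: "orthonormal \<xi>"
    by (simp add: orthonormal_def)
  have orth: "cinner (\<omega> m) (\<xi> n) = 0" if "m \<noteq> n" for m n
    using tendsto_cinner[OF tendsto_const[of "\<omega> m"] \<xi>[of n]]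
    by (simp add: \<omega>_E_orth[OF that] LIMSEQ_const_iff)
  \<comment> \<open>Applying \<open>s(y_1) \<cdots> s(y_m)\<close> is isometric, maps
    \<open>\<omega> m\<close> to \<open>\<omega> 0\<close> and preserves the span. Hence it suffices
    to approximate \<open>\<omega> m\<close> for some large \<open>m\<close>, where
    \<open>\<xi> m\<close> itself is close.\<close>
  have pull: "\<exists>x'\<in>chain_span \<pi> \<xi>. norm (\<omega> 0 - x') = norm (\<omega> m - x)" if "x \<in> chain_span \<pi> \<xi>" for m x
    using that
  proof (induction m arbitrary: x)
    case (Suc m)
    have "\<omega> m - comb_op \<pi> (y (Suc m)) \<cdot> x = comb_op \<pi> (y (Suc m)) \<cdot> (\<omega> (Suc m) - x)"
      by (simp add: apply_bop_diff comb_op_chain[OF \<pi> \<omega>(1)])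
    then show ?case
      using Suc.IH[OF chain_span_comb_op[OF Suc.prems, of "y (Suc m)"]]
      by (simp add: norm_comb_op[OF \<pi> norms(1)])
  qed auto
  have "\<exists>x\<in>chain_span \<pi> \<xi>. dist x (\<omega> 0) < e" if e: "0 < e" for e
  proof -
    define L where "L = suminf (\<lambda>m. 1 - a m)"
    have "\<forall>\<^sub>F n in sequentially. dist (s n) L < e\<^sup>2 / 2"
      using e s by (intro tendstoD) (simp_all add: L_def)
    then obtain m where m: "dist (s m) L < e\<^sup>2 / 2"
      by (auto simp: eventually_sequentially)
    have "(norm (\<omega> m - E m d))\<^sup>2 \<le> 2 * (L - s m)" for d
      using E_diff[of m 0 d] s_le[of "m + d"] by (simp add: E_simps L_def)
    moreover have "(\<lambda>d. (norm (\<omega> m - E m d))\<^sup>2) \<longlonglongrightarrow> (norm (\<omega> m - \<xi> m))\<^sup>2"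
      by (intro tendsto_intros \<xi>)
    ultimately have "(norm (\<omega> m - \<xi> m))\<^sup>2 \<le> 2 * (L - s m)"
      by (intro LIMSEQ_le_const2) auto
    also have "\<dots> < e\<^sup>2"
      using m abs_ge_minus_self[of "s m - L"] unfolding dist_real_def by argo
    finally have "norm (\<omega> m - \<xi> m) < e"
      using e by (simp add: power2_less_imp_less)
    then show ?thesis
      using pull[OF chain_span.base, of m m] by (metis dist_norm dist_commute)
  qed
  then have "\<omega> 0 \<in> closure (chain_span \<pi> \<xi>)"
    by (simp add: closure_approachable)
  with chain ortho orth show ?thesis using that by blast
qed

text \<open>The shifted sequence \<open>\<omega> (k + m)\<close> is a chain for the shifted
  \<open>y\<close>; adjusting phases makes all overlaps with \<open>z\<close> nonnegative, which is
  the case already treated. The last conclusion provides the non-scalar intertwiner used for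
  reducibility.\<close>

lemma chain_exists:
  fixes \<pi> :: "'n::finite cuntz \<Rightarrow> 'h::chilbert_space bop"
  assumes \<pi>: "representation \<pi>" and \<omega>: "product_chain \<pi> y \<omega>" "orthonormal \<omega>"
    and cyc: "cyclic_vector \<pi> (\<omega> 0)"
    and norms: "\<And>n. norm (y (Suc n)) = 1" "\<And>n. norm (z (Suc n)) = 1"
    and sum: "summable (\<lambda>n. 1 - cmod (vinner (z (Suc n)) (y (Suc n + k))))"
  obtains \<xi> where "product_chain \<pi> z \<xi>" "orthonormal \<xi>" "closure (chain_span \<pi> \<xi>) = UNIV"
    "0 < k \<Longrightarrow> cinner (\<omega> 0) (\<xi> 0) = 0"
proof -
  define b where "b m = vinner (z (Suc m)) (y (Suc m + k))" for m
  \<comment> \<open>Chosen so that \<open>p m * cnj (p (Suc m)) * b m\<close> is the modulus of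
    \<open>b m\<close>. The default 1 keeps \<open>p\<close> unimodular, as
    \<open>sgn 0 = 0\<close>.\<close>
  define p where "p m = (\<Prod>i<m. if b i = 0 then 1 else sgn (b i))" for m
  have p_unit: "cmod (p m) = 1" for m
    unfolding p_def by (induction m) (simp_all add: norm_mult norm_sgn)
  then have p_cnj: "p m * cnj (p m) = 1" for m
    by (simp add: complex_norm_square[symmetric])
  define \<omega>' where "\<omega>' m = p m *\<^sub>C \<omega> (k + m)" for m
  \<comment> \<open>The factors are forced by requiring \<open>\<omega>'\<close> to be a chain for
    \<open>y'\<close>; only the positive indices \<open>n = Suc m\<close> enter.\<close>
  define y' where "y' n = (\<chi> i. p (n - 1) * cnj (p n) * y (n + k) $ i)" for n
  have chain': "product_chain \<pi> y' \<omega>'"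
    unfolding product_chain_def
  proof (intro allI)
    fix m i
    have "star (\<pi> (cuntz_gen i)) \<cdot> \<omega>' m = (p m * y (Suc (k + m)) $ i) *\<^sub>C \<omega> (Suc (k + m))"
      using \<omega>(1) by (simp add: \<omega>'_def apply_bop_scaleC product_chain_def scaleC_scaleC)
    also have "p m * y (Suc (k + m)) $ i = y' (Suc m) $ i * p (Suc m)"
      using p_cnj[of "Suc m"] by (simp add: y'_def add.commute mult_ac)
    finally show "star (\<pi> (cuntz_gen i)) \<cdot> \<omega>' m = (y' (Suc m) $ i) *\<^sub>C \<omega>' (Suc m)"
      by (simp add: \<omega>'_def scaleC_scaleC)
  qed
  have ortho': "orthonormal \<omega>'"
    using \<omega>(2) p_cnj by (auto simp: orthonormal_def \<omega>'_def cinner_scaleC_left cinner_scaleC_right)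
  have norm': "norm (y' (Suc n)) = 1" for n
    using norms(1)[of "n + k"] by (simp add: y'_def norm_vec_def norm_mult p_unit)
  have overlap: "vinner (z (Suc m)) (y' (Suc m)) = complex_of_real (cmod (b m))" for m
  proof -
    have "vinner (z (Suc m)) (y' (Suc m)) = p m * cnj (p (Suc m)) * b m"
      by (simp add: vinner_def y'_def b_def sum_distrib_left mult_ac)
    also have "p m * cnj (p (Suc m)) = (if b m = 0 then 1 else cnj (sgn (b m)))"
      using p_cnj[of m] by (simp add: p_def)
    also have "\<dots> * b m = complex_of_real (cmod (b m))"
      by (simp add: sgn_eq complex_norm_square[symmetric] power2_eq_square mult.commute)
    finally show ?thesis .
  qed
  obtain \<xi> where \<xi>: "product_chain \<pi> z \<xi>" "orthonormal \<xi>" "\<omega>' 0 \<in> closure (chain_span \<pi> \<xi>)"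
      "\<And>m n. m \<noteq> n \<Longrightarrow> cinner (\<omega>' m) (\<xi> n) = 0"
    using chain_of_positive_overlaps[OF \<pi> chain' ortho' norm' norms(2) overlap norm_ge_zero
        sum[folded b_def]] by blast
  have comb: "comb_op \<pi> w \<cdot> x \<in> closure (chain_span \<pi> \<xi>)" if "x \<in> closure (chain_span \<pi> \<xi>)" for w x
    using that by (rule apply_bop_closure[rotated])
      (intro subsetD[OF closure_subset] chain_span_comb_op)
  have "\<omega> 0 \<in> closure (chain_span \<pi> \<xi>)" if "\<omega> k \<in> closure (chain_span \<pi> \<xi>)" for k
    using that
  proof (induction k)
    case (Suc k)
    then show ?case
      using comb[OF Suc.prems, of "y (Suc k)"] by (simp add: comb_op_chain[OF \<pi> \<omega>(1)])
  qed
  moreover have "\<omega>' 0 = \<omega> k"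
    by (simp add: \<omega>'_def p_def)
  ultimately have "closure (chain_span \<pi> \<xi>) = UNIV"
    using \<xi>(3) by (intro chain_span_dense[OF \<pi> \<xi>(1) cyc]) simp
  \<comment> \<open>After \<open>k\<close> steps the inner product is a multiple of that of
    \<open>\<omega> k = \<omega>' 0\<close> with \<open>\<xi> k\<close>, whose indices
    \<open>0\<close> and \<open>k\<close> differ.\<close>
  moreover have "cinner (\<omega> 0) (\<xi> 0) = 0" if "0 < k"
    using cinner_chains[OF \<pi> \<omega>(1) \<xi>(1), of 0 0 k] \<xi>(4)[of 0 k] that \<open>\<omega>' 0 = \<omega> k\<close> by simp
  ultimately show ?thesis
    using that \<xi> by blast
qed

text \<open>With \<open>V\<close> the unitary, multiplied by \<open>\<i>\<close> if necessary, and \<open>A = (V + V\<^sup>*)/2\<close>, the invariant subspace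
  is the kernel of \<open>|A| - A\<close>, where \<open>|A| = (1 - (1 - A\<^sup>2))\<^bsup>1/2\<^esup>\<close>. It is nontrivial as \<open>|A| \<noteq> \<plusminus>A\<close>:
  \<open>\<langle>v|A v\<rangle> = 0\<close>, but \<open>\<langle>v|A\<^sup>2 v\<rangle> \<ge> 1/2\<close> implies \<open>\<langle>v||A| v\<rangle> > 0\<close>.\<close>

lemma reducible_of_commuting_unitary:
  fixes \<pi> :: "'a::cstar_algebra \<Rightarrow> 'h::chilbert_space bop"
  assumes \<pi>: "representation \<pi>"
    and U: "surj U" "\<And>x y. U (x + y) = U x + U y" "\<And>c x. U (c *\<^sub>C x) = c *\<^sub>C U x"
      "\<And>x y. cinner (U x) (U y) = cinner x y" "\<And>a x. U (\<pi> a \<cdot> x) = \<pi> a \<cdot> U x"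
    and v: "norm v = 1" "cinner v (U v) = 0"
  shows "\<not> irreducible_representation \<pi>"
proof
  assume irr: "irreducible_representation \<pi>"
  have "norm (U x) \<le> norm x * 1" for x
    using norm_eq_of_cinner[OF U(4), of x] by simp
  then obtain T where T: "\<And>x. T \<cdot> x = U x"
    using ex_bop[OF U(2,3)] by blast
  have T_unit: "star T \<cdot> T \<cdot> x = x" for x
    by (rule cinner_ext) (simp add: cinner_star_right T U(4))
  have T_unit': "T \<cdot> star T \<cdot> x = x" for x
    using U(1) T_unit T by (metis surjD)
  \<comment> \<open>The factor \<open>\<i>\<close> reverses the sign of
    \<open>\<langle>v|T T v\<rangle>\<close>. A nonnegative real part is what gives
    \<open>\<langle>v|A A v\<rangle> \<ge> 1/2\<close>.\<close>
  define c where "c = (if 0 \<le> Re (cinner v (T \<cdot> T \<cdot> v)) then 1 else \<i>)"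
  have c: "cnj c * c = 1" "c * cnj c = 1"
    by (simp_all add: c_def)
  define V where "V = c *\<^sub>C T"
  have V1: "star V * V = 1" and V2: "V * star V = 1"
    by (rule bop_eqI; simp add: V_def star_scaleC mult_scaleC_left mult_scaleC_right scaleC_scaleC c
        apply_bop_simps T_unit T_unit')+
  have V_pos: "0 \<le> Re (cinner v (V \<cdot> V \<cdot> v))"
    by (simp add: V_def apply_scaleC_bop apply_bop_scaleC cinner_scaleC_right c_def)
  have V_orth: "cinner v (V \<cdot> v) = 0" "cinner v (star V \<cdot> v) = 0"
    using v(2) cinner_commute[of v "U v"]
    by (simp_all add: cinner_star_right V_def apply_scaleC_bop cinner_scaleC_right
        cinner_scaleC_left T)
  have V_comm: "\<pi> a * V = V * \<pi> a" for a
    by (rule bop_eqI) (simp add: V_def apply_bop_simps apply_scaleC_bop apply_bop_scaleC T U(5))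
  have V_comm': "\<pi> a * star V = star V * \<pi> a" for a
    by (rule bop_commute_star) (simp add: V_comm flip: star_hom_onD(4)[OF \<pi>])
  have norm_V: "norm V \<le> 1" "norm (star V) \<le> 1"
    using cstar_identity[of V] norm_one_le[where 'a = "'h bop"]
    by (simp_all add: V1 norm_star power_le_one_iff)
  define A where "A = (1 / 2) *\<^sub>R (V + star V)"
  \<comment> \<open>This is \<open>1 - A * A\<close> written out by unitarity of \<open>V\<close>: a
    quarter of a signed sum of four contractions, so its norm is at most 1.\<close>
  define X where "X = (1 / 4) *\<^sub>R (1 + 1 - V * V - star V * star V)"
  have XA: "1 - X = A * A"
    by (simp add: X_def A_def algebra_simps V1 V2 flip: scaleR_add_left)
  have norm_X: "norm X \<le> 1"
  proof -
    have "norm (V * V) \<le> 1 * 1" "norm (star V * star V) \<le> 1 * 1"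
      by (intro order_trans[OF norm_mult_ineq] mult_mono norm_V; simp)+
    then have "norm (1 + 1 - V * V - star V * star V) \<le> 1 + 1 + 1 + 1"
      by (intro order_trans[OF norm_triangle_ineq4] order_trans[OF norm_triangle_ineq] add_mono
          norm_one_le) simp_all
    then show ?thesis by (simp add: X_def)
  qed
  have X_half: "Re (cinner v (X \<cdot> v)) \<le> 1 / 2"
  proof -
    have "cinner v (star V \<cdot> star V \<cdot> v) = cnj (cinner v (V \<cdot> V \<cdot> v))"
      by (simp add: cinner_star_right flip: cinner_commute)
    then have "cinner v (X \<cdot> v) =
        complex_of_real (1 / 4) * (1 + 1 - cinner v (V \<cdot> V \<cdot> v) - cnj (cinner v (V \<cdot> V \<cdot> v)))"
      using v(1) by (simp add: X_def apply_bop_simps scaleR_scaleC[where 'a = 'h] cinner_scaleC_right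
          cinner_add_right cinner_diff_right cinner_self)
    from arg_cong[OF this, of Re] show ?thesis
      using V_pos by simp
  qed
  define Y where "Y = sqrt_one_minus X"
  have YY: "Y * Y = A * A"
    unfolding Y_def sqrt_one_minus_square[OF norm_X] XA ..
  have X_eq: "X = 1 - A * A"
    by (simp flip: XA)
  have AY: "A * Y = Y * A"
    unfolding Y_def by (rule sqrt_one_minus_commute[OF norm_X]) (simp add: X_eq algebra_simps)
  have A_comm: "\<pi> a * A = A * \<pi> a" for a
    by (simp add: A_def algebra_simps V_comm V_comm')
  have Y_comm: "\<pi> a * Y = Y * \<pi> a" for a
    unfolding Y_def
  proof (rule sqrt_one_minus_commute[OF norm_X])
    have "\<pi> a * (A * A) = A * A * \<pi> a"
      by (metis A_comm mult.assoc)
    then show "\<pi> a * X = X * \<pi> a"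
      by (simp add: X_eq algebra_simps)
  qed
  define M where "M = {x. (Y - A) \<cdot> x = 0}"
  have "subrepresentation_on UNIV \<pi> M"
    unfolding subrepresentation_on_def
  proof (intro conjI ballI)
    show "closed_csubspace M"
      unfolding M_def by (rule closed_csubspace_kernel)
    fix a x assume "x \<in> M"
    have "(Y - A) * \<pi> a = \<pi> a * (Y - A)"
      by (simp add: algebra_simps A_comm Y_comm)
    then have "(Y - A) \<cdot> \<pi> a \<cdot> x = \<pi> a \<cdot> (Y - A) \<cdot> x"
      by (metis apply_bop_simps(6))
    with \<open>x \<in> M\<close> show "\<pi> a \<cdot> x \<in> M"
      by (simp add: M_def apply_bop_simps)
  qed
  then consider "M = {0}" | "M = UNIV"
    using irr by (auto simp: irreducible_representation_def)
  then have "Y \<cdot> v = - (A \<cdot> v) \<or> Y \<cdot> v = A \<cdot> v"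
  proof cases
    case 1
    \<comment> \<open>\<open>Y\<close> and \<open>A\<close> commute and have equal squares, so the
      range of \<open>Y + A\<close> lies in the kernel \<open>M\<close> of
      \<open>Y - A\<close>.\<close>
    have "(Y - A) * (Y + A) = 0"
      by (simp add: algebra_simps YY AY)
    then have "(Y + A) \<cdot> v \<in> M"
      by (simp add: M_def flip: apply_bop_simps(6)) (simp add: apply_bop_simps)
    with 1 show ?thesis
      by (simp add: apply_bop_simps eq_neg_iff_add_eq_0)
  next
    case 2
    then have "v \<in> M" by simp
    then show ?thesis
      by (simp add: M_def apply_bop_simps)
  qed
  moreover have "cinner v (A \<cdot> v) = 0"
    by (simp add: A_def apply_bop_simps scaleR_scaleC[where 'a = 'h] cinner_scaleC_right cinner_add_right V_orth)
  ultimately have "cinner v (Y \<cdot> v) = 0"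
    using cinner_diff_right[of v 0 "A \<cdot> v"] by auto
  then show False
    using cinner_sqrt_one_minus_pos[OF norm_X v(1) X_half] by (simp add: Y_def)
qed

section \<open>The chain of an induced product representation\<close>

definition homogeneous :: "int \<Rightarrow> 'n::finite cuntz set" where
  "homogeneous n = {x. \<forall>\<theta>. gauge \<theta> x = cis (of_int n * \<theta>) *\<^sub>C x}"

lemma gauge_fixed_eq: "gauge_fixed = homogeneous 0"
  by (simp add: gauge_fixed_def homogeneous_def)

lemmas gauge_simps = star_hom_onD[OF star_hom_gauge]

lemma homogeneous_zero: "0 \<in> homogeneous n"
  by (simp add: homogeneous_def gauge_simps)

lemma homogeneous_one: "1 \<in> homogeneous 0"
  by (simp add: homogeneous_def gauge_simps)

lemma homogeneous_add: "x \<in> homogeneous n \<Longrightarrow> y \<in> homogeneous n \<Longrightarrow> x + y \<in> homogeneous n"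
  by (simp add: homogeneous_def gauge_simps scaleC_add_right)

lemma homogeneous_scaleC: "x \<in> homogeneous n \<Longrightarrow> c *\<^sub>C x \<in> homogeneous n"
  by (simp add: homogeneous_def gauge_simps scaleC_scaleC mult.commute)

lemma homogeneous_mult:
  "x \<in> homogeneous m \<Longrightarrow> y \<in> homogeneous n \<Longrightarrow> x * y \<in> homogeneous (m + n)"
  by (simp add: homogeneous_def gauge_simps mult_scaleC_left mult_scaleC_right scaleC_scaleC
      cis_mult distrib_right add.commute)

lemma homogeneous_star: "x \<in> homogeneous n \<Longrightarrow> star x \<in> homogeneous (- n)"
  by (simp add: homogeneous_def gauge_simps star_scaleC cis_cnj)

lemma homogeneous_gen: "cuntz_gen i \<in> homogeneous 1"
  by (simp add: homogeneous_def gauge_cuntz_gen)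

lemma homogeneous_star_gen: "star (cuntz_gen i) \<in> homogeneous (- 1)"
  by (rule homogeneous_star[OF homogeneous_gen])

lemma homogeneous_word: "cuntz_word J \<in> homogeneous (int (length J))"
proof (induction J)
  case (Cons i J)
  then show ?case
    using homogeneous_mult[OF homogeneous_gen[of i] Cons] by (simp add: cuntz_word_def)
qed (simp add: cuntz_word_def homogeneous_one)

lemma homogeneous_comb: "cuntz_comb w \<in> homogeneous 1"
proof -
  have "(\<Sum>i\<in>A. w $ i *\<^sub>C cuntz_gen i) \<in> homogeneous 1" for A
    by (induction A rule: infinite_finite_induct)
      (simp_all add: homogeneous_zero homogeneous_add homogeneous_scaleC homogeneous_gen)
  then show ?thesis
    by (simp add: cuntz_comb_def)
qed

lemma homogeneous_annihilators: "annihilators z n \<in> homogeneous (- int n)"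
proof (induction n)
  case (Suc n)
  then show ?case
    using homogeneous_mult[OF homogeneous_star[OF homogeneous_comb[of "z (Suc n)"]] Suc] by simp
qed (simp add: homogeneous_one)

lemma has_integral_cis:
  assumes "n \<noteq> (0::int)"
  shows "((\<lambda>\<theta>. cis (of_int n * \<theta>)) has_integral 0) {0..2 * pi}"
proof -
  define A where "A = \<i> * of_int n"
  have A: "A \<noteq> 0"
    using assms by (simp add: A_def)
  have cis: "exp (\<theta> *\<^sub>R A) = cis (of_int n * \<theta>)" for \<theta>
    by (simp add: A_def cis_conv_exp scaleR_conv_of_real mult_ac)
  have "((\<lambda>\<theta>. exp (\<theta> *\<^sub>R A) * A * inverse A) has_integral
      exp ((2 * pi) *\<^sub>R A) * inverse A - exp (0 *\<^sub>R A) * inverse A) {0..2 * pi}"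
    by (intro fundamental_theorem_of_calculus has_vector_derivative_mult_left
        exp_scaleR_has_vector_derivative_right) simp
  moreover have "exp ((2 * pi) *\<^sub>R A) = 1"
    unfolding cis using cis_multiple_2pi[of "of_int n"] by (simp add: mult_ac)
  ultimately show ?thesis
    using A by (simp add: cis mult.assoc)
qed

lemma bounded_linear_scaleC_left: "bounded_linear (\<lambda>c. c *\<^sub>C (x::'a::complex_normed_vector))"
  by (rule bounded_linear_intro[where K = "norm x"])
    (simp_all add: scaleC_add_left norm_scaleC scaleR_scaleC[where 'a = 'a] scaleC_scaleC
      scaleR_conv_of_real)

text \<open>On weight \<open>n\<close> the average is the mean of a character of the circle, which
  vanishes unless the character is trivial.\<close>

lemma gauge_expectation_homogeneous:
  assumes "x \<in> homogeneous n"
  shows "gauge_expectation x = (if n = 0 then x else 0)"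
proof (cases "n = 0")
  case True
  have "((\<lambda>\<theta>. x) has_integral (2 * pi) *\<^sub>R x) {0..2 * pi}"
    using has_integral_const_real[of x 0 "2 * pi"] by simp
  moreover have "gauge \<theta> x = x" for \<theta>
    using assms True by (simp add: homogeneous_def)
  ultimately show ?thesis
    using True by (simp add: gauge_expectation_def integral_unique)
next
  case False
  have "((\<lambda>c. c *\<^sub>C x) \<circ> (\<lambda>\<theta>. cis (of_int n * \<theta>)) has_integral 0 *\<^sub>C x) {0..2 * pi}"
    by (rule has_integral_linear[OF has_integral_cis[OF False] bounded_linear_scaleC_left])
  moreover have "gauge \<theta> x = cis (of_int n * \<theta>) *\<^sub>C x" for \<theta>
    using assms by (simp add: homogeneous_def)
  ultimately show ?thesis
    using False by (simp add: gauge_expectation_def integral_unique o_def)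
qed

section \<open>Values of the induced state on words\<close>

lemma product_tensor_in_power: "product_tensor z r \<in> tensor_power r"
proof (induction r)
  case (Suc r)
  have "length (butlast L) \<noteq> r" if "L \<noteq> []" "length L \<noteq> Suc r" for L :: "'a list"
    using that by (cases L rule: rev_cases) auto
  with Suc show ?case
    by (auto simp: tensor_power_def tensor_snoc_def)
qed (simp add: tensor_power_def)

lemma product_tensor_snoc: "product_tensor z (Suc r) (J @ [i]) = product_tensor z r J * z (Suc r) $ i"
  by (simp add: tensor_snoc_def)

lemma finite_words: "finite {L :: 'n::finite list. length L = r}"
  using finite_lists_length_eq[of "UNIV :: 'n set" r] by simp

text \<open>Tensoring with the next \<open>z\<close> is the connecting map of the limit, so the
  defining sequence is constant from index 1 on.\<close>

lemma product_vector_eq: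
  assumes "product_limit z \<iota>" "r \<ge> 1"
  shows "product_vector z \<iota> = \<iota> r (product_tensor z r)"
proof -
  have step_eq: "\<iota> (Suc r) (product_tensor z (Suc r)) = \<iota> r (product_tensor z r)" if "r \<ge> 1" for r
    using assms(1) that product_tensor_in_power[of z r] by (simp add: product_limit_def)
  have const: "\<iota> r (product_tensor z r) = \<iota> 1 (product_tensor z 1)" if "r \<ge> 1" for r
    using that
  proof (induction rule: dec_induct)
    case (step r)
    then show ?case using step_eq[of r] by simp
  qed simp
  \<comment> \<open>\<open>\<iota> 0\<close> is unconstrained, hence the shift by one before taking
    limits.\<close>
  have "(\<lambda>r. \<iota> (r + 1) (product_tensor z (r + 1))) = (\<lambda>_. \<iota> 1 (product_tensor z 1))"
    by (rule ext, rule const) simp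
  then have "(\<lambda>r. \<iota> (r + 1) (product_tensor z (r + 1))) \<longlonglongrightarrow> \<iota> 1 (product_tensor z 1)"
    by (simp only: tendsto_const)
  then have "(\<lambda>r. \<iota> r (product_tensor z r)) \<longlonglongrightarrow> \<iota> 1 (product_tensor z 1)"
    by (rule LIMSEQ_offset)
  then show ?thesis
    using const[OF assms(2)] by (simp add: product_vector_def limI)
qed

lemma induced_state_homogeneous:
  assumes "product_limit_representation z \<iota> a\<^sub>0" "x \<in> homogeneous n" "n \<noteq> 0"
  shows "induced_state z \<iota> a\<^sub>0 x = 0"
proof -
  have "star_hom_on gauge_fixed a\<^sub>0"
    using assms(1) by (simp add: product_limit_representation_def)
  \<comment> \<open>\<open>a\<^sub>0\<close> is a homomorphism on \<open>gauge_fixed\<close> only,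
    so its value at 0 has to be obtained there.\<close>
  then have "a\<^sub>0 (0 + 0) = a\<^sub>0 0 + a\<^sub>0 0"
    using homogeneous_zero[of 0] unfolding gauge_fixed_eq star_hom_on_def by blast
  then show ?thesis
    by (simp add: induced_state_def gauge_expectation_homogeneous[OF assms(2)] assms(3) apply_bop_simps)
qed

lemma induced_state_word:
  assumes lim: "product_limit_representation z \<iota> a\<^sub>0" and z: "norm (z 1) = 1"
    and len: "length J = r" "length K = r"
  shows "induced_state z \<iota> a\<^sub>0 (cuntz_word J * star (cuntz_word K)) =
    cnj (product_tensor z r J) * product_tensor z r K"
proof -
  have pl: "product_limit z \<iota>"
    using lim by (simp add: product_limit_representation_def)
  have inner: "cinner (\<iota> r \<xi>) (\<iota> r \<eta>) = tensor_inner r \<xi> \<eta>"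
    if "r \<ge> 1" "\<xi> \<in> tensor_power r" "\<eta> \<in> tensor_power r" for r \<xi> \<eta>
    using pl that by (auto simp: product_limit_def)
  have "cuntz_word J * star (cuntz_word K) \<in> homogeneous 0"
    using homogeneous_mult[OF homogeneous_word[of J] homogeneous_star[OF homogeneous_word[of K]]]
    by (simp add: len)
  then have E: "gauge_expectation (cuntz_word J * star (cuntz_word K)) = cuntz_word J * star (cuntz_word K)"
    by (simp add: gauge_expectation_homogeneous)
  show ?thesis
  proof (cases "r = 0")
    \<comment> \<open>The limit starts at the first tensor power, so for empty words the squared
      norm of the product vector is computed at level 1, where it is that of
      \<open>z 1\<close>.\<close>
    case True
    then have JK: "J = []" "K = []"
      using len by auto
    have "star_hom_on gauge_fixed a\<^sub>0"
      using lim by (simp add: product_limit_representation_def)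
    then have one: "a\<^sub>0 1 = 1"
      by (simp add: star_hom_on_def)
    have words: "{L :: 'a list. length L = 1} = (\<lambda>i. [i]) ` UNIV"
      by (auto simp: length_Suc_conv)
    have "cinner (product_vector z \<iota>) (product_vector z \<iota>) =
        tensor_inner 1 (product_tensor z 1) (product_tensor z 1)"
      by (simp add: product_vector_eq[OF pl, of 1] inner product_tensor_in_power del: One_nat_def)
    also have "\<dots> = vinner (z 1) (z 1)"
      unfolding tensor_inner_def words
      by (subst sum.reindex) (simp_all add: inj_on_def vinner_def tensor_snoc_def)
    also have "\<dots> = 1"
      using vinner_self[of "z 1"] unfolding z by simp
    finally show ?thesis
      using E True by (simp add: induced_state_def JK cuntz_word_def one apply_bop_simps)
  next
    case False
    let ?p = "product_tensor z r"
    have act: "a\<^sub>0 (cuntz_word J * star (cuntz_word K)) \<cdot> \<iota> r ?p = \<iota> r (tensor_matrix_unit J K ?p)"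
      using lim len False product_tensor_in_power[of z r]
      by (simp add: product_limit_representation_def)
    have "tensor_matrix_unit J K ?p \<in> tensor_power r"
      using len by (auto simp: tensor_power_def tensor_matrix_unit_def)
    then have "induced_state z \<iota> a\<^sub>0 (cuntz_word J * star (cuntz_word K)) =
        tensor_inner r ?p (tensor_matrix_unit J K ?p)"
      using False by (simp add: induced_state_def E product_vector_eq[OF pl, of r] act inner
          product_tensor_in_power)
    also have "\<dots> = (\<Sum>L | length L = r. if L = J then cnj (?p J) * ?p K else 0)"
      unfolding tensor_inner_def tensor_matrix_unit_def by (rule sum.cong) auto
    also have "\<dots> = cnj (?p J) * ?p K"
      by (simp add: finite_words len)
    finally show ?thesis .
  qed
qed

text \<open>A rank-one Gram matrix forces all \<open>s\<^sub>i\<^sup>* \<omega>\<close> to be multiples of a single unit vector.\<close>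

lemma star_gen_of_gram:
  fixes \<pi> :: "'n::finite cuntz \<Rightarrow> 'h::chilbert_space bop"
  assumes w: "norm w = 1"
    and gram: "\<And>i j. cinner (star (\<pi> (cuntz_gen i)) \<cdot> \<omega>) (star (\<pi> (cuntz_gen j)) \<cdot> \<omega>) = cnj (w $ i) * w $ j"
  shows "star (\<pi> (cuntz_gen i)) \<cdot> \<omega> = (w $ i) *\<^sub>C star (comb_op \<pi> w) \<cdot> \<omega>"
    and "norm (star (comb_op \<pi> w) \<cdot> \<omega>) = 1"
proof -
  define v where "v i = star (\<pi> (cuntz_gen i)) \<cdot> \<omega>" for i
  define u where "u = star (comb_op \<pi> w) \<cdot> \<omega>"
  have u: "u = (\<Sum>i\<in>UNIV. cnj (w $ i) *\<^sub>C v i)"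
    by (simp add: u_def v_def apply_star_comb_op)
  have ww: "(\<Sum>i\<in>UNIV. cnj (w $ i) * w $ i) = 1"
    using vinner_self[of w] w by (simp add: vinner_def)
  have vv: "cinner (v i) (v j) = cnj (w $ i) * w $ j" for i j
    by (simp add: v_def gram)
  have vu: "cinner (v i) u = cnj (w $ i)" for i
  proof -
    have "cinner (v i) u = cnj (w $ i) * (\<Sum>j\<in>UNIV. cnj (w $ j) * w $ j)"
      by (simp add: u cinner_sum_right cinner_scaleC_right vv sum_distrib_left mult_ac)
    then show ?thesis by (simp add: ww)
  qed
  have uu: "cinner u u = 1"
  proof -
    have "cinner u u = (\<Sum>i\<in>UNIV. cinner (cnj (w $ i) *\<^sub>C v i) u)"
      by (subst (1) u) (rule cinner_sum_left)
    then show ?thesis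
      using ww by (simp add: cinner_scaleC_left vu mult.commute)
  qed
  then show "norm (star (comb_op \<pi> w) \<cdot> \<omega>) = 1"
    unfolding u_def using norm_ge_zero[of "star (comb_op \<pi> w) \<cdot> \<omega>"]
    by (simp add: cinner_self power2_eq_1_iff flip: of_real_power)
  have uv: "cinner u (v i) = w $ i" for i
    using vu[of i] cinner_commute[of u "v i"] by simp
  have "cinner (v i - (w $ i) *\<^sub>C u) (v i - (w $ i) *\<^sub>C u) = 0"
    by (simp add: cinner_diff_left cinner_diff_right cinner_scaleC_left cinner_scaleC_right
        vv vu uv uu)
  then show "star (\<pi> (cuntz_gen i)) \<cdot> \<omega> = (w $ i) *\<^sub>C star (comb_op \<pi> w) \<cdot> \<omega>"
    by (simp add: cinner_self v_def u_def)
qed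

text \<open>For words of length \<open>r\<close> the vectors \<open>s_J^* \<Omega>\<close> have a
  rank-one Gram matrix, and induction on \<open>r\<close> shows each to be the
  \<open>J\<close>-coefficient of the product tensor times one unit vector
  \<open>\<omega> r\<close>. Vectors of different index are orthogonal because their gauge weights
  differ.\<close>

lemma induced_chain:
  fixes a :: "'n::finite cuntz \<Rightarrow> 'h::chilbert_space bop"
  assumes ind: "induced_product_representation z \<iota> a\<^sub>0 a" and z: "\<forall>n\<ge>1. norm (z n) = 1"
  obtains \<omega> where "representation a" "product_chain a z \<omega>" "orthonormal \<omega>" "cyclic_vector a (\<omega> 0)"
    "\<And>n. \<omega> n = a (annihilators z n) \<cdot> \<omega> 0"
    "\<And>m n x y. x \<in> homogeneous m \<Longrightarrow> y \<in> homogeneous n \<Longrightarrow> m \<noteq> n \<Longrightarrow>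
      cinner (a x \<cdot> \<omega> 0) (a y \<cdot> \<omega> 0) = 0"
proof -
  have lim: "product_limit_representation z \<iota> a\<^sub>0" and rep: "representation a"
    using ind by (auto simp: induced_product_representation_def gns_representation_def)
  obtain \<Omega> where cyc: "cyclic_vector a \<Omega>"
      and state: "\<And>x. induced_state z \<iota> a\<^sub>0 x = cinner \<Omega> (a x \<cdot> \<Omega>)"
    using ind by (auto simp: induced_product_representation_def gns_representation_def)
  note hom = star_hom_onD[OF rep]
  define \<omega> where "\<omega> n = a (annihilators z n) \<cdot> \<Omega>" for n
  have \<omega>0: "\<omega> 0 = \<Omega>"
    by (simp add: \<omega>_def hom apply_bop_simps)
  have \<omega>_Suc: "\<omega> (Suc n) = star (comb_op a (z (Suc n))) \<cdot> \<omega> n" for n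
    by (simp add: \<omega>_def hom apply_bop_simps comb_op_eq[OF rep])
  have gram: "cinner (star (a (cuntz_word J)) \<cdot> \<Omega>) (star (a (cuntz_word K)) \<cdot> \<Omega>) =
      cnj (product_tensor z r J) * product_tensor z r K" if "length J = r" "length K = r" for J K r
    using induced_state_word[OF lim _ that] z by (simp add: state hom apply_bop_simps cinner_star_left)
  have snoc: "star (a (cuntz_word (J @ [i]))) \<cdot> \<Omega> = star (a (cuntz_gen i)) \<cdot> star (a (cuntz_word J)) \<cdot> \<Omega>"
    for J i
    by (simp add: cuntz_word_def hom star_mult apply_bop_simps)
  \<comment> \<open>A word \<open>J\<close> with nonzero coefficient allows division: the Gram
    matrix of the words \<open>J @ [i]\<close> becomes that of the vectors
    \<open>s_i^* \<omega>_r\<close>, to which \<open>star_gen_of_gram\<close> applies.\<close>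
  have step: "star (a (cuntz_gen i)) \<cdot> \<omega> r = (z (Suc r) $ i) *\<^sub>C \<omega> (Suc r)" (is ?A)
      "norm (\<omega> (Suc r)) = 1" (is ?B)
    if J: "length J = r" "product_tensor z r J \<noteq> 0"
      and words: "\<And>J. length J = r \<Longrightarrow> star (a (cuntz_word J)) \<cdot> \<Omega> = product_tensor z r J *\<^sub>C \<omega> r"
    for r J i
  proof -
    let ?c = "product_tensor z r J"
    have "cinner (star (a (cuntz_gen i)) \<cdot> \<omega> r) (star (a (cuntz_gen j)) \<cdot> \<omega> r) =
        cnj (z (Suc r) $ i) * z (Suc r) $ j" for i j
    proof -
      have "cnj ?c * ?c * cinner (star (a (cuntz_gen i)) \<cdot> \<omega> r) (star (a (cuntz_gen j)) \<cdot> \<omega> r) =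
          cinner (star (a (cuntz_word (J @ [i]))) \<cdot> \<Omega>) (star (a (cuntz_word (J @ [j]))) \<cdot> \<Omega>)"
        by (simp add: snoc words[OF J(1)] apply_bop_scaleC cinner_scaleC_left cinner_scaleC_right mult_ac)
      also have "\<dots> = cnj ?c * ?c * (cnj (z (Suc r) $ i) * z (Suc r) $ j)"
        using gram[of "J @ [i]" "Suc r" "J @ [j]"] J(1)
        by (simp add: product_tensor_snoc mult_ac del: product_tensor.simps)
      finally show ?thesis
        using J(2) by simp
    qed
    then show ?A ?B
      unfolding \<omega>_Suc using z by (intro star_gen_of_gram; simp)+
  qed
  \<comment> \<open>The existence of a nonzero coefficient is part of the induction, since the next
    step divides by it.\<close>
  have main: "norm (\<omega> r) = 1 \<and> (\<exists>J. length J = r \<and> product_tensor z r J \<noteq> 0) \<and>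
      (\<forall>J. length J = r \<longrightarrow> star (a (cuntz_word J)) \<cdot> \<Omega> = product_tensor z r J *\<^sub>C \<omega> r)" for r
  proof (induction r)
    case 0
    have "cinner \<Omega> \<Omega> = 1"
      using gram[of "[]" 0 "[]"] by (simp add: cuntz_word_def hom apply_bop_simps)
    then have "norm \<Omega> = 1"
      using norm_ge_zero[of \<Omega>] by (simp add: cinner_self power2_eq_1_iff flip: of_real_power)
    then show ?case
      by (simp add: \<omega>0 cuntz_word_def hom apply_bop_simps)
  next
    case (Suc r)
    then obtain J where J: "length J = r" "product_tensor z r J \<noteq> 0" by blast
    have words: "star (a (cuntz_word J)) \<cdot> \<Omega> = product_tensor z r J *\<^sub>C \<omega> r" if "length J = r" for J
      using Suc that by blast
    note step = step[OF J words]
    have "z (Suc r) \<noteq> 0"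
      using z by (metis le_add1 norm_zero plus_1_eq_Suc zero_neq_one)
    then obtain i where "z (Suc r) $ i \<noteq> 0"
      by (auto simp: vec_eq_iff)
    then have "product_tensor z (Suc r) (J @ [i]) \<noteq> 0"
      using J(2) by (simp add: product_tensor_snoc del: product_tensor.simps)
    moreover have "star (a (cuntz_word K)) \<cdot> \<Omega> = product_tensor z (Suc r) K *\<^sub>C \<omega> (Suc r)"
      if "length K = Suc r" for K
    proof -
      obtain L i where K: "K = L @ [i]" "length L = r"
        using \<open>length K = Suc r\<close> by (metis length_Suc_conv_rev)
      show ?thesis
        by (simp add: K snoc words[OF K(2)] apply_bop_scaleC step(1) scaleC_scaleC product_tensor_snoc
            del: product_tensor.simps)
    qed
    ultimately show ?case
      using step(2) J(1) by (intro conjI exI[of _ "J @ [i]"]) auto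
  qed
  have chain: "product_chain a z \<omega>"
    unfolding product_chain_def
  proof (intro allI)
    fix m i
    obtain J where "length J = m" "product_tensor z m J \<noteq> 0"
      using main by blast
    then show "star (a (cuntz_gen i)) \<cdot> \<omega> m = (z (Suc m) $ i) *\<^sub>C \<omega> (Suc m)"
      by (rule step(1)) (use main in blast)
  qed
  have orth: "cinner (a x \<cdot> \<Omega>) (a y \<cdot> \<Omega>) = 0"
    if "x \<in> homogeneous m" "y \<in> homogeneous n" "m \<noteq> n" for m n x y
  proof -
    have "induced_state z \<iota> a\<^sub>0 (star x * y) = 0"
      using homogeneous_mult[OF homogeneous_star[OF that(1)] that(2)] that(3)
      by (intro induced_state_homogeneous[OF lim]) auto
    then show ?thesis
      by (simp add: state hom apply_bop_simps cinner_star_right)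
  qed
  have "orthonormal \<omega>"
    unfolding orthonormal_def
  proof (intro allI)
    fix m n
    show "cinner (\<omega> m) (\<omega> n) = (if m = n then 1 else 0)"
      using main[THEN conjunct1, of m]
        orth[OF homogeneous_annihilators[of z m] homogeneous_annihilators[of z n]]
      by (cases "m = n") (simp_all add: \<omega>_def cinner_self)
  qed
  then show ?thesis
  proof (rule that[OF rep chain])
    show "cyclic_vector a (\<omega> 0)"
      unfolding \<omega>0 by (rule cyc)
    show "\<omega> n = a (annihilators z n) \<cdot> \<omega> 0" for n
      unfolding \<omega>0 by (rule \<omega>_def)
    show "cinner (a x \<cdot> \<omega> 0) (a y \<cdot> \<omega> 0) = 0"
      if "x \<in> homogeneous m" "y \<in> homogeneous n" "m \<noteq> n" for m n x y
      unfolding \<omega>0 using that by (rule orth)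
  qed
qed

section \<open>Equivalence, irreducibility and the gauge grading\<close>

lemma chains_unitarily_equivalent:
  assumes "representation \<pi>" "product_chain \<pi> z \<omega>" "orthonormal \<omega>"
    and "closure (chain_span \<pi> \<omega>) = UNIV"
    and "representation \<rho>" "product_chain \<rho> z \<eta>" "orthonormal \<eta>"
    and "closure (chain_span \<rho> \<eta>) = UNIV"
  shows "unitarily_equivalent \<pi> \<rho>"
proof (rule chain_unitary[OF assms])
  fix U
  assume "surj U" "\<And>x y. U (x + y) = U x + U y" "\<And>c x. U (c *\<^sub>C x) = c *\<^sub>C U x"
    "\<And>x y. cinner (U x) (U y) = cinner x y" "\<And>a x. U (\<pi> a \<cdot> x) = \<rho> a \<cdot> U x"
  then show ?thesis
    unfolding unitarily_equivalent_def by blast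
qed

lemma cyclic_chain_dense:
  assumes "representation \<pi>" "product_chain \<pi> z \<omega>" "cyclic_vector \<pi> (\<omega> 0)"
  shows "closure (chain_span \<pi> \<omega>) = UNIV"
  by (rule chain_span_dense[OF assms subsetD[OF closure_subset chain_span.base]])

text \<open>Finitely many terms do not affect summability, so only the difference of the starting
  indices matters.\<close>

lemma summable_shifted_overlaps:
  fixes z y :: "nat \<Rightarrow> complex ^ 'n::finite"
  assumes "summable (\<lambda>i. 1 - cmod (vinner (z (Suc (m + i))) (y (Suc (n + i)))))"
  shows "m \<le> n \<Longrightarrow> summable (\<lambda>i. 1 - cmod (vinner (z (Suc i)) (y (Suc i + (n - m)))))"
    and "n \<le> m \<Longrightarrow> summable (\<lambda>i. 1 - cmod (vinner (z (Suc i + (m - n))) (y (Suc i))))"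
proof -
  show "summable (\<lambda>i. 1 - cmod (vinner (z (Suc i)) (y (Suc i + (n - m)))))" if "m \<le> n"
  proof (subst summable_iff_shift[where k = m, symmetric])
    show "summable (\<lambda>i. 1 - cmod (vinner (z (Suc (i + m))) (y (Suc (i + m) + (n - m)))))"
      using assms that by (simp add: add.commute)
  qed
  show "summable (\<lambda>i. 1 - cmod (vinner (z (Suc i + (m - n))) (y (Suc i))))" if "n \<le> m"
  proof (subst summable_iff_shift[where k = n, symmetric])
    show "summable (\<lambda>i. 1 - cmod (vinner (z (Suc (i + n) + (m - n))) (y (Suc (i + n)))))"
      using assms that by (simp add: add.commute)
  qed
qed

text \<open>An equivalence brings both chains into one representation, where divergent overlaps
  would make them orthogonal. Conversely, summable overlaps give one representation a chain for the
  sequence of the other, and a dense orthonormal chain determines its representation.\<close>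

lemma unitarily_equivalent_iff_overlaps:
  fixes \<pi> :: "'n::finite cuntz \<Rightarrow> 'h::chilbert_space bop"
    and \<rho> :: "'n cuntz \<Rightarrow> 'g::chilbert_space bop"
  assumes \<pi>: "representation \<pi>" and \<omega>: "product_chain \<pi> z \<omega>" "orthonormal \<omega>" "cyclic_vector \<pi> (\<omega> 0)"
    and \<rho>: "representation \<rho>" and \<eta>: "product_chain \<rho> y \<eta>" "orthonormal \<eta>" "cyclic_vector \<rho> (\<eta> 0)"
    and z: "\<And>n. norm (z (Suc n)) = 1" and y: "\<And>n. norm (y (Suc n)) = 1"
  shows "unitarily_equivalent \<pi> \<rho> \<longleftrightarrow>
    (\<exists>k. summable (\<lambda>n. 1 - cmod (vinner (z (Suc n)) (y (Suc n + k)))) \<or>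
         summable (\<lambda>n. 1 - cmod (vinner (z (Suc n + k)) (y (Suc n)))))" (is "_ \<longleftrightarrow> ?R")
proof
  assume "unitarily_equivalent \<pi> \<rho>"
  then obtain U where U: "\<And>c x. U (c *\<^sub>C x) = c *\<^sub>C U x"
      "\<And>x y. cinner (U x) (U y) = cinner x y" "\<And>a x. U (\<pi> a \<cdot> x) = \<rho> a \<cdot> U x"
    by (auto simp: unitarily_equivalent_def)
  have U_star: "star (\<rho> a) \<cdot> U x = U (star (\<pi> a) \<cdot> x)" for a x
    by (simp add: U(3) flip: star_hom_onD(4)[OF \<pi>] star_hom_onD(4)[OF \<rho>])
  define \<xi> where "\<xi> n = U (\<omega> n)" for n
  have \<xi>: "product_chain \<rho> z \<xi>"
    using \<omega>(1) by (simp add: product_chain_def \<xi>_def U_star U(1))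
  have norm_\<xi>: "norm (\<xi> n) = 1" for n
    using norm_eq_of_cinner[OF U(2)] orthonormal_norm[OF \<omega>(2)] by (simp add: \<xi>_def)
  show ?R
  proof (rule ccontr)
    assume "\<not> ?R"
    then have no: "\<not> summable (\<lambda>i. 1 - cmod (vinner (z (Suc i)) (y (Suc i + k))))"
        "\<not> summable (\<lambda>i. 1 - cmod (vinner (z (Suc i + k)) (y (Suc i))))" for k
      by blast+
    have "\<not> summable (\<lambda>i. 1 - cmod (vinner (z (Suc (n + i))) (y (Suc (m + i)))))" for m n
    proof
      assume "summable (\<lambda>i. 1 - cmod (vinner (z (Suc (n + i))) (y (Suc (m + i)))))"
      note shifted = summable_shifted_overlaps[OF this]
      show False
        using shifted(1) shifted(2) no(1)[of "m - n"] no(2)[of "n - m"] nat_le_linear[of m n]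
        by argo
    qed
    then have "cinner (\<eta> m) (\<xi> n) = 0" for m n
      by (intro chains_orthogonal[OF \<rho> \<eta>(1) \<xi>])
        (simp_all add: y z norm_\<xi> orthonormal_norm[OF \<eta>(2)] cmod_vinner_commute[of "y _"])
    then have "\<xi> 0 = 0"
      by (rule chain_orthogonal_span[OF cyclic_chain_dense[OF \<rho> \<eta>(1,3)] \<xi>])
    with norm_\<xi>[of 0] show False by simp
  qed
next
  assume ?R
  then obtain k where "summable (\<lambda>n. 1 - cmod (vinner (z (Suc n)) (y (Suc n + k)))) \<or>
      summable (\<lambda>n. 1 - cmod (vinner (z (Suc n + k)) (y (Suc n))))" by blast
  then show "unitarily_equivalent \<pi> \<rho>"
  proof
    assume "summable (\<lambda>n. 1 - cmod (vinner (z (Suc n)) (y (Suc n + k))))"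
    then obtain \<xi> where "product_chain \<rho> z \<xi>" "orthonormal \<xi>" "closure (chain_span \<rho> \<xi>) = UNIV"
      using chain_exists[where y = y and z = z, OF \<rho> \<eta> y z] by blast
    then show ?thesis
      by (rule chains_unitarily_equivalent[OF \<pi> \<omega>(1,2) cyclic_chain_dense[OF \<pi> \<omega>(1,3)] \<rho>])
  next
    assume "summable (\<lambda>n. 1 - cmod (vinner (z (Suc n + k)) (y (Suc n))))"
    \<comment> \<open>Here the roles are exchanged: the new chain is for \<open>y\<close> and lives
      in \<open>\<pi>\<close>.\<close>
    then have "summable (\<lambda>n. 1 - cmod (vinner (y (Suc n)) (z (Suc n + k))))"
      by (simp add: cmod_vinner_commute[of "y _"])
    then obtain \<xi> where "product_chain \<pi> y \<xi>" "orthonormal \<xi>" "closure (chain_span \<pi> \<xi>) = UNIV"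
      using chain_exists[where y = z and z = y, OF \<pi> \<omega> z y] by blast
    then show ?thesis
      by (rule chains_unitarily_equivalent[OF \<pi> _ _ _ \<rho> \<eta>(1,2) cyclic_chain_dense[OF \<rho> \<eta>(1,3)]])
  qed
qed

text \<open>If the overlaps of \<open>z\<close> with its shifts are not summable, the projection of \<open>\<omega>\<^sub>0\<close> onto an
  invariant subspace is a multiple of \<open>\<omega>\<^sub>0\<close>.\<close>

lemma irreducible_of_overlaps:
  fixes \<pi> :: "'n::finite cuntz \<Rightarrow> 'h::chilbert_space bop"
  assumes \<pi>: "representation \<pi>" and \<omega>: "product_chain \<pi> z \<omega>" "orthonormal \<omega>" "cyclic_vector \<pi> (\<omega> 0)"
    and z: "\<And>n. norm (z (Suc n)) = 1"
    and div: "\<And>k. k \<ge> 1 \<Longrightarrow> \<not> summable (\<lambda>n. 1 - cmod (vinner (z (Suc n)) (z (Suc n + k))))"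
  shows "irreducible_representation \<pi>"
  unfolding irreducible_representation_def
proof (intro conjI allI impI)
  note hom = star_hom_onD[OF \<pi>]
  show "representation \<pi>" by (rule \<pi>)
  show "(UNIV :: 'h set) \<noteq> {0}"
    using orthonormal_norm[OF \<omega>(2), of 0] by (metis UNIV_I norm_zero singletonD zero_neq_one)
  fix S :: "'h set"
  assume S: "subrepresentation_on UNIV \<pi> S"
  then have sub: "closed_csubspace S" and inv: "\<And>a x. x \<in> S \<Longrightarrow> \<pi> a \<cdot> x \<in> S"
    by (auto simp: subrepresentation_on_def)
  note subD = closed_csubspaceD[OF sub]
  have "\<exists>p. p \<in> S \<and> (\<forall>y\<in>S. cinner y (x - p) = 0)" for x
    using orthogonal_projection_exists[OF sub, of x] by metis
  then obtain P where P: "\<And>x. P x \<in> S" "\<And>x y. y \<in> S \<Longrightarrow> cinner y (x - P x) = 0"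
    by metis
  \<comment> \<open>Uniqueness of the projection: the difference lies in \<open>S\<close> and is
    orthogonal to \<open>S\<close>. Homogeneity of \<open>P\<close> and its commutation with the
    representation follow from it.\<close>
  have P_eq: "P x = p" if "p \<in> S" "\<And>y. y \<in> S \<Longrightarrow> cinner y (x - p) = 0" for x p
  proof -
    have "P x - p \<in> S"
      using P that by (intro subD) auto
    then have "cinner (P x - p) ((x - p) - (x - P x)) = 0"
      by (simp only: cinner_diff_right[of _ "x - p" "x - P x"] P(2) that(2) diff_self)
    then show ?thesis by (simp add: cinner_self)
  qed
  have P_scaleC: "P (c *\<^sub>C x) = c *\<^sub>C P x" for c x
  proof (rule P_eq)
    show "c *\<^sub>C P x \<in> S"
      using P(1) by (rule subD(4))
    show "cinner y (c *\<^sub>C x - c *\<^sub>C P x) = 0" if "y \<in> S" for y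
      using P(2)[OF that, of x] by (simp add: cinner_scaleC_right flip: scaleC_diff_right)
  qed
  have P_star: "P (star (\<pi> a) \<cdot> x) = star (\<pi> a) \<cdot> P x" for a x
  proof (rule P_eq)
    show "star (\<pi> a) \<cdot> P x \<in> S"
      using inv[OF P(1), of "star a"] by (simp add: hom)
    show "cinner y (star (\<pi> a) \<cdot> x - star (\<pi> a) \<cdot> P x) = 0" if "y \<in> S" for y
      using P(2)[OF inv[OF that, of a], of x] by (simp add: cinner_star_right flip: apply_bop_diff)
  qed
  define p where "p n = P (\<omega> n)" for n
  have p_chain: "product_chain \<pi> z p"
    using \<omega>(1) by (simp add: product_chain_def p_def P_scaleC flip: P_star)
  have p_le: "norm (p n) \<le> 1" for n
  proof -
    have "cinner (p n) (\<omega> n) = cinner (p n) (p n)"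
      using P(2)[OF P(1), of "\<omega> n" "\<omega> n"] by (simp add: p_def cinner_diff_right)
    then have "(norm (p n))\<^sup>2 = cmod (cinner (p n) (\<omega> n))"
      by (simp add: cinner_self norm_power)
    also have "\<dots> \<le> norm (p n) * 1"
      using cinner_cauchy_schwarz[of "p n" "\<omega> n"] by (simp add: orthonormal_norm[OF \<omega>(2)])
    finally show ?thesis
      by (cases "p n = 0") (simp_all add: power2_eq_square)
  qed
  have off: "cinner (\<omega> m) (p n) = 0" if "m \<noteq> n" for m n
  proof (rule chains_orthogonal[OF \<pi> \<omega>(1) p_chain])
    show "\<not> summable (\<lambda>i. 1 - cmod (vinner (z (Suc (m + i))) (z (Suc (n + i)))))"
    proof
      assume *: "summable (\<lambda>i. 1 - cmod (vinner (z (Suc (m + i))) (z (Suc (n + i)))))"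
      show False
      proof (cases "m \<le> n")
        case True
        with that have "n - m \<ge> 1" by simp
        then show False
          using summable_shifted_overlaps(1)[OF * True] div by blast
      next
        case False
        have "summable (\<lambda>i. 1 - cmod (vinner (z (Suc (n + i))) (z (Suc (m + i)))))"
          using * by (simp add: cmod_vinner_commute[of "z (Suc (n + _))"])
        moreover have "m - n \<ge> 1" "n \<le> m"
          using False by simp_all
        ultimately show False
          using summable_shifted_overlaps(1)[of z n z m] div by blast
      qed
    qed
  qed (simp_all add: z p_le orthonormal_norm[OF \<omega>(2)])
  define c where "c = cinner (\<omega> 0) (p 0)"
  \<comment> \<open>The overlap of \<open>z\<close> with itself is 1, so the diagonal inner products
    do not depend on the index.\<close>
  have diag: "cinner (\<omega> n) (p n) = c" for n
    using cinner_chains[OF \<pi> \<omega>(1) p_chain, of 0 0 n] by (simp add: c_def vinner_self z)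
  have "p 0 - c *\<^sub>C \<omega> 0 = 0"
  proof (rule chain_orthogonal_span[OF cyclic_chain_dense[OF \<pi> \<omega>(1,3)]])
    show "product_chain \<pi> z (\<lambda>n. p n - c *\<^sub>C \<omega> n)"
      using p_chain \<omega>(1) by (simp add: product_chain_def apply_bop_diff apply_bop_scaleC
          scaleC_diff_right scaleC_scaleC mult.commute)
    show "cinner (\<omega> m) (p n - c *\<^sub>C \<omega> n) = 0" for m n
      using \<omega>(2) by (cases "m = n")
        (simp_all add: cinner_diff_right cinner_scaleC_right diag off orthonormal_def)
  qed
  then have p0: "p 0 = c *\<^sub>C \<omega> 0" by simp
  have "cinner (p 0) (\<omega> 0 - p 0) = 0"
    using P(2)[OF P(1)] by (simp add: p_def)
  then have "cnj c * (1 - c) = 0"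
    using \<omega>(2) by (simp add: p0 cinner_diff_right cinner_scaleC_left cinner_scaleC_right
        orthonormal_def algebra_simps)
  then consider "c = 1" | "c = 0" by auto
  then show "S = {0} \<or> S = UNIV"
  proof cases
    case 1
    then have "\<omega> 0 \<in> S"
      using P(1)[of "\<omega> 0"] p0 by (simp add: p_def)
    then have "S = UNIV"
      by (intro cyclic_vector_subspace[OF \<omega>(3)] subD inv)
    then show ?thesis ..
  next
    case 2
    \<comment> \<open>The cyclic vector lies in the orthogonal complement of \<open>S\<close>, which
      is invariant and therefore everything.\<close>
    have orth: "cinner y (\<omega> 0) = 0" if "y \<in> S" for y
      using P(2)[OF that, of "\<omega> 0"] p0 2 by (simp add: p_def)
    have "{x. \<forall>y\<in>S. cinner y x = 0} = UNIV"
    proof (rule cyclic_vector_subspace[OF \<omega>(3)])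
      show "closed {x. \<forall>y\<in>S. cinner y x = 0}"
        by (rule closed_csubspaceD(1)[OF closed_csubspace_orthogonal])
      have "cinner y (\<pi> a \<cdot> \<omega> 0) = 0" if "y \<in> S" for a y
        using orth[OF inv[OF that, of "star a"]] by (simp add: hom cinner_star_left)
      then show "\<pi> a \<cdot> \<omega> 0 \<in> {x. \<forall>y\<in>S. cinner y x = 0}" for a
        by simp
    qed
    then have "cinner y y = 0" if "y \<in> S" for y
      using that by blast
    then have "S \<subseteq> {0}"
      by (auto simp: cinner_self)
    then show ?thesis
      using subD(2) by blast
  qed
qed

text \<open>Summability for some \<open>k \<ge> 1\<close> yields a second dense chain for the same
  \<open>z\<close>, starting orthogonally to \<open>\<omega> 0\<close>. The unitary carrying one
  chain to the other commutes with \<open>\<pi>\<close> and moves \<open>\<omega> 0\<close> to an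
  orthogonal vector.\<close>

lemma irreducible_iff_overlaps:
  fixes \<pi> :: "'n::finite cuntz \<Rightarrow> 'h::chilbert_space bop"
  assumes \<pi>: "representation \<pi>" and \<omega>: "product_chain \<pi> z \<omega>" "orthonormal \<omega>" "cyclic_vector \<pi> (\<omega> 0)"
    and z: "\<And>n. norm (z (Suc n)) = 1"
  shows "irreducible_representation \<pi> \<longleftrightarrow>
    (\<forall>k\<ge>1. \<not> summable (\<lambda>n. 1 - cmod (vinner (z (Suc n)) (z (Suc n + k)))))"
proof (intro iffI allI impI notI)
  fix k :: nat
  assume irr: "irreducible_representation \<pi>" and k: "k \<ge> 1"
    and sum: "summable (\<lambda>n. 1 - cmod (vinner (z (Suc n)) (z (Suc n + k))))"
  have "\<not> irreducible_representation \<pi>"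
  proof (rule chain_exists[where y = z and z = z, OF \<pi> \<omega> z z sum])
    fix \<xi>
    assume \<xi>: "product_chain \<pi> z \<xi>" "orthonormal \<xi>" "closure (chain_span \<pi> \<xi>) = UNIV"
      and "0 < k \<Longrightarrow> cinner (\<omega> 0) (\<xi> 0) = 0"
    with k have orth: "cinner (\<omega> 0) (\<xi> 0) = 0" by simp
    show ?thesis
    proof (rule chain_unitary[OF \<pi> \<omega>(1,2) cyclic_chain_dense[OF \<pi> \<omega>(1,3)] \<pi> \<xi>])
      fix U
      assume U: "surj U" "\<And>x y. U (x + y) = U x + U y" "\<And>c x. U (c *\<^sub>C x) = c *\<^sub>C U x"
          "\<And>x y. cinner (U x) (U y) = cinner x y" "\<And>a x. U (\<pi> a \<cdot> x) = \<pi> a \<cdot> U x"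
        and "\<And>m. U (\<omega> m) = \<xi> m"
      with orth have "cinner (\<omega> 0) (U (\<omega> 0)) = 0" by simp
      then show ?thesis
        by (rule reducible_of_commuting_unitary[OF \<pi> U orthonormal_norm[OF \<omega>(2)]])
    qed
  qed
  with irr show False by contradiction
qed (use irreducible_of_overlaps[OF assms] in blast)

text \<open>The summand of index \<open>n\<close> is the closure of the weight \<open>n\<close>
  elements applied to the cyclic vector. Elements of weight 0 preserve it, while generators and
  their adjoints shift the index by one, so the algebraic sum has an invariant closure.\<close>

lemma gauge_grading:
  fixes \<pi> :: "'n::finite cuntz \<Rightarrow> 'h::chilbert_space bop"
  assumes \<pi>: "representation \<pi>" and \<omega>: "orthonormal \<omega>" "cyclic_vector \<pi> (\<omega> 0)"
    and ann: "\<And>n. \<omega> n = \<pi> (annihilators z n) \<cdot> \<omega> 0"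
    and orth: "\<And>m n x y. x \<in> homogeneous m \<Longrightarrow> y \<in> homogeneous n \<Longrightarrow> m \<noteq> n \<Longrightarrow>
      cinner (\<pi> x \<cdot> \<omega> 0) (\<pi> y \<cdot> \<omega> 0) = 0"
  shows "\<exists>M :: int \<Rightarrow> 'h set.
    (\<forall>n. subrepresentation_on gauge_fixed \<pi> (M n) \<and> M n \<noteq> {0}) \<and> orthogonal_direct_sum M"
proof -
  note hom = star_hom_onD[OF \<pi>]
  define A where "A n = (\<lambda>x. \<pi> x \<cdot> \<omega> 0) ` homogeneous n" for n
  define M where "M n = closure (A n)" for n
  have A_apply: "\<pi> x \<cdot> v \<in> A (m + n)" if x: "x \<in> homogeneous m" and v: "v \<in> A n" for x v m n
  proof -
    obtain y where "y \<in> homogeneous n" "v = \<pi> y \<cdot> \<omega> 0"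
      using v by (auto simp: A_def)
    then show ?thesis
      unfolding A_def
      by (intro image_eqI[OF _ homogeneous_mult[OF x]]) (simp_all add: hom apply_bop_simps)
  qed
  have M_apply: "\<pi> x \<cdot> v \<in> M (m + n)" if "x \<in> homogeneous m" "v \<in> M n" for x v m n
    using that(2) unfolding M_def by (rule apply_bop_closure[rotated])
      (intro subsetD[OF closure_subset] A_apply that(1))
  have sub: "closed_csubspace (M n)" for n
    unfolding M_def
  proof (rule closed_csubspace_closure)
    show "0 \<in> A n"
      unfolding A_def by (rule image_eqI[OF _ homogeneous_zero]) (simp add: hom apply_bop_simps)
    show "c *\<^sub>C v \<in> A n" if v: "v \<in> A n" for c v
    proof -
      obtain x where "x \<in> homogeneous n" "v = \<pi> x \<cdot> \<omega> 0"
        using v by (auto simp: A_def)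
      then show ?thesis
        unfolding A_def by (intro image_eqI[OF _ homogeneous_scaleC]) (simp_all add: hom apply_scaleC_bop)
    qed
    show "v + w \<in> A n" if vw: "v \<in> A n" "w \<in> A n" for v w
    proof -
      obtain x y where "x \<in> homogeneous n" "v = \<pi> x \<cdot> \<omega> 0" "y \<in> homogeneous n" "w = \<pi> y \<cdot> \<omega> 0"
        using vw by (auto simp: A_def)
      then show ?thesis
        unfolding A_def
        by (intro image_eqI[of _ _ "x + y"] homogeneous_add) (simp_all add: hom apply_bop_simps)
    qed
  qed
  \<comment> \<open>Chain vectors cover the weights \<open>n \<le> 0\<close>; positive weights are
    reached by applying a generator, which is injective. Any generator serves, hence
    \<open>undefined\<close> as its index.\<close>
  have "\<exists>x\<in>homogeneous n. \<pi> x \<cdot> \<omega> 0 \<noteq> 0" for n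
  proof (cases "n \<le> 0")
    case True
    then have "annihilators z (nat (- n)) \<in> homogeneous n"
      using homogeneous_annihilators[of z "nat (- n)"] by simp
    moreover have "\<pi> (annihilators z (nat (- n))) \<cdot> \<omega> 0 \<noteq> 0"
      using orthonormal_norm[OF \<omega>(1), of "nat (- n)"] ann by (metis norm_zero zero_neq_one)
    ultimately show ?thesis by blast
  next
    case False
    have "\<exists>x\<in>homogeneous (int m). \<pi> x \<cdot> \<omega> 0 \<noteq> 0" for m
    proof (induction m)
      case 0
      have "\<omega> 0 \<noteq> 0"
        using orthonormal_norm[OF \<omega>(1), of 0] by auto
      then show ?case
        by (intro bexI[of _ 1]) (simp_all add: homogeneous_one hom apply_bop_simps)
    next
      case (Suc m)
      then obtain x where x: "x \<in> homogeneous (int m)" "\<pi> x \<cdot> \<omega> 0 \<noteq> 0" by blast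
      let ?g = "cuntz_gen undefined :: 'n cuntz"
      have "\<pi> ?g \<cdot> \<pi> x \<cdot> \<omega> 0 \<noteq> 0"
        using x(2) star_gen_gen[OF \<pi>, of undefined undefined "\<pi> x \<cdot> \<omega> 0"]
        by (auto simp: apply_bop_simps)
      then show ?case
        using homogeneous_mult[OF homogeneous_gen x(1)]
        by (intro bexI[of _ "?g * x"]) (simp_all add: hom apply_bop_simps)
    qed
    from this[of "nat n"] False show ?thesis by simp
  qed
  then have nonzero: "M n \<noteq> {0}" for n
    using closure_subset[of "A n"] by (auto simp: M_def A_def)
  have M_orth: "cinner v w = 0" if "m \<noteq> n" "v \<in> M m" "w \<in> M n" for m n v w
  proof -
    obtain V where V: "\<And>i. V i \<in> A m" "V \<longlonglongrightarrow> v"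
      using \<open>v \<in> M m\<close> unfolding M_def closure_sequential by blast
    obtain W where W: "\<And>i. W i \<in> A n" "W \<longlonglongrightarrow> w"
      using \<open>w \<in> M n\<close> unfolding M_def closure_sequential by blast
    have "cinner (V i) (W i) = 0" for i
      using V(1)[of i] W(1)[of i] \<open>m \<noteq> n\<close> orth by (auto simp: A_def)
    then show ?thesis
      using tendsto_cinner[OF V(2) W(2)] by (simp add: LIMSEQ_const_iff)
  qed
  define T where "T = {\<Sum>i\<in>F. v i | F v. finite F \<and> (\<forall>i\<in>F. v i \<in> M i)}"
  have TI: "(\<Sum>i\<in>F. v i) \<in> T" if "finite F" "\<And>i. i \<in> F \<Longrightarrow> v i \<in> M i" for F v
    unfolding T_def using that by blast
  have TE: "\<exists>F v. finite F \<and> (\<forall>i\<in>F. v i \<in> M i) \<and> u = (\<Sum>i\<in>F. v i)" if "u \<in> T" for u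
    using that unfolding T_def by blast
  have M_T: "v \<in> T" if "v \<in> M n" for v n
    using TI[of "{n}" "\<lambda>_. v"] that by simp
  have T_zero: "0 \<in> T"
    using TI[of "{}"] by simp
  have T_add: "u + u' \<in> T" if uT: "u \<in> T" "u' \<in> T" for u u'
  proof -
    obtain F v where F: "finite F" "\<And>i. i \<in> F \<Longrightarrow> v i \<in> M i" "u = (\<Sum>i\<in>F. v i)"
      using TE[OF uT(1)] by blast
    obtain F' v' where F': "finite F'" "\<And>i. i \<in> F' \<Longrightarrow> v' i \<in> M i" "u' = (\<Sum>i\<in>F'. v' i)"
      using TE[OF uT(2)] by blast
    have "u = (\<Sum>i\<in>F \<union> F'. if i \<in> F then v i else 0)"
      unfolding F(3) by (rule sum.mono_neutral_cong_left) (use F(1) F'(1) in auto)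
    moreover have "u' = (\<Sum>i\<in>F \<union> F'. if i \<in> F' then v' i else 0)"
      unfolding F'(3) by (rule sum.mono_neutral_cong_left) (use F(1) F'(1) in auto)
    ultimately have "u + u' = (\<Sum>i\<in>F \<union> F'. (if i \<in> F then v i else 0) + (if i \<in> F' then v' i else 0))"
      by (simp add: sum.distrib)
    also have "\<dots> \<in> T"
      using F F' closed_csubspaceD(2,3)[OF sub] by (intro TI) auto
    finally show ?thesis .
  qed
  have T_sum: "(\<Sum>i\<in>F. v i) \<in> T" if "\<And>i. i \<in> F \<Longrightarrow> v i \<in> T" for F :: "int set" and v
    using that by (induction F rule: infinite_finite_induct) (simp_all add: T_zero T_add)
  have T_scaleC: "c *\<^sub>C u \<in> T" if u: "u \<in> T" for c u
  proof -
    obtain F v where F: "finite F" "\<And>i. i \<in> F \<Longrightarrow> v i \<in> M i" "u = (\<Sum>i\<in>F. v i)"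
      using TE[OF u] by blast
    show ?thesis
      unfolding F(3) scaleC_sum_right
      by (rule T_sum, rule M_T, rule closed_csubspaceD(4)[OF sub F(2)])
  qed
  have T_apply: "\<pi> x \<cdot> u \<in> closure T" if x: "x \<in> homogeneous m" and u: "u \<in> closure T" for x m u
    using u
  proof (rule apply_bop_closure[rotated])
    fix u assume "u \<in> T"
    obtain F v where F: "finite F" "\<And>i. i \<in> F \<Longrightarrow> v i \<in> M i" "u = (\<Sum>i\<in>F. v i)"
      using TE[OF \<open>u \<in> T\<close>] by blast
    have "\<pi> x \<cdot> u \<in> T"
      unfolding F(3) apply_bop_sum by (rule T_sum, rule M_T, rule M_apply[OF x F(2)])
    then show "\<pi> x \<cdot> u \<in> closure T"
      using closure_subset by blast
  qed
  have subT: "closed_csubspace (closure T)"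
    by (rule closed_csubspace_closure[OF T_zero T_add T_scaleC])
  have "\<omega> 0 \<in> A 0"
    unfolding A_def by (rule image_eqI[OF _ homogeneous_one]) (simp add: hom apply_bop_simps)
  then have "\<omega> 0 \<in> T"
    using closure_subset by (intro M_T[of _ 0]) (auto simp: M_def)
  then have \<omega>T: "\<omega> 0 \<in> closure T"
    using closure_subset by blast
  have "\<pi> x \<cdot> \<omega> 0 \<in> closure T" for x
  proof (rule representation_invariant[OF \<pi> subT _ _ \<omega>T])
    show "\<pi> (cuntz_gen i) \<cdot> v \<in> closure T" "star (\<pi> (cuntz_gen i)) \<cdot> v \<in> closure T"
      if "v \<in> closure T" for i v
      using T_apply[OF homogeneous_gen that] T_apply[OF homogeneous_star_gen that] by (simp_all add: hom)
  qed
  then have "closure T = UNIV"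
    by (rule cyclic_vector_subspace[OF \<omega>(2) closed_closure])
  then have "orthogonal_direct_sum M"
    using M_orth by (simp add: orthogonal_direct_sum_def T_def)
  moreover have "subrepresentation_on gauge_fixed \<pi> (M n)" for n
    unfolding subrepresentation_on_def gauge_fixed_eq using sub M_apply[of _ 0 _ n] by simp
  ultimately show ?thesis
    using nonzero by (intro exI[of _ M]) simp
qed

theorem theorem3p3:
  fixes z y :: "nat \<Rightarrow> complex ^ 'n::finite"
    and \<iota>z :: "nat \<Rightarrow> ('n list \<Rightarrow> complex) \<Rightarrow> 'k::chilbert_space"
    and \<iota>y :: "nat \<Rightarrow> ('n list \<Rightarrow> complex) \<Rightarrow> 'l::chilbert_space"
    and a\<^sub>0z :: "'n cuntz \<Rightarrow> 'k bop" and a\<^sub>0y :: "'n cuntz \<Rightarrow> 'l bop"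
    and az :: "'n cuntz \<Rightarrow> 'h::chilbert_space bop" and ay :: "'n cuntz \<Rightarrow> 'g::chilbert_space bop"
  assumes "CARD('n) \<ge> 2"
    and "\<forall>n\<ge>1. norm (z n) = 1" and "\<forall>n\<ge>1. norm (y n) = 1"
    and "induced_product_representation z \<iota>z a\<^sub>0z az"
    and "induced_product_representation y \<iota>y a\<^sub>0y ay"
  shows
    "(unitarily_equivalent az ay \<longleftrightarrow>
        (\<exists>k. summable (\<lambda>n. 1 - cmod (vinner (z (Suc n)) (y (Suc n + k)))) \<or>
             summable (\<lambda>n. 1 - cmod (vinner (z (Suc n + k)) (y (Suc n)))))) \<and>
     (irreducible_representation az \<longleftrightarrow>
        (\<forall>k\<ge>1. \<not> summable (\<lambda>n. 1 - cmod (vinner (z (Suc n)) (z (Suc n + k)))))) \<and>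
     (\<exists>M :: int \<Rightarrow> 'h set.
        (\<forall>n. subrepresentation_on gauge_fixed az (M n) \<and> M n \<noteq> {0}) \<and> orthogonal_direct_sum M) \<and>
     GP_representation z az"
proof -
  have z: "norm (z (Suc n)) = 1" and y: "norm (y (Suc n)) = 1" for n
    using assms(2,3) by simp_all
  show ?thesis
  proof (rule induced_chain[OF assms(4,2)], rule induced_chain[OF assms(5,3)])
    fix \<omega> \<eta>
    assume \<omega>: "representation az" "product_chain az z \<omega>" "orthonormal \<omega>" "cyclic_vector az (\<omega> 0)"
        "\<And>n. \<omega> n = az (annihilators z n) \<cdot> \<omega> 0"
        "\<And>m n x y. x \<in> homogeneous m \<Longrightarrow> y \<in> homogeneous n \<Longrightarrow> m \<noteq> n \<Longrightarrow>
          cinner (az x \<cdot> \<omega> 0) (az y \<cdot> \<omega> 0) = 0"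
      and \<eta>: "representation ay" "product_chain ay y \<eta>" "orthonormal \<eta>" "cyclic_vector ay (\<eta> 0)"
    have "\<forall>m\<ge>1. \<forall>n\<ge>1. cinner (az (annihilators z m) \<cdot> \<omega> 0) (az (annihilators z n) \<cdot> \<omega> 0) =
        (if m = n then 1 else 0)"
      using \<omega>(3) unfolding \<omega>(5)[symmetric] orthonormal_def by blast
    then have "GP_representation z az"
      unfolding GP_representation_def
      using \<omega>(1,4) orthonormal_norm[OF \<omega>(3)] by blast
    then show ?thesis
      by (intro conjI unitarily_equivalent_iff_overlaps[OF \<omega>(1-4) \<eta> z y]
          irreducible_iff_overlaps[OF \<omega>(1-4) z] gauge_grading[OF \<omega>(1,3-6)])
  qed
qed

end
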